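(* Let $Z$ be a positive random variable with continuous distribution function $G$, and assume that there exists $\hat{x}>0$ such that $G\in C^2([0,\hat{x}])$ is strictly increasing on $[0,\hat{x}]$ with $\lambda:=G'(0+)>0$. Let $(s_n)_{n\in\mathbb{N}}$ be a sequence in $(0,\infty)$ with $s_n\to 0$, $s_n\log n\to\infty$ and $s_n^2\log n\to 0$. Let the edge weights of the complete graph $K_n$ satisfy $X_e\overset{d}{=}Z^{s_n}$. Then, with high probability, \[ (1-\epsilon_n)\, e\,\lfloor s_n\log n\rfloor\, u_n\le W_n\le e\,\lceil s_n\log n\rceil\, u_n, \] where $\epsilon_n=\sqrt{s_n\log\log n}=o(1)$. In particular, \[ \frac{W_n}{u_n s_n\log n}\overset{\mathbb{P}}{\longrightarrow} e\qquad\text{as } n\to\infty. \] Moreover, \[ \frac{H_n}{s_n\log n}\overset{\mathbb{P}}{\longrightarrow}1\qquad\text{as } n\to\infty. \]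
   Context: For each $n$, let $K_n$ be the complete graph with vertex set $[n]=\{1,\dots,n\}$ and edge set $\mathrm{E}_n$. The edge weights $(X_e)_{e\in \mathrm{E}_n}$ are positive i.i.d. random variables with continuous distribution function $F_n$. The weight of a path $p$ is $w(p)=\sum_{e\in p}X_e$. Let $\mathcal{S}_{1,2}$ be the set of self-avoiding paths between vertex $1$ and vertex $2$. $W_n=\min_{p\in\mathcal{S}_{1,2}}w(p)$ is the weight of the (almost surely unique) minimal weight path, and the hopcount $H_n$ is its number of edges. For $n$ large, $u_n$ denotes the unique positive value with $nF_n(u_n)=1$. Here $e$ in the bounds is Euler's number. A sequence of events $(A_n)$ occurs with high probability if $\mathbb{P}(A_n)\to1$; all limits are as $n\to\infty$. *)

theory Defs
  imports "HOL-Probability.Probability"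
begin

definition complete_graph_edges :: "nat \<Rightarrow> nat set set" where
  "complete_graph_edges n = {{i, j} | i j. i \<in> {1..n} \<and> j \<in> {1..n} \<and> i \<noteq> j}"

text \<open>A path is given by the list of its vertices, from its start to its end.\<close>

definition path_edges :: "nat list \<Rightarrow> nat set list" where
  "path_edges p = map2 (\<lambda>i j. {i, j}) p (tl p)"

definition self_avoiding_paths :: "nat \<Rightarrow> nat \<Rightarrow> nat \<Rightarrow> nat list set" where
  "self_avoiding_paths n a b =
     {p. p \<noteq> [] \<and> hd p = a \<and> last p = b \<and> distinct p \<and> set p \<subseteq> {1..n} \<and>
         set (path_edges p) \<subseteq> complete_graph_edges n}"

definition path_weight :: "(nat set \<Rightarrow> real) \<Rightarrow> nat list \<Rightarrow> real" where
  "path_weight x p = (\<Sum>e\<leftarrow>path_edges p. x e)"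

definition min_path_weight :: "nat \<Rightarrow> (nat set \<Rightarrow> real) \<Rightarrow> real" where
  "min_path_weight n x = Min (path_weight x ` self_avoiding_paths n 1 2)"

text \<open>The description below picks out a path only if the minimal weight path is unique; for
  independent edge weights with a continuous distribution function this holds almost surely.\<close>

definition min_weight_path :: "nat \<Rightarrow> (nat set \<Rightarrow> real) \<Rightarrow> nat list" where
  "min_weight_path n x =
     (THE p. p \<in> self_avoiding_paths n 1 2 \<and> path_weight x p = min_path_weight n x)"

definition hopcount :: "nat \<Rightarrow> (nat set \<Rightarrow> real) \<Rightarrow> nat" where
  "hopcount n x = length (path_edges (min_weight_path n x))"

definition iid_edge_weights ::
    "'a measure \<Rightarrow> nat \<Rightarrow> (nat set \<Rightarrow> 'a \<Rightarrow> real) \<Rightarrow> (real \<Rightarrow> real) \<Rightarrow> bool" where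
  "iid_edge_weights M n X F \<longleftrightarrow>
     prob_space M \<and>
     prob_space.indep_vars M (\<lambda>_. borel) X (complete_graph_edges n) \<and>
     (\<forall>e\<in>complete_graph_edges n. (AE \<omega> in M. 0 < X e \<omega>) \<and> cdf (distr M borel (X e)) = F) \<and>
     continuous_on UNIV F"

definition weight_scale :: "nat \<Rightarrow> (real \<Rightarrow> real) \<Rightarrow> real" where
  "weight_scale n F = (THE u. 0 < u \<and> real n * F u = 1)"

text \<open>Derivatives at the end points of the interval are one-sided.\<close>

definition C2_on_interval :: "real \<Rightarrow> real \<Rightarrow> (real \<Rightarrow> real) \<Rightarrow> bool" where
  "C2_on_interval a b f \<longleftrightarrow>
     (\<exists>f' f''. (\<forall>x\<in>{a..b}. (f has_real_derivative f' x) (at x within {a..b})) \<and>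
               (\<forall>x\<in>{a..b}. (f' has_real_derivative f'' x) (at x within {a..b})) \<and>
               continuous_on {a..b} f'')"

text \<open>The probability space may depend on \<open>n\<close>.  A set that is not measurable has
  measure 0 in HOL, hence the measurability requirement in the second definition; in the first
  one the limit 1 already forces the events to be measurable for all large \<open>n\<close>.\<close>

definition with_high_probability ::
    "(nat \<Rightarrow> 'a measure) \<Rightarrow> (nat \<Rightarrow> 'a \<Rightarrow> bool) \<Rightarrow> bool" where
  "with_high_probability M A \<longleftrightarrow>
     (\<lambda>n. measure (M n) {\<omega> \<in> space (M n). A n \<omega>}) \<longlonglongrightarrow> 1"

definition converges_in_probability ::
    "(nat \<Rightarrow> 'a measure) \<Rightarrow> (nat \<Rightarrow> 'a \<Rightarrow> real) \<Rightarrow> real \<Rightarrow> bool" where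
  "converges_in_probability M Y c \<longleftrightarrow>
     (\<forall>n. Y n \<in> borel_measurable (M n)) \<and>
     (\<forall>\<delta>>0. (\<lambda>n. measure (M n) {\<omega> \<in> space (M n). \<bar>Y n \<omega> - c\<bar> > \<delta>}) \<longlonglongrightarrow> 0)"

end

theory Submission
  imports Defs
begin

text \<open>
  Write \<open>\<alpha> = 1 / s\<^sub>n\<close>, so that an edge has weight at most \<open>y\<close> with probability about
  \<open>(y / u\<^sub>n)\<^sup>\<alpha> / n\<close>.

  Lower bound and hopcount: by the inequality of arithmetic and geometric means, a path with \<open>k\<close> edges
  and weight at most \<open>t u\<^sub>n\<close> satisfies \<open>\<Prod> X\<^sub>e\<^sup>-\<^sup>\<alpha> \<ge> (k / t u\<^sub>n)\<^sup>k\<^sup>\<alpha>\<close>.  Markov's inequality, with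
  \<open>X\<^sub>e\<^sup>-\<^sup>\<alpha>\<close> truncated where no weight occurs with high probability, bounds the expected number of such
  paths by \<open>(C ln n)\<^sup>k (t / k)\<^sup>k\<^sup>\<alpha> / n\<close>.  The exponent \<open>\<alpha> k ln (t / k)\<close> is maximal for \<open>k = t / e\<close>, and strictly
  smaller away from it; compared with \<open>ln n\<close> this gives both claims.

  Upper bound: let \<open>k = \<lceil>s\<^sub>n ln n\<rceil>\<close>, \<open>d = n\<^sup>1\<^sup>/\<^sup>k\<close> and \<open>\<theta> = u\<^sub>n d\<^sup>1\<^sup>/\<^sup>\<alpha> \<le> e u\<^sub>n\<close>, so that the edges of weight at
  most \<open>\<theta>\<close> form a random graph of average degree about \<open>d\<close>.  Since \<open>d\<close> exceeds every fixed power of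
  \<open>ln n\<close>, Chernoff's bound survives a union over all vertex sets: every small set \<open>A\<close> has
  at least \<open>(1 - O(1 / k)) d |A|\<close> neighbours.  Hence about \<open>n / d\<close> vertices are reached from vertex 1
  within \<open>k - 1\<close> steps avoiding vertex 2.  A last edge from there to vertex 2 exists only with
  probability bounded away from 0, but letting the last two thresholds be \<open>\<theta> (1 + i s\<^sub>n)\<close> and
  \<open>\<theta> (1 - i s\<^sub>n)\<close> for \<open>i < I\<close> gives \<open>I\<close> nearly independent chances, so the failure probability is
  \<open>exp (- c I)\<close> with \<open>I\<close> arbitrary.
\<close>

section \<open>Real analysis\<close>

text \<open>The upper bound has no error factor. When \<open>s n * ln n\<close> is an integer,
  \<open>\<theta>\<close> is exactly \<open>exp 1 * u n\<close>, and the expected number of paths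
  with \<open>k\<close> edges that all weigh at most \<open>\<theta>\<close> is about
  \<open>d ^ k / n = 1\<close>. So growth may lose only a constant factor in total, and the constant
  failure probability at the last edge cannot be removed by enlarging all thresholds. Both
  constraints shape the proof. A loss of \<open>(1 - 1 / k) ^ 3\<close> in each generation leaves at
  least a factor \<open>exp (- 6)\<close> overall, which asks for Chernoff's bound with relative
  deviation \<open>1 / k\<close> and hence for \<open>d\<close> beyond
  \<open>k\<^sup>2 * ln n\<close>. This holds because \<open>s\<^sup>2 * ln n\<close> tends to 0:
  then \<open>k\<^sup>2 \<le> ln n\<close>, and \<open>d = exp (ln n / k)\<close> is at least
  \<open>exp (sqrt (ln n))\<close>. A relative change of order \<open>s\<close> in one threshold
  changes its edge probability by a constant factor, so weight can be moved between the last two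
  edges at constant total; the disjoint weight intervals that this opens for the last edge supply
  the \<open>I\<close> chances.\<close>

lemma C2_on_interval_quadratic_error:
  fixes G :: "real \<Rightarrow> real"
  assumes b: "0 < b" and C2: "C2_on_interval 0 b G" and lam: "(deriv G \<longlongrightarrow> lam) (at_right 0)"
  obtains C where "0 \<le> C" "\<And>x. x \<in> {0..b} \<Longrightarrow> \<bar>G x - G 0 - lam * x\<bar> \<le> C * x\<^sup>2"
proof -
  obtain f' f'' where D1: "\<And>x. x \<in> {0..b} \<Longrightarrow> (G has_real_derivative f' x) (at x within {0..b})"
    and D2: "\<And>x. x \<in> {0..b} \<Longrightarrow> (f' has_real_derivative f'' x) (at x within {0..b})"
    and c: "continuous_on {0..b} f''"
    using C2 unfolding C2_on_interval_def by blast
  have "bounded (f'' ` {0..b})" using compact_continuous_image[OF c] compact_imp_bounded by blast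
  then obtain C where "\<forall>y\<in>f'' ` {0..b}. norm y \<le> C" unfolding bounded_iff by (elim exE)
  then have C: "norm (f'' x) \<le> C" if "x \<in> {0..b}" for x using that by simp
  have C0: "0 \<le> C" using order_trans[OF norm_ge_zero C[of 0]] b by simp
  \<comment> \<open>The one-sided derivative at 0 is the limit of \<open>deriv G\<close>, since
    \<open>f'\<close> is continuous at 0 from the right and agrees with \<open>deriv G\<close> in
    the interior.\<close>
  have "f' 0 = lam"
  proof (rule tendsto_unique)
    have "continuous_on {0..b} f'" by (rule DERIV_continuous_on) (rule D2)
    then have "(f' \<longlongrightarrow> f' 0) (at 0 within {0..b})" using b by (simp add: continuous_on_def)
    then show "(f' \<longlongrightarrow> f' 0) (at_right 0)" using b by (simp add: at_within_Icc_at_right)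
    have "eventually (\<lambda>x. deriv G x = f' x) (at_right 0)"
    proof (rule eventually_mono[OF eventually_at_right_real[OF b]])
      fix x assume x: "x \<in> {0<..<b}"
      then have "(G has_real_derivative f' x) (at x)"
        using D1[of x] at_within_Icc_at[of 0 x b] by auto
      then show "deriv G x = f' x" by (rule DERIV_imp_deriv)
    qed
    then show "(f' \<longlongrightarrow> lam) (at_right 0)" using lam by (rule Lim_transform_eventually[rotated])
  qed simp
  \<comment> \<open>The mean value inequality is used twice: here for \<open>f'\<close>, whose
    derivative is bounded, and below for \<open>G x - lam * x\<close>, whose derivative is
    \<open>f' x - lam\<close>.\<close>
  then have f': "\<bar>f' x - lam\<bar> \<le> C * x" if "x \<in> {0..b}" for x
    using field_differentiable_bound[OF _ D2 C, of x 0] that b by auto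
  have "\<bar>G x - G 0 - lam * x\<bar> \<le> C * x\<^sup>2" if x: "x \<in> {0..b}" for x
  proof -
    have "norm ((G x - lam * x) - (G 0 - lam * 0)) \<le> C * x * norm (x - 0)"
    proof (rule field_differentiable_bound)
      fix y assume y: "y \<in> {0..x}"
      have "(G has_real_derivative f' y) (at y within {0..x})"
        by (rule DERIV_subset[OF D1]) (use x y in auto)
      then show "((\<lambda>x. G x - lam * x) has_real_derivative f' y - lam) (at y within {0..x})"
        by (auto intro!: derivative_eq_intros)
      show "norm (f' y - lam) \<le> C * x"
        using f'[of y] x y mult_left_mono[of y x C] C0 by auto
    qed (use x in auto)
    then show ?thesis using x by (simp add: power2_eq_square)
  qed
  then show ?thesis using that C0 by blast
qed

text \<open>The function \<open>x * (1 - ln x)\<close> has its strict maximum 1 at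
  \<open>x = 1\<close>. Here \<open>x\<close> stands for a path length relative to the optimal one,
  and the gap \<open>c\<close> makes atypical lengths improbable. With \<open>x = r\<^sup>2\<close>,
  the inequality \<open>1 - 1 / r \<le> ln r\<close> yields the explicit gap
  \<open>(r - 1)\<^sup>2\<close>.\<close>

lemma mult_one_minus_ln_gap:
  fixes \<eta> :: real
  assumes "0 < \<eta>"
  obtains c where "0 < c" "\<And>x. 0 < x \<Longrightarrow> \<eta> \<le> \<bar>x - 1\<bar> \<Longrightarrow> x * (1 - ln x) \<le> 1 - c"
proof -
  \<comment> \<open>The two values belong to \<open>r \<le> 2\<close>, where
    \<open>\<eta> \<le> \<bar>r - 1\<bar> * (r + 1)\<close> gives
    \<open>\<eta> / 3 \<le> \<bar>r - 1\<bar>\<close>, and to \<open>r > 2\<close>, where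
    \<open>(r - 1)\<^sup>2\<close> exceeds 1.\<close>
  define c where "c = min 1 (\<eta>\<^sup>2 / 9)"
  have "x * (1 - ln x) \<le> 1 - c" if x: "0 < x" "\<eta> \<le> \<bar>x - 1\<bar>" for x
  proof -
    define r where "r = sqrt x"
    have r: "0 < r" "x = r\<^sup>2" using x by (auto simp: r_def)
    have "ln (1 / r) \<le> 1 / r - 1" using r by (intro ln_le_minus_one) auto
    then have "1 - 1 / r \<le> ln r" using r by (simp add: ln_div)
    then have "r\<^sup>2 * (1 - 1 / r) \<le> r\<^sup>2 * ln r" by (intro mult_left_mono) auto
    moreover have "r\<^sup>2 * (1 - 1 / r) = r\<^sup>2 - r" using r by (simp add: power2_eq_square field_simps)
    ultimately have 1: "r\<^sup>2 - r \<le> r\<^sup>2 * ln r" by simp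
    have "ln x = 2 * ln r" using r by (simp add: ln_realpow)
    then have "x * (1 - ln x) \<le> 1 - (r - 1)\<^sup>2" using 1 r by (simp add: power2_eq_square algebra_simps)
    moreover have "c \<le> (r - 1)\<^sup>2"
    proof (cases "r \<le> 2")
      case True
      have "\<eta> \<le> \<bar>r - 1\<bar> * (r + 1)" proof -
        have "x - 1 = (r - 1) * (r + 1)" using r by (simp add: power2_eq_square algebra_simps)
        then show ?thesis using x r by (simp add: abs_mult)
      qed
      also have "\<dots> \<le> \<bar>r - 1\<bar> * 3" using True by (intro mult_left_mono) auto
      finally have "\<eta> / 3 \<le> \<bar>r - 1\<bar>" by simp
      then have "(\<eta> / 3)\<^sup>2 \<le> \<bar>r - 1\<bar>\<^sup>2" using assms by (intro power_mono) auto
      then show ?thesis by (simp add: c_def power_divide min_le_iff_disj)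
    next
      case False
      then have "1\<^sup>2 \<le> (r - 1)\<^sup>2" by (intro power_mono) auto
      then show ?thesis by (simp add: c_def min_le_iff_disj)
    qed
    ultimately show ?thesis by linarith
  qed
  then show ?thesis using that[of c] assms by (simp add: c_def)
qed

lemma one_minus_exp_minus_ge:
  fixes t :: real
  assumes "0 \<le> t"
  shows "t * (1 - t) \<le> 1 - exp (- t)"
proof -
  have "exp (- t) \<le> 1 / (1 + t)"
    using exp_ge_add_one_self[of t] assms by (simp add: exp_minus field_simps)
  also have "1 - t * (1 - t) \<ge> 1 / (1 + t)"
  proof -
    have "(1 - t * (1 - t)) * (1 + t) = 1 + t ^ 3" by (simp add: algebra_simps power3_eq_cube)
    then have "1 \<le> (1 - t * (1 - t)) * (1 + t)" using assms by simp
    then show ?thesis using assms by (simp add: pos_divide_le_eq)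
  qed
  finally show ?thesis by simp
qed

text \<open>The right side is the expected number of neighbours of \<open>j\<close> vertices among
  \<open>n - 1\<close>, with edge probability \<open>p\<close>. It is close to
  \<open>n * p * j\<close> as long as neighbourhoods rarely overlap (\<open>p * a\<close> small) and
  few vertices are used up (\<open>a / n\<close> small). The term \<open>2 * a\<close> pays for the
  one missing vertex and for the \<open>j\<close> vertices themselves.\<close>

lemma expansion_rate_le:
  fixes p \<eta> :: real and n a j :: nat
  assumes p: "0 \<le> p" "p \<le> 1" and n: "1 \<le> n" and j: "1 \<le> j" "j \<le> a"
    and small: "p * a + 2 * a / n \<le> \<eta>" and \<eta>: "\<eta> \<le> 1"
  shows "n * p * (1 - \<eta>) * j \<le> (real (n - 1) - j) * (1 - (1 - p) ^ j)"
proof -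
  have n0: "0 < real n" using n by simp
  have ja: "real j \<le> a" "1 \<le> real j" using j by auto
  have pj: "p * j \<le> p * a" using ja p by (intro mult_left_mono) auto
  have a1: "2 * real a / n \<le> 1" and pa1: "p * a \<le> 1"
  proof -
    have "0 \<le> 2 * real a / n" "0 \<le> p * a" using p by simp_all
    then show "2 * real a / n \<le> 1" "p * a \<le> 1" using small \<eta> by linarith+
  qed
  have 1: "real n * (1 - 2 * a / n) \<le> real (n - 1) - j"
  proof -
    have "real n * (1 - 2 * a / n) = real n - 2 * a" using n0 by (simp add: field_simps)
    moreover have "real (n - 1) = real n - 1" using n by (simp add: of_nat_diff)
    ultimately show ?thesis using ja by linarith
  qed
  have "(1 - p) ^ j \<le> exp (- p) ^ j"
    using p exp_ge_add_one_self[of "- p"] by (intro power_mono) auto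
  also have "\<dots> = exp (- (p * j))" by (simp add: exp_of_nat_mult[symmetric] mult.commute)
  finally have "1 - exp (- (p * j)) \<le> 1 - (1 - p) ^ j" by simp
  moreover have "p * j * (1 - p * a) \<le> p * j * (1 - p * j)" using pj p by (intro mult_left_mono) auto
  moreover have "p * j * (1 - p * j) \<le> 1 - exp (- (p * j))" using p by (intro one_minus_exp_minus_ge) simp
  ultimately have 2: "p * j * (1 - p * a) \<le> 1 - (1 - p) ^ j" by linarith
  have "1 - \<eta> \<le> (1 - 2 * a / n) * (1 - p * a)"
  proof -
    have "(1 - A) * (1 - b) = 1 - A - b + A * b" for A b :: real by (simp add: algebra_simps)
    moreover have "0 \<le> (2 * a / n) * (p * a)" using p n0 by simp
    ultimately show ?thesis using small by (metis add_increasing2 diff_diff_eq diff_left_mono add.commute)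
  qed
  then have "n * p * j * (1 - \<eta>) \<le> n * p * j * ((1 - 2 * a / n) * (1 - p * a))"
    using p by (intro mult_left_mono) auto
  also have "\<dots> = (n * (1 - 2 * a / n)) * (p * j * (1 - p * a))" by simp
  also have "\<dots> \<le> (real (n - 1) - j) * (1 - (1 - p) ^ j)"
  proof (rule mult_mono[OF 1 2])
    have "0 \<le> n * (1 - 2 * a / n)" using a1 by (intro mult_nonneg_nonneg) auto
    then show "0 \<le> real (n - 1) - j" using 1 by linarith
    show "0 \<le> p * j * (1 - p * a)" using pa1 p by (intro mult_nonneg_nonneg) auto
  qed
  finally show ?thesis by (simp add: mult_ac)
qed

text \<open>Bounds the total loss over \<open>k\<close> generations that each lose a factor
  \<open>1 - 1 / k\<close>. The exponent comes from \<open>k / (k - 1) \<le> 2\<close>.\<close>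

lemma one_minus_inverse_power_ge:
  fixes k :: nat
  assumes "2 \<le> k"
  shows "exp (- 2) \<le> (1 - 1 / real k) ^ k"
proof -
  have k: "2 \<le> real k" using assms by simp
  have "k / (real k - 1) \<le> exp (1 / (real k - 1))"
    using exp_ge_add_one_self[of "1 / (real k - 1)"] k by (simp add: field_simps)
  then have "1 / exp (1 / (real k - 1)) \<le> 1 / (k / (real k - 1))"
    using k by (intro divide_left_mono) auto
  then have "exp (- (1 / (real k - 1))) \<le> 1 - 1 / k" using k by (simp add: exp_minus field_simps)
  then have "exp (- (1 / (real k - 1))) ^ k \<le> (1 - 1 / k) ^ k" by (intro power_mono) auto
  moreover have "exp (- 2) \<le> exp (- (1 / (real k - 1))) ^ k"
    using k by (simp add: exp_of_nat_mult[symmetric] field_simps)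
  ultimately show ?thesis by linarith
qed

section \<open>Paths and vertices reachable by light paths\<close>

lemma path_edges_simps [simp]:
  "path_edges [] = []" "path_edges [a] = []"
  "path_edges (a # b # p) = {a, b} # path_edges (b # p)"
  by (simp_all add: path_edges_def)

lemma path_edges_append:
  "path_edges (p @ v # r) = path_edges (p @ [v]) @ path_edges (v # r)"
  by (induction p rule: induct_list012) auto

lemma path_edges_snoc:
  "p \<noteq> [] \<Longrightarrow> path_edges (p @ [v]) = path_edges p @ [{last p, v}]"
  by (induction p rule: induct_list012) auto

lemma length_path_edges [simp]: "length (path_edges p) = length p - 1"
  by (induction p rule: induct_list012) auto

lemma path_edges_subset_verts: "e \<in> set (path_edges p) \<Longrightarrow> e \<subseteq> set p"
  by (induction p rule: induct_list012) auto

lemma distinct_path_edges: "distinct p \<Longrightarrow> distinct (path_edges p)"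
proof (induction p rule: induct_list012)
  case (3 a b p)
  then show ?case using path_edges_subset_verts[of "{a, b}" "b # p"] by auto
qed auto

lemma path_edges_pairs:
  "distinct p \<Longrightarrow> e \<in> set (path_edges p) \<Longrightarrow>
     \<exists>i j. e = {i, j} \<and> i \<in> set p \<and> j \<in> set p \<and> i \<noteq> j"
proof (induction p rule: induct_list012)
  case (3 a b p)
  show ?case
  proof (cases "e = {a, b}")
    case True
    then show ?thesis using 3(3) by auto
  next
    case False
    then have "\<exists>i j. e = {i, j} \<and> i \<in> set (b # p) \<and> j \<in> set (b # p) \<and> i \<noteq> j"
      using 3 by auto
    then show ?thesis by auto
  qed
qed auto

lemma path_edges_complete_graph:
  assumes "distinct p" "set p \<subseteq> {1..n}"
  shows "set (path_edges p) \<subseteq> complete_graph_edges n"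
proof
  fix e assume "e \<in> set (path_edges p)"
  then show "e \<in> complete_graph_edges n"
    using path_edges_pairs[OF assms(1)] assms(2) unfolding complete_graph_edges_def by blast
qed

text \<open>On a self-avoiding path only the first edge contains the start vertex, so the edge set
  determines the second vertex, and induction applies to the rest. Hence two different paths with
  the same ends differ in an edge, which is what almost sure uniqueness of the minimum rests
  on.\<close>

lemma path_determined_by_edges:
  "distinct p \<Longrightarrow> distinct q \<Longrightarrow> p \<noteq> [] \<Longrightarrow> q \<noteq> [] \<Longrightarrow> hd p = hd q \<Longrightarrow>
     set (path_edges p) = set (path_edges q) \<Longrightarrow> p = q"
proof (induction p arbitrary: q rule: induct_list012)
  case 1
  then show ?case by simp
next
  case (2 a)
  then obtain r where q: "q = a # r" by (cases q) auto
  show ?case using 2 q by (cases r) auto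
next
  case (3 a b p)
  obtain c q' where q: "q = a # c # q'"
    proof -
    obtain r where r: "q = a # r" using 3(6,7) by (cases q) auto
    have "r \<noteq> []" using 3(8) r by auto
    then show ?thesis using r that by (cases r) auto
  qed
  have nin: "{a, x} \<notin> set (path_edges (b # p))" "{a, x} \<notin> set (path_edges (c # q'))" for x
    using path_edges_subset_verts[of "{a, x}" "b # p"] path_edges_subset_verts[of "{a, x}" "c # q'"]
      3(3,4) q by auto
  have ins: "insert {a, b} (set (path_edges (b # p))) = insert {a, c} (set (path_edges (c # q')))"
    using 3(8) q by simp
  then have "{a, b} = {a, c}" using nin by blast
  then have bc: "b = c" by (auto simp: doubleton_eq_iff)
  have "set (path_edges (b # p)) = set (path_edges (c # q'))"
    using ins nin bc by (metis insert_ident)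
  then show ?case using 3(2)[of "c # q'"] 3(3,4) q bc by auto
qed

lemma path_weight_eq_sum: "distinct p \<Longrightarrow> path_weight x p = (\<Sum>e\<in>set (path_edges p). x e)"
  unfolding path_weight_def using distinct_path_edges by (simp add: sum_list_distinct_conv_sum_set)

lemma self_avoiding_pathsD:
  assumes "p \<in> self_avoiding_paths n a b"
  shows "p \<noteq> []" "hd p = a" "last p = b" "distinct p" "set p \<subseteq> {1..n}"
    "set (path_edges p) \<subseteq> complete_graph_edges n"
  using assms by (auto simp: self_avoiding_paths_def)

lemma finite_complete_graph_edges [simp]: "finite (complete_graph_edges n)"
proof -
  have "complete_graph_edges n \<subseteq> Pow {1..n}" by (auto simp: complete_graph_edges_def)
  then show ?thesis by (rule finite_subset) simp
qed

lemma card_complete_graph_edges_le: "card (complete_graph_edges n) \<le> n\<^sup>2"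
proof -
  have "complete_graph_edges n \<subseteq> (\<lambda>(i, j). {i, j}) ` ({1..n} \<times> {1..n})"
    by (auto simp: complete_graph_edges_def)
  then have "card (complete_graph_edges n) \<le> card ((\<lambda>(i, j). {i, j}) ` ({1..n} \<times> {1..n}))"
    by (intro card_mono) auto
  also have "\<dots> \<le> card ({1..n} \<times> {1..n})" by (intro card_image_le) auto
  finally show ?thesis by (simp add: power2_eq_square)
qed

lemma doubleton_in_complete_graph_edges [simp]:
  "{i, j} \<in> complete_graph_edges n \<longleftrightarrow> i \<in> {1..n} \<and> j \<in> {1..n} \<and> i \<noteq> j"
  by (auto simp: complete_graph_edges_def doubleton_eq_iff)

text \<open>Both ends are fixed, so only the \<open>k - 1\<close> inner vertices are free. The
  missing power of \<open>n\<close> is the source of the factor \<open>1 / n\<close> in the first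
  moment bound.\<close>

lemma card_self_avoiding_paths_length_le:
  assumes "1 \<le> k" "1 \<le> n"
  shows "card {p \<in> self_avoiding_paths n a b. length p = Suc k} \<le> n ^ (k - 1)"
proof -
  let ?S = "{p \<in> self_avoiding_paths n a b. length p = Suc k}"
  let ?L = "{r. set r \<subseteq> {1..n} \<and> length r = k - 1}"
  have sub: "?S \<subseteq> (\<lambda>r. a # r @ [b]) ` ?L"
  proof
    fix p assume p: "p \<in> ?S"
    note D = self_avoiding_pathsD[of p n a b]
    obtain c p' where p1: "p = c # p'" using p by (cases p) auto
    have "p' \<noteq> []" using p p1 assms by auto
    then have "p = a # butlast p' @ [b]" using p p1 D by auto
    moreover have "butlast p' \<in> ?L"
      using p p1 D(5) by (auto dest: in_set_butlastD)
    ultimately show "p \<in> (\<lambda>r. a # r @ [b]) ` ?L" by blast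
  qed
  have fin: "finite ?L" using finite_lists_length_eq[of "{1..n}" "k - 1"] by simp
  have "card ?S \<le> card ?L"
    using sub fin by (meson card_image_le card_mono finite_imageI le_trans)
  also have "\<dots> = n ^ (k - 1)" using card_lists_length_eq[of "{1..n}" "k - 1"] by simp
  finally show "card ?S \<le> n ^ (k - 1)" .
qed

lemma self_avoiding_path_length:
  assumes "p \<in> self_avoiding_paths n a b"
  shows "1 \<le> length p" "length p \<le> n"
proof -
  note D = self_avoiding_pathsD[OF assms]
  show "1 \<le> length p" using D(1) by (cases p) auto
  have "length p = card (set p)" using D(4) by (simp add: distinct_card)
  also have "\<dots> \<le> card {1..n}" using D(5) by (intro card_mono) auto
  finally show "length p \<le> n" by simp
qed

lemma finite_self_avoiding_paths [simp]: "finite (self_avoiding_paths n a b)"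
proof (rule finite_subset)
  show "self_avoiding_paths n a b \<subseteq> {p. set p \<subseteq> {1..n} \<and> length p \<le> n}"
    using self_avoiding_pathsD(5) self_avoiding_path_length(2) by blast
  show "finite {p. set p \<subseteq> {1..n} \<and> length p \<le> n}" by (rule finite_lists_length_le) simp
qed

lemma self_avoiding_paths_nonempty: "2 \<le> n \<Longrightarrow> self_avoiding_paths n 1 2 \<noteq> {}"
proof -
  assume "2 \<le> n"
  then have "[1, 2] \<in> self_avoiding_paths n 1 2" by (auto simp: self_avoiding_paths_def)
  then show ?thesis by blast
qed

text \<open>The ball of radius \<open>c\<close> around vertex 1 in the weighted graph induced on
  \<open>U\<close>. Taking \<open>U\<close> without vertex 2 keeps it independent of the edges at
  vertex 2.\<close>

definition reachable_within :: "(nat set \<Rightarrow> real) \<Rightarrow> nat set \<Rightarrow> real \<Rightarrow> nat set" where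
  "reachable_within x U c =
     {v. \<exists>p. p \<noteq> [] \<and> hd p = 1 \<and> last p = v \<and> distinct p \<and> set p \<subseteq> U \<and> path_weight x p \<le> c}"

lemma reachable_within_subset: "reachable_within x U c \<subseteq> U"
  by (auto simp: reachable_within_def)

lemma reachable_within_start: "1 \<in> U \<Longrightarrow> 1 \<in> reachable_within x U 0"
  unfolding reachable_within_def by (intro CollectI exI[of _ "[1]"]) (auto simp: path_weight_def)

text \<open>If \<open>v\<close> already lies on the path to \<open>w\<close>, appending it would not
  give a self-avoiding path. The initial piece up to \<open>v\<close> is used instead; it is no
  heavier because weights inside \<open>U\<close> are nonnegative.\<close>

lemma reachable_within_step:
  assumes nonneg: "\<And>i j. i \<in> U \<Longrightarrow> j \<in> U \<Longrightarrow> i \<noteq> j \<Longrightarrow> 0 \<le> x {i, j}"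
    and w: "w \<in> reachable_within x U c" and v: "v \<in> U" "v \<noteq> w" and x: "x {w, v} \<le> d"
  shows "v \<in> reachable_within x U (c + d)"
proof -
  obtain p where p: "p \<noteq> []" "hd p = 1" "last p = w" "distinct p" "set p \<subseteq> U" "path_weight x p \<le> c"
    using w by (auto simp: reachable_within_def)
  have wU: "w \<in> U" using p by (metis last_in_set subsetD)
  then have d: "0 \<le> d" using nonneg[of w v] v x by force
  show ?thesis
  proof (cases "v \<in> set p")
    case True
    then obtain q r where qr: "p = q @ v # r" by (meson split_list)
    have "path_weight x p = path_weight x (q @ [v]) + path_weight x (v # r)"
      using qr by (simp add: path_weight_def path_edges_append[of q v r])
    moreover have "0 \<le> path_weight x (v # r)"
      unfolding path_weight_def
    proof (rule sum_list_nonneg)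
      fix y assume "y \<in> set (map x (path_edges (v # r)))"
      then obtain e where "y = x e" "e \<in> set (path_edges (v # r))" by auto
      then show "0 \<le> y" using path_edges_pairs[of "v # r" e] p(4,5) qr nonneg by auto
    qed
    ultimately have "path_weight x (q @ [v]) \<le> c + d" using p(6) d by linarith
    moreover have "hd (q @ [v]) = 1" using p(2) qr by (cases q) auto
    ultimately show ?thesis
      unfolding reachable_within_def using p qr by (intro CollectI exI[of _ "q @ [v]"]) auto
  next
    case False
    have "path_weight x (p @ [v]) = path_weight x p + x {w, v}"
      using p by (simp add: path_weight_def path_edges_snoc)
    then show ?thesis
      unfolding reachable_within_def using p v False x
      by (intro CollectI exI[of _ "p @ [v]"]) auto
  qed
qed

text \<open>A path that avoids vertex 2 stays self-avoiding when vertex 2 is appended.\<close>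

lemma min_path_weight_le_via:
  assumes v: "v \<in> reachable_within x ({1..n} - {2}) c" and x: "x {2, v} \<le> d" and n: "2 \<le> n"
  shows "min_path_weight n x \<le> c + d"
proof -
  obtain p where p: "p \<noteq> []" "hd p = 1" "last p = v" "distinct p" "set p \<subseteq> {1..n} - {2}"
      "path_weight x p \<le> c"
    using v by (auto simp: reachable_within_def)
  have "distinct (p @ [2])" "set (p @ [2]) \<subseteq> {1..n}" using p n by auto
  then have "p @ [2] \<in> self_avoiding_paths n 1 2"
    using p path_edges_complete_graph[of "p @ [2]" n] by (auto simp: self_avoiding_paths_def)
  then have "min_path_weight n x \<le> path_weight x (p @ [2])"
    unfolding min_path_weight_def by (intro Min_le) auto
  also have "\<dots> = path_weight x p + x {2, v}"
    using p by (simp add: path_weight_def path_edges_snoc insert_commute)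
  finally show ?thesis using p x by linarith
qed

section \<open>The first moment bound\<close>

text \<open>A layer-cake bound down to the cutoff \<open>(1 / 2) ^ J\<close>. In the induction step,
  either \<open>z\<close> is above the old cutoff, or the new term alone equals
  \<open>2 ^ Suc J\<close> and dominates \<open>1 / z\<close>.\<close>

lemma inverse_le_dyadic_sum:
  fixes z :: real
  assumes "0 < z" "(1 / 2) ^ J \<le> z"
  shows "1 / z \<le> 1 + (\<Sum>j=1..J. 2 ^ j * (if z \<le> 2 * (1 / 2) ^ j then 1 else 0))"
  using assms(2)
proof (induction J)
  case 0
  then show ?case using assms(1) by simp
next
  case (Suc J)
  show ?case
  proof (cases "(1 / 2) ^ J \<le> z")
    case True
    have "(\<Sum>j=1..J. 2 ^ j * (if z \<le> 2 * (1 / 2) ^ j then 1 else 0 :: real))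
            \<le> (\<Sum>j=1..Suc J. 2 ^ j * (if z \<le> 2 * (1 / 2) ^ j then 1 else 0))"
      by (intro sum_mono2) auto
    then show ?thesis using Suc.IH[OF True] by linarith
  next
    case False
    have "1 / z \<le> 2 ^ Suc J"
      using Suc.prems assms(1) by (simp add: field_simps power_one_over)
    moreover have "0 \<le> (\<Sum>j=1..J. 2 ^ j * (if z \<le> 2 * (1 / 2) ^ j then 1 else 0 :: real))"
      by (intro sum_nonneg) auto
    ultimately show ?thesis using False by simp
  qed
qed

text \<open>The inequality of arithmetic and geometric means, raised to a negative power. It
  replaces a condition on a sum by one on a product, whose expectation factorises under
  independence.\<close>

lemma prod_powr_ge_of_sum_le:
  fixes a :: "'b \<Rightarrow> real" and x \<alpha> :: real
  assumes "finite S" "S \<noteq> {}" and pos: "\<And>i. i \<in> S \<Longrightarrow> 0 < a i"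
    and sum: "(\<Sum>i\<in>S. a i) \<le> x" and \<alpha>: "0 \<le> \<alpha>"
  shows "(x / card S) powr (- \<alpha> * card S) \<le> (\<Prod>i\<in>S. a i powr - \<alpha>)"
proof -
  have k: "0 < real (card S)" using assms by (simp add: card_gt_0_iff)
  have P: "0 < (\<Prod>i\<in>S. a i)" using pos by (intro prod_pos) auto
  have "(\<Prod>i\<in>S. a i) powr (1 / card S) \<le> (\<Sum>i\<in>S. a i / card S)"
    using assms by (intro arith_geom_mean) (auto intro: less_imp_le)
  also have "\<dots> \<le> x / card S" using sum k by (simp add: sum_divide_distrib[symmetric] divide_right_mono)
  finally have 1: "(\<Prod>i\<in>S. a i) powr (1 / card S) \<le> x / card S" .
  have "(x / card S) powr (- \<alpha> * card S) \<le> ((\<Prod>i\<in>S. a i) powr (1 / card S)) powr (- \<alpha> * card S)"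
    using 1 P \<alpha> by (intro powr_mono2') auto
  also have "\<dots> = (\<Prod>i\<in>S. a i) powr - \<alpha>" using k by (simp add: powr_powr)
  also have "\<dots> = (\<Prod>i\<in>S. a i powr - \<alpha>)"
    by (rule prod_powr_distrib)
  finally show ?thesis .
qed

section \<open>The edge weights of one fixed complete graph\<close>

locale iid_weights = prob_space M for M :: "'a measure" +
  fixes n :: nat and X :: "nat set \<Rightarrow> 'a \<Rightarrow> real" and F :: "real \<Rightarrow> real"
  assumes iid: "iid_edge_weights M n X F"
begin

lemma indep: "indep_vars (\<lambda>_. borel) X (complete_graph_edges n)"
  using iid by (simp add: iid_edge_weights_def)

lemma rv: "e \<in> complete_graph_edges n \<Longrightarrow> X e \<in> borel_measurable M"
  using indep by (auto simp: indep_vars_def)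

lemma prob_le:
  assumes e: "e \<in> complete_graph_edges n"
  shows "prob {\<omega> \<in> space M. X e \<omega> \<le> x} = F x"
proof -
  have "F x = measure (distr M borel (X e)) {..x}"
    using iid e by (auto simp: iid_edge_weights_def cdf_def)
  also have "\<dots> = prob (X e -` {..x} \<inter> space M)"
    using rv[OF e] by (subst measure_distr) auto
  also have "X e -` {..x} \<inter> space M = {\<omega> \<in> space M. X e \<omega> \<le> x}" by auto
  finally show ?thesis ..
qed

lemma AE_pos: "AE \<omega> in M. \<forall>e\<in>complete_graph_edges n. 0 < X e \<omega>"
  using iid by (intro AE_finite_allI) (auto simp: iid_edge_weights_def)

lemma measurable_path_weight:
  assumes "p \<in> self_avoiding_paths n a b"
  shows "(\<lambda>\<omega>. path_weight (\<lambda>e. X e \<omega>) p) \<in> borel_measurable M"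
proof -
  have "(\<lambda>\<omega>. \<Sum>e\<in>set (path_edges p). X e \<omega>) \<in> borel_measurable M"
    using self_avoiding_pathsD(6)[OF assms] rv by (intro borel_measurable_sum) auto
  then show ?thesis using self_avoiding_pathsD(4)[OF assms] by (simp add: path_weight_eq_sum)
qed

lemma sets_edge_Collect:
  assumes "e \<in> complete_graph_edges n" "{y. P y} \<in> sets borel"
  shows "{\<omega> \<in> space M. P (X e \<omega>)} \<in> events"
proof -
  have "{\<omega> \<in> space M. P (X e \<omega>)} = X e -` {y. P y} \<inter> space M" by auto
  then show ?thesis using measurable_sets[OF rv[OF assms(1)] assms(2)] by simp
qed

end

locale weights_power_bound = iid_weights +
  fixes \<alpha> B :: real
  assumes \<alpha>: "0 < \<alpha>" and B: "0 \<le> B" and F_le: "\<And>y. 0 < y \<Longrightarrow> F y \<le> B * y powr \<alpha>"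
begin

lemma prob_powr_le:
  assumes e: "e \<in> complete_graph_edges n" and z: "0 < z"
  shows "prob {\<omega> \<in> space M. 0 < X e \<omega> \<and> X e \<omega> powr \<alpha> \<le> z} \<le> B * z"
proof -
  have "prob {\<omega> \<in> space M. 0 < X e \<omega> \<and> X e \<omega> powr \<alpha> \<le> z} \<le> prob {\<omega> \<in> space M. X e \<omega> \<le> z powr (1 / \<alpha>)}"
  proof (rule finite_measure_mono)
    show "{\<omega> \<in> space M. 0 < X e \<omega> \<and> X e \<omega> powr \<alpha> \<le> z} \<subseteq> {\<omega> \<in> space M. X e \<omega> \<le> z powr (1 / \<alpha>)}"
    proof safe
      fix \<omega> assume "0 < X e \<omega>" "X e \<omega> powr \<alpha> \<le> z"
      then have "(X e \<omega> powr \<alpha>) powr (1 / \<alpha>) \<le> z powr (1 / \<alpha>)"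
        using \<alpha> by (intro powr_mono2) auto
      then show "X e \<omega> \<le> z powr (1 / \<alpha>)" using \<alpha> \<open>0 < X e \<omega>\<close> by (simp add: powr_powr)
    qed
    show "{\<omega> \<in> space M. X e \<omega> \<le> z powr (1 / \<alpha>)} \<in> events"
      by (intro sets_edge_Collect e) simp
  qed
  also have "\<dots> = F (z powr (1 / \<alpha>))" by (rule prob_le[OF e])
  also have "\<dots> \<le> B * (z powr (1 / \<alpha>)) powr \<alpha>" using z by (intro F_le) simp
  also have "\<dots> = B * z" using \<alpha> z by (simp add: powr_powr)
  finally show ?thesis .
qed

text \<open>The cutoff makes the expectation of \<open>y powr - \<alpha>\<close> finite, of order \<open>J\<close>.\<close>

definition inv_weight :: "nat \<Rightarrow> real \<Rightarrow> real" where
  "inv_weight J y = (if 0 < y \<and> (1 / 2) ^ J \<le> y powr \<alpha> then y powr - \<alpha> else 0)"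

lemma inv_weight_measurable [measurable]: "inv_weight J \<in> borel_measurable borel"
  unfolding inv_weight_def by measurable

lemma inv_weight_nonneg: "0 \<le> inv_weight J y"
  by (simp add: inv_weight_def)

lemma inv_weight_le: "inv_weight J y \<le> 2 ^ J"
proof (cases "0 < y \<and> (1 / 2) ^ J \<le> y powr \<alpha>")
  case True
  then have "1 / y powr \<alpha> \<le> 1 / (1 / 2) ^ J" by (intro divide_left_mono) auto
  then show ?thesis using True by (simp add: inv_weight_def powr_minus_divide power_one_over)
qed (auto simp: inv_weight_def)

lemma integrable_inv_weight:
  assumes "e \<in> complete_graph_edges n"
  shows "integrable M (\<lambda>\<omega>. inv_weight J (X e \<omega>))"
  by (rule integrable_const_bound[where B = "2 ^ J"])
    (use rv[OF assms] inv_weight_nonneg inv_weight_le in auto)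

text \<open>With \<open>z = y powr \<alpha>\<close> the bound on \<open>F\<close> says that
  \<open>z\<close> is at most \<open>t\<close> with probability at most \<open>B * t\<close>, so the
  mean of \<open>1 / z\<close> diverges only logarithmically: each of the \<open>J\<close> dyadic
  levels costs at most \<open>2 * B\<close>.\<close>

lemma expectation_inv_weight_le:
  assumes e: "e \<in> complete_graph_edges n"
  shows "expectation (\<lambda>\<omega>. inv_weight J (X e \<omega>)) \<le> 1 + 2 * B * real J"
proof -
  note [measurable] = rv[OF e]
  define S where "S j = {\<omega> \<in> space M. 0 < X e \<omega> \<and> X e \<omega> powr \<alpha> \<le> 2 * (1 / 2) ^ j}" for j :: nat
  have S [measurable]: "S j \<in> events" for j unfolding S_def by measurable
  have int: "integrable M (\<lambda>\<omega>. 2 ^ j * indicator (S j) \<omega> :: real)" for j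
    by (intro integrable_mult_right) (auto simp: less_top[symmetric])
  have "expectation (\<lambda>\<omega>. inv_weight J (X e \<omega>)) \<le> expectation (\<lambda>\<omega>. 1 + (\<Sum>j=1..J. 2 ^ j * indicator (S j) \<omega>))"
  proof (rule integral_mono)
    show "integrable M (\<lambda>\<omega>. inv_weight J (X e \<omega>))" by (rule integrable_inv_weight[OF e])
    show "integrable M (\<lambda>\<omega>. 1 + (\<Sum>j=1..J. 2 ^ j * indicator (S j) \<omega>) :: real)"
      by (intro Bochner_Integration.integrable_add Bochner_Integration.integrable_sum integrable_mult_right)
        (auto simp: less_top[symmetric])
    fix \<omega> assume \<omega>: "\<omega> \<in> space M"
    show "inv_weight J (X e \<omega>) \<le> 1 + (\<Sum>j=1..J. 2 ^ j * indicator (S j) \<omega>)"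
    proof (cases "0 < X e \<omega> \<and> (1 / 2) ^ J \<le> X e \<omega> powr \<alpha>")
      case True
      have "inv_weight J (X e \<omega>) = 1 / (X e \<omega> powr \<alpha>)"
        using True by (simp add: inv_weight_def powr_minus_divide)
      also have "\<dots> \<le> 1 + (\<Sum>j=1..J. 2 ^ j * (if X e \<omega> powr \<alpha> \<le> 2 * (1 / 2) ^ j then 1 else 0))"
        using True by (intro inverse_le_dyadic_sum) auto
      also have "\<dots> = 1 + (\<Sum>j=1..J. 2 ^ j * indicator (S j) \<omega>)"
        using True \<omega> by (intro arg_cong2[where f = "(+)"] sum.cong) (auto simp: S_def indicator_def)
      finally show ?thesis .
    next
      case False
      have "0 \<le> (\<Sum>j=1..J. 2 ^ j * indicator (S j) \<omega> :: real)" by (intro sum_nonneg) auto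
      moreover have "inv_weight J (X e \<omega>) = 0" using False by (auto simp: inv_weight_def)
      ultimately show ?thesis by linarith
    qed
  qed
  also have "\<dots> = 1 + (\<Sum>j=1..J. 2 ^ j * prob (S j))"
  proof -
    have "expectation (\<lambda>\<omega>. 1 + (\<Sum>j=1..J. 2 ^ j * indicator (S j) \<omega>))
        = expectation (\<lambda>\<omega>. 1 :: real) + expectation (\<lambda>\<omega>. \<Sum>j=1..J. 2 ^ j * indicator (S j) \<omega>)"
      by (rule Bochner_Integration.integral_add[OF _ Bochner_Integration.integrable_sum[OF int]]) simp
    also have "expectation (\<lambda>\<omega>. \<Sum>j=1..J. 2 ^ j * indicator (S j) \<omega> :: real)
        = (\<Sum>j=1..J. expectation (\<lambda>\<omega>. 2 ^ j * indicator (S j) \<omega>))"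
      by (rule Bochner_Integration.integral_sum[OF int])
    finally show ?thesis by (simp add: prob_space)
  qed
  also have "\<dots> \<le> 1 + (\<Sum>j=1..J. 2 * B)"
  proof (intro add_left_mono sum_mono)
    fix j
    have "prob (S j) \<le> B * (2 * (1 / 2) ^ j)" unfolding S_def by (rule prob_powr_le[OF e]) simp
    then have "2 ^ j * prob (S j) \<le> 2 ^ j * (B * (2 * (1 / 2) ^ j))" by (intro mult_left_mono) auto
    then show "2 ^ j * prob (S j) \<le> 2 * B" by (simp add: power_one_over)
  qed
  also have "\<dots> = 1 + 2 * B * real J" by simp
  finally show ?thesis .
qed

text \<open>Markov's inequality for the product of the truncated inverse weights. On the event no
  factor is cut off, so the product is at least the constant \<open>c\<close> given by the
  arithmetic-geometric mean inequality.\<close>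

lemma prob_sum_le:
  assumes S: "S \<subseteq> complete_graph_edges n" "S \<noteq> {}" and x: "0 < x"
  shows "prob {\<omega> \<in> space M. (\<Sum>e\<in>S. X e \<omega>) \<le> x \<and> (\<forall>e\<in>S. 0 < X e \<omega> \<and> (1 / 2) ^ J \<le> X e \<omega> powr \<alpha>)}
           \<le> (x / card S) powr (\<alpha> * card S) * (1 + 2 * B * real J) ^ card S" (is "prob ?A \<le> _")
proof -
  have fin: "finite S" using S(1) by (rule finite_subset) simp
  note [measurable] = rv[OF subsetD[OF S(1)]]
  define c where "c = (x / card S) powr (- \<alpha> * card S)"
  have k: "0 < real (card S)" using fin S by (simp add: card_gt_0_iff)
  have c: "0 < c" using x k by (simp add: c_def)
  have A: "?A \<in> events" using fin by measurable
  have indS: "indep_vars (\<lambda>_. borel) (\<lambda>e \<omega>. inv_weight J (X e \<omega>)) S"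
    by (rule indep_vars_compose2[OF indep_vars_subset[OF indep S(1)]]) simp
  have int: "\<And>e. e \<in> S \<Longrightarrow> integrable M (\<lambda>\<omega>. inv_weight J (X e \<omega>))"
    using S(1) integrable_inv_weight by blast
  have "c * prob ?A = expectation (\<lambda>\<omega>. c * indicator ?A \<omega>)" using A by simp
  also have "\<dots> \<le> expectation (\<lambda>\<omega>. \<Prod>e\<in>S. inv_weight J (X e \<omega>))"
  proof (rule integral_mono)
    show "integrable M (\<lambda>\<omega>. c * indicator ?A \<omega>)"
      using A by (intro integrable_mult_right) (auto simp: less_top[symmetric])
    show "integrable M (\<lambda>\<omega>. \<Prod>e\<in>S. inv_weight J (X e \<omega>))"
      by (rule indep_vars_integrable[OF fin indS int])
    fix \<omega> assume "\<omega> \<in> space M"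
    show "c * indicator ?A \<omega> \<le> (\<Prod>e\<in>S. inv_weight J (X e \<omega>))"
    proof (cases "\<omega> \<in> ?A")
      case True
      then have "c \<le> (\<Prod>e\<in>S. X e \<omega> powr - \<alpha>)"
        unfolding c_def using fin S(2) \<alpha> by (intro prod_powr_ge_of_sum_le) auto
      also have "\<dots> = (\<Prod>e\<in>S. inv_weight J (X e \<omega>))"
        using True by (intro prod.cong) (auto simp: inv_weight_def)
      finally show ?thesis using True by simp
    next
      case False
      then show ?thesis using inv_weight_nonneg by (simp add: prod_nonneg)
    qed
  qed
  also have "\<dots> = (\<Prod>e\<in>S. expectation (\<lambda>\<omega>. inv_weight J (X e \<omega>)))"
    by (rule indep_vars_lebesgue_integral[OF fin indS int])
  also have "\<dots> \<le> (\<Prod>e\<in>S. 1 + 2 * B * real J)"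
    using S(1) by (intro prod_mono conjI expectation_inv_weight_le integral_nonneg_AE) (auto simp: inv_weight_nonneg)
  finally have "c * prob ?A \<le> (1 + 2 * B * real J) ^ card S" by simp
  then have "prob ?A \<le> inverse c * (1 + 2 * B * real J) ^ card S" using c by (simp add: field_simps)
  also have "inverse c = (x / card S) powr (\<alpha> * card S)" by (simp add: c_def powr_minus)
  finally show ?thesis .
qed

lemma prob_small_weight_le:
  "prob {\<omega> \<in> space M. \<exists>e\<in>complete_graph_edges n. 0 < X e \<omega> \<and> X e \<omega> powr \<alpha> < (1 / 2) ^ J}
     \<le> (real n)\<^sup>2 * B * (1 / 2) ^ J"
proof -
  let ?E = "complete_graph_edges n"
  define S where "S e = {\<omega> \<in> space M. 0 < X e \<omega> \<and> X e \<omega> powr \<alpha> \<le> (1 / 2) ^ J}" for e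
  have S: "S e \<in> events" if "e \<in> ?E" for e
    unfolding S_def by (rule sets_edge_Collect[OF that]) measurable
  have "prob {\<omega> \<in> space M. \<exists>e\<in>?E. 0 < X e \<omega> \<and> X e \<omega> powr \<alpha> < (1 / 2) ^ J} \<le> prob (\<Union>e\<in>?E. S e)"
    using S by (intro finite_measure_mono) (auto simp: S_def)
  also have "\<dots> \<le> (\<Sum>e\<in>?E. prob (S e))"
    using S by (intro finite_measure_subadditive_finite) auto
  also have "\<dots> \<le> (\<Sum>e\<in>?E. B * (1 / 2) ^ J)"
    unfolding S_def by (intro sum_mono prob_powr_le) auto
  also have "\<dots> = real (card ?E) * (B * (1 / 2) ^ J)" by simp
  also have "\<dots> \<le> (real n)\<^sup>2 * (B * (1 / 2) ^ J)"
    using card_complete_graph_edges_le[of n] B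
    by (intro mult_right_mono) (auto simp flip: of_nat_power)
  finally show ?thesis by (simp add: mult.assoc)
qed

text \<open>A union bound over all paths with a number of edges in \<open>K\<close>. The constant
  factor contributed by each edge is absorbed into \<open>t\<close> as a power
  \<open>1 / \<alpha>\<close>, so that only the maximum \<open>m\<close> of a function of the form
  \<open>k * ln (t' / k)\<close> remains to be controlled.\<close>

lemma prob_light_path_le:
  assumes n: "1 \<le> n" and t: "0 < t" and U: "0 < U" and C: "0 < C" "U powr \<alpha> \<le> C / n"
    and m: "\<And>k. k \<in> K \<Longrightarrow> 1 \<le> k \<Longrightarrow>
      real k * ln (t * (2 * C * (1 + 2 * B * real J)) powr (1 / \<alpha>) / real k) \<le> m"
  shows "prob {\<omega> \<in> space M. \<exists>p\<in>self_avoiding_paths n 1 2. length p - 1 \<in> K \<and>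
            path_weight (\<lambda>e. X e \<omega>) p \<le> t * U}
           \<le> (real n)\<^sup>2 * B * (1 / 2) ^ J + exp (\<alpha> * m) / n" (is "prob ?A \<le> _")
proof -
  let ?E = "complete_graph_edges n"
  define D where "D = 1 + 2 * B * real J"
  have D: "0 < D" using B by (simp add: D_def add_pos_nonneg)
  define Small where "Small = {\<omega> \<in> space M. \<exists>e\<in>?E. 0 < X e \<omega> \<and> X e \<omega> powr \<alpha> < (1 / 2) ^ J}"
  have Small: "Small \<in> events"
  proof -
    have "Small = (\<Union>e\<in>?E. {\<omega> \<in> space M. 0 < X e \<omega> \<and> X e \<omega> powr \<alpha> < (1 / 2) ^ J})"
      by (auto simp: Small_def)
    also have "\<dots> \<in> events" by (intro sets.finite_UN sets_edge_Collect) auto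
    finally show ?thesis .
  qed
  define L where "L p = {\<omega> \<in> space M. (\<Sum>e\<in>set (path_edges p). X e \<omega>) \<le> t * U \<and>
      (\<forall>e\<in>set (path_edges p). 0 < X e \<omega> \<and> (1 / 2) ^ J \<le> X e \<omega> powr \<alpha>)}" for p
  have L: "L p \<in> events" if "p \<in> self_avoiding_paths n 1 2" for p
  proof -
    note [measurable] = rv[OF subsetD[OF self_avoiding_pathsD(6)[OF that]]]
    show ?thesis unfolding L_def by measurable
  qed
  define S where "S k = {p \<in> self_avoiding_paths n 1 2. length p = Suc k}" for k
  have S: "finite (S k)" "\<And>p. p \<in> S k \<Longrightarrow> p \<in> self_avoiding_paths n 1 2" for k
    using finite_subset[OF _ finite_self_avoiding_paths[of n 1 2]] by (auto simp: S_def)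
  \<comment> \<open>The ends 1 and 2 differ, so a path between them has at least one edge; being
    self-avoiding, it has fewer than \<open>n\<close>.\<close>
  define K' where "K' = K \<inter> {1..n}"
  have K': "finite K'" by (simp add: K'_def)
  have UL: "(\<Union>k\<in>K'. \<Union>p\<in>S k. L p) \<in> events"
    using K' S L by (intro sets.finite_UN) auto
  have "prob ?A \<le> prob (Small \<union> (\<Union>k\<in>K'. \<Union>p\<in>S k. L p))"
  proof (rule finite_measure_mono_AE)
    show "Small \<union> (\<Union>k\<in>K'. \<Union>p\<in>S k. L p) \<in> events" using Small UL by (rule sets.Un)
    show "AE \<omega> in M. \<omega> \<in> ?A \<longrightarrow> \<omega> \<in> Small \<union> (\<Union>k\<in>K'. \<Union>p\<in>S k. L p)"
      using AE_pos
    proof (rule AE_mp, intro AE_I2 impI)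
      fix \<omega> assume \<omega>: "\<omega> \<in> space M" "\<forall>e\<in>?E. 0 < X e \<omega>" "\<omega> \<in> ?A"
      then obtain p where p: "p \<in> self_avoiding_paths n 1 2" "length p - 1 \<in> K"
          "path_weight (\<lambda>e. X e \<omega>) p \<le> t * U" by blast
      note D = self_avoiding_pathsD[OF p(1)]
      show "\<omega> \<in> Small \<union> (\<Union>k\<in>K'. \<Union>p\<in>S k. L p)"
      proof (cases "\<omega> \<in> Small")
        case False
        obtain a b r where ab: "p = a # b # r"
          using D(1-3) by (cases p rule: remdups_adj.cases) auto
        have "length p - 1 \<in> K'"
          using p(2) ab self_avoiding_path_length[OF p(1)] by (auto simp: K'_def)
        moreover have "p \<in> S (length p - 1)" using p(1) ab by (simp add: S_def)
        moreover have "\<omega> \<in> L p"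
        proof -
          have "\<forall>e\<in>set (path_edges p). 0 < X e \<omega> \<and> (1 / 2) ^ J \<le> X e \<omega> powr \<alpha>"
            using False \<omega> D(6) unfolding Small_def by (fastforce simp: not_less)
          then show ?thesis using p(3) D(4) \<omega>(1) by (simp add: L_def path_weight_eq_sum)
        qed
        ultimately show ?thesis by blast
      qed blast
    qed
  qed
  also have "\<dots> \<le> prob Small + prob (\<Union>k\<in>K'. \<Union>p\<in>S k. L p)"
    by (rule measure_Un_le[OF Small UL])
  also have "prob (\<Union>k\<in>K'. \<Union>p\<in>S k. L p) \<le> (\<Sum>k\<in>K'. prob (\<Union>p\<in>S k. L p))"
    using K' S L by (intro finite_measure_subadditive_finite) (auto intro!: sets.finite_UN)
  also have "\<dots> \<le> (\<Sum>k\<in>K'. (1 / 2) ^ k * (exp (\<alpha> * m) / n))"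
  proof (rule sum_mono)
    fix k assume k: "k \<in> K'"
    then have k1: "1 \<le> k" "k \<in> K" by (auto simp: K'_def)
    have "prob (\<Union>p\<in>S k. L p) \<le> (\<Sum>p\<in>S k. prob (L p))"
      using S L by (intro finite_measure_subadditive_finite) auto
    also have "\<dots> \<le> (\<Sum>p\<in>S k. (t * U / k) powr (\<alpha> * k) * D ^ k)"
    proof (rule sum_mono)
      fix p assume p: "p \<in> S k"
      note D = self_avoiding_pathsD[OF S(2)[OF p]]
      have c: "card (set (path_edges p)) = k"
        using distinct_card[OF distinct_path_edges[OF D(4)]] p by (simp add: S_def)
      then have "set (path_edges p) \<noteq> {}" using k1 by auto
      from prob_sum_le[OF D(6) this, of "t * U" J]
      show "prob (L p) \<le> (t * U / k) powr (\<alpha> * k) * D ^ k"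
        using t U by (simp add: L_def c D_def)
    qed
    also have "\<dots> = real (card (S k)) * ((t * U / k) powr (\<alpha> * k) * D ^ k)" by simp
    also have "\<dots> \<le> real n ^ (k - 1) * ((t * U / k) powr (\<alpha> * k) * D ^ k)"
      using card_self_avoiding_paths_length_le[of k n 1 2] k1 n D unfolding S_def
      by (intro mult_right_mono) (auto simp flip: of_nat_power)
    also have "real n ^ (k - 1) = real n ^ k / n" using k1 n by (cases k) auto
    also have "(t * U / k) powr (\<alpha> * k) = (t / k) powr (\<alpha> * k) * (U powr \<alpha>) ^ k"
    proof -
      have "(t * U / k) powr (\<alpha> * k) = (t / k * U) powr (\<alpha> * k)" by simp
      also have "\<dots> = (t / k) powr (\<alpha> * k) * U powr (\<alpha> * k)" using t U by (intro powr_mult) 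
      also have "U powr (\<alpha> * k) = (U powr \<alpha>) ^ k" using U by (simp add: powr_powr[symmetric] powr_realpow)
      finally show ?thesis .
    qed
    also have "real n ^ k / n * ((t / k) powr (\<alpha> * k) * (U powr \<alpha>) ^ k * D ^ k)
        \<le> real n ^ k / n * ((t / k) powr (\<alpha> * k) * (C / n) ^ k * D ^ k)"
      using C D by (intro mult_left_mono mult_right_mono power_mono) auto
    also have "\<dots> = (C * D) ^ k * (t / k) powr (\<alpha> * k) / n"
      using n by (simp add: power_mult_distrib power_divide field_simps)
    \<comment> \<open>A spare factor \<open>2 ^ k\<close> is put aside: the geometric weights
      \<open>(1 / 2) ^ k\<close> make the sum over all lengths at most 1, with no further factor
      \<open>n\<close>.\<close>
    also have "(C * D) ^ k * (t / k) powr (\<alpha> * k) = (1 / 2) ^ k * ((2 * C * D) ^ k * (t / k) powr (\<alpha> * k))"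
      by (simp add: power_mult_distrib power_one_over)
    also have "(2 * C * D) ^ k * (t / k) powr (\<alpha> * k) \<le> exp (\<alpha> * m)"
    proof -
      define R where "R = 2 * C * D"
      have R: "0 < R" using C D by (simp add: R_def)
      have "R ^ k * (t / k) powr (\<alpha> * k) = exp (\<alpha> * (k * ln (t * R powr (1 / \<alpha>) / k)))"
        using R t k1 \<alpha> by (simp add: powr_def ln_mult ln_div powr_realpow[symmetric] exp_add[symmetric] field_simps)
      also have "\<dots> \<le> exp (\<alpha> * m)"
        using m[OF k1(2,1)] \<alpha> by (simp add: R_def D_def)
      finally show ?thesis by (simp add: R_def)
    qed
    finally show "prob (\<Union>p\<in>S k. L p) \<le> (1 / 2) ^ k * (exp (\<alpha> * m) / n)"
      using n by (simp add: divide_right_mono mult_left_mono)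
  qed
  also have "\<dots> = (\<Sum>k\<in>K'. (1 / 2) ^ k) * (exp (\<alpha> * m) / n)"
    by (rule sum_distrib_right[symmetric])
  also have "\<dots> \<le> 1 * (exp (\<alpha> * m) / n)"
  proof (rule mult_right_mono)
    have "(\<Sum>k\<in>K'. (1 / 2) ^ k) \<le> (\<Sum>k\<in>{1..n}. (1 / 2 :: real) ^ k)"
      by (intro sum_mono2) (auto simp: K'_def)
    also have "\<dots> = 1 - (1 / 2) ^ n" by (induction n) auto
    finally show "(\<Sum>k\<in>K'. (1 / 2) ^ k) \<le> (1 :: real)" by (rule order_trans) simp
  qed simp
  finally show ?thesis using prob_small_weight_le[of J] by (simp add: Small_def)
qed

end

section \<open>Expansion of threshold graphs\<close>

text \<open>The exponential Markov inequality, with \<open>t\<close> left free. A common lower bound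
  \<open>q\<close> for the success probabilities suffices, because the expectation of
  \<open>exp (- t * Y v)\<close> decreases in the success probability.\<close>

lemma (in prob_space) chernoff_lower_tail:
  fixes Y :: "'i \<Rightarrow> 'a \<Rightarrow> real" and q t b :: real
  assumes fin: "finite T" and ind: "indep_vars (\<lambda>_. borel) Y T"
    and Y01: "\<And>v \<omega>. v \<in> T \<Longrightarrow> \<omega> \<in> space M \<Longrightarrow> Y v \<omega> \<in> {0, 1}"
    and q: "\<And>v. v \<in> T \<Longrightarrow> q \<le> prob {\<omega> \<in> space M. Y v \<omega> = 1}" and t: "0 \<le> t"
  shows "prob {\<omega> \<in> space M. (\<Sum>v\<in>T. Y v \<omega>) \<le> b} \<le> exp (t * b - card T * q * (1 - exp (- t)))"
    (is "prob ?A \<le> _")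
proof -
  have Y [measurable]: "Y v \<in> borel_measurable M" if "v \<in> T" for v
    using ind that by (auto simp: indep_vars_def)
  have A: "?A \<in> events" by measurable
  have indS: "indep_vars (\<lambda>_. borel) (\<lambda>v \<omega>. exp (- t * Y v \<omega>)) T"
    by (rule indep_vars_compose2[OF ind]) simp
  have int: "integrable M (\<lambda>\<omega>. exp (- t * Y v \<omega>))" if "v \<in> T" for v
  proof (rule integrable_const_bound[where B = 1])
    show "AE \<omega> in M. norm (exp (- t * Y v \<omega>)) \<le> 1"
      using Y01[OF that] t by (intro AE_I2) fastforce
  qed (use that in measurable)
  have E: "expectation (\<lambda>\<omega>. exp (- t * Y v \<omega>)) \<le> exp (- (q * (1 - exp (- t))))" if v: "v \<in> T" for v
  proof -
    let ?B = "{\<omega> \<in> space M. Y v \<omega> = 1}"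
    have B [measurable]: "?B \<in> events" using Y[OF v] by measurable
    have "expectation (\<lambda>\<omega>. exp (- t * Y v \<omega>)) = expectation (\<lambda>\<omega>. 1 - (1 - exp (- t)) * indicator ?B \<omega>)"
      using Y01[OF v] by (intro Bochner_Integration.integral_cong) (auto simp: indicator_def)
    also have "\<dots> = 1 - (1 - exp (- t)) * prob ?B"
      using B by (subst Bochner_Integration.integral_diff) (auto simp: prob_space less_top[symmetric])
    also have "\<dots> \<le> 1 - (1 - exp (- t)) * q" using q[OF v] t by (simp add: mult_left_mono)
    also have "\<dots> \<le> exp (- (q * (1 - exp (- t))))"
      using exp_ge_add_one_self[of "- (q * (1 - exp (- t)))"] by (simp add: mult.commute)
    finally show ?thesis .
  qed
  have "exp (- t * b) * prob ?A = expectation (\<lambda>\<omega>. exp (- t * b) * indicator ?A \<omega>)" using A by simp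
  also have "\<dots> \<le> expectation (\<lambda>\<omega>. \<Prod>v\<in>T. exp (- t * Y v \<omega>))"
  proof (rule integral_mono)
    show "integrable M (\<lambda>\<omega>. exp (- t * b) * indicator ?A \<omega>)"
      using A by (intro integrable_mult_right) (auto simp: less_top[symmetric])
    show "integrable M (\<lambda>\<omega>. \<Prod>v\<in>T. exp (- t * Y v \<omega>))"
      by (rule indep_vars_integrable[OF fin indS int])
    fix \<omega> assume "\<omega> \<in> space M"
    show "exp (- t * b) * indicator ?A \<omega> \<le> (\<Prod>v\<in>T. exp (- t * Y v \<omega>))"
    proof (cases "\<omega> \<in> ?A")
      case True
      then have "exp (- t * b) \<le> exp (\<Sum>v\<in>T. - t * Y v \<omega>)"
        using t by (simp add: sum_distrib_left[symmetric] mult_left_mono sum_negf)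
      then show ?thesis using True fin by (simp add: exp_sum)
    qed (simp add: prod_nonneg)
  qed
  also have "\<dots> = (\<Prod>v\<in>T. expectation (\<lambda>\<omega>. exp (- t * Y v \<omega>)))"
    by (rule indep_vars_lebesgue_integral[OF fin indS int])
  also have "\<dots> \<le> (\<Prod>v\<in>T. exp (- (q * (1 - exp (- t)))))"
    by (intro prod_mono conjI E integral_nonneg_AE) auto
  also have "\<dots> = exp (- (card T * q * (1 - exp (- t))))"
    by (simp add: exp_of_nat_mult[symmetric] mult.assoc)
  finally have "prob ?A \<le> exp (- (card T * q * (1 - exp (- t)))) / exp (- t * b)"
    by (simp add: pos_le_divide_eq mult.commute)
  also have "\<dots> = exp (t * b - card T * q * (1 - exp (- t)))" by (simp add: exp_diff[symmetric])
  finally show ?thesis .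
qed

text \<open>The outer vertex boundary of \<open>A\<close> in the graph on \<open>U\<close> formed by
  the edges of weight at most \<open>\<theta>\<close>.\<close>

definition threshold_nbrs :: "(nat set \<Rightarrow> real) \<Rightarrow> nat set \<Rightarrow> real \<Rightarrow> nat set \<Rightarrow> nat set" where
  "threshold_nbrs x U \<theta> A = {v \<in> U - A. \<exists>w\<in>A. x {w, v} \<le> \<theta>}"

lemma threshold_nbrs_subset: "threshold_nbrs x U \<theta> A \<subseteq> U - A"
  by (auto simp: threshold_nbrs_def)

context iid_weights
begin

lemma prob_block_le:
  assumes A: "A \<subseteq> {1..n}" and v: "v \<in> {1..n} - A"
  shows "prob {\<omega> \<in> space M. \<exists>w\<in>A. X {w, v} \<omega> \<le> \<theta>} = 1 - (1 - F \<theta>) ^ card A"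
proof (cases "A = {}")
  case False
  have finA: "finite A" using A by (rule finite_subset) simp
  define K where "K = (\<lambda>w. {w, v}) ` A"
  have KE: "K \<subseteq> complete_graph_edges n" using A v by (auto simp: K_def)
  have "inj_on (\<lambda>w. {w, v}) A" by (auto simp: inj_on_def doubleton_eq_iff)
  then have cK: "card K = card A" by (simp add: K_def card_image)
  have pe: "prob (X e -` {\<theta><..} \<inter> space M) = 1 - F \<theta>" if "e \<in> K" for e
  proof -
    have "e \<in> complete_graph_edges n" using that KE by blast
    then have "prob (space M - {\<omega> \<in> space M. X e \<omega> \<le> \<theta>}) = 1 - F \<theta>"
      using prob_compl[OF sets_edge_Collect[of e "\<lambda>y. y \<le> \<theta>"]] prob_le[of e \<theta>] by simp
    moreover have "X e -` {\<theta><..} \<inter> space M = space M - {\<omega> \<in> space M. X e \<omega> \<le> \<theta>}" by auto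
    ultimately show ?thesis by simp
  qed
  have "prob (\<Inter>e\<in>K. X e -` {\<theta><..} \<inter> space M) = (\<Prod>e\<in>K. prob (X e -` {\<theta><..} \<inter> space M))"
    using finA False by (intro indep_varsD[OF indep _ _ KE]) (auto simp: K_def)
  also have "\<dots> = (1 - F \<theta>) ^ card A" using pe cK by simp
  finally have 1: "prob (\<Inter>e\<in>K. X e -` {\<theta><..} \<inter> space M) = (1 - F \<theta>) ^ card A" .
  have ev: "(\<Inter>e\<in>K. X e -` {\<theta><..} \<inter> space M) \<in> events"
    using finA False KE rv by (intro sets.finite_INT) (auto simp: K_def intro!: measurable_sets)
  have "{\<omega> \<in> space M. \<exists>w\<in>A. X {w, v} \<omega> \<le> \<theta>} = space M - (\<Inter>e\<in>K. X e -` {\<theta><..} \<inter> space M)"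
    using False by (auto simp: K_def not_less)
  then show ?thesis using prob_compl[OF ev] 1 by simp
qed simp

text \<open>Different \<open>v\<close> outside \<open>A\<close> use disjoint sets of edges: an edge
  \<open>{w, v} = {w', v'}\<close> with \<open>v \<noteq> v'\<close> would put \<open>v\<close> into
  \<open>A\<close>.\<close>

lemma indep_blocks:
  assumes A: "A \<subseteq> {1..n}" "A \<noteq> {}" and T: "T \<subseteq> {1..n} - A"
  shows "indep_vars (\<lambda>_. borel) (\<lambda>v \<omega>. if \<exists>w\<in>A. X {w, v} \<omega> \<le> \<theta> then 1 else 0 :: real) T"
proof -
  have finA: "finite A" using A(1) by (rule finite_subset) simp
  define K where "K v = (\<lambda>w. {w, v}) ` A" for v
  have KE: "\<And>v. v \<in> T \<Longrightarrow> K v \<subseteq> complete_graph_edges n" using A T by (fastforce simp: K_def)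
  have disj: "disjoint_family_on K T"
    using T by (auto simp: disjoint_family_on_def K_def doubleton_eq_iff)
  have 1: "indep_vars (\<lambda>v. PiM (K v) (\<lambda>_. borel)) (\<lambda>v \<omega>. restrict (\<lambda>e. X e \<omega>) (K v)) T"
    by (rule indep_vars_restrict[OF indep KE disj])
  have 2: "indep_vars (\<lambda>_. borel)
      (\<lambda>v \<omega>. (\<lambda>g. if \<exists>w\<in>A. g {w, v} \<le> \<theta> then 1 else 0 :: real) (restrict (\<lambda>e. X e \<omega>) (K v))) T"
  proof (rule indep_vars_compose2[OF 1])
    fix v assume "v \<in> T"
    have [measurable]: "(\<lambda>g. g {w, v}) \<in> borel_measurable (PiM (K v) (\<lambda>_. borel :: real measure))" if "w \<in> A" for w
      using that by (intro measurable_component_singleton) (auto simp: K_def)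
    show "(\<lambda>g. if \<exists>w\<in>A. g {w, v} \<le> \<theta> then 1 else 0 :: real) \<in> borel_measurable (PiM (K v) (\<lambda>_. borel))"
      using finA by measurable
  qed
  show ?thesis
    by (rule indep_vars_cong[THEN iffD1, OF _ _ _ 2]) (auto simp: K_def)
qed

lemma prob_few_nbrs_le:
  fixes \<delta> \<mu> \<theta> :: real
  assumes A: "A \<subseteq> U" "A \<noteq> {}" and U: "U \<subseteq> {1..n}" and \<delta>: "0 \<le> \<delta>" "\<delta> \<le> 1"
    and \<mu>: "\<mu> * card A \<le> real (card (U - A)) * (1 - (1 - F \<theta>) ^ card A)" "0 \<le> \<mu>"
  shows "prob {\<omega> \<in> space M. real (card (threshold_nbrs (\<lambda>e. X e \<omega>) U \<theta> A)) \<le> (1 - \<delta>) * \<mu> * card A}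
           \<le> exp (- (\<delta>\<^sup>2 * \<mu> / 4 * card A))"
proof -
  let ?T = "U - A"
  have fin: "finite ?T" "finite U" using U finite_subset by auto
  define q where "q = 1 - (1 - F \<theta>) ^ card A"
  define Y where "Y v \<omega> = (if \<exists>w\<in>A. X {w, v} \<omega> \<le> \<theta> then 1 else 0 :: real)" for v \<omega>
  \<comment> \<open>Per unit of \<open>\<mu> * card A\<close> the exponent is at most
    \<open>t * (1 - \<delta>) - t * (1 - t) = t * (t - \<delta>)\<close>, which is minimal at this
    \<open>t\<close> with value \<open>- \<delta>\<^sup>2 / 4\<close>.\<close>
  define t where "t = \<delta> / 2"
  have sumY: "(\<Sum>v\<in>?T. Y v \<omega>) = real (card (threshold_nbrs (\<lambda>e. X e \<omega>) U \<theta> A))" for \<omega>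
    unfolding Y_def threshold_nbrs_def using fin by (subst sum.inter_filter[symmetric]) auto
  have "prob {\<omega> \<in> space M. (\<Sum>v\<in>?T. Y v \<omega>) \<le> (1 - \<delta>) * \<mu> * card A}
      \<le> exp (t * ((1 - \<delta>) * \<mu> * card A) - card ?T * q * (1 - exp (- t)))"
  proof (rule chernoff_lower_tail)
    show "indep_vars (\<lambda>_. borel) Y ?T"
      using indep_blocks[of A ?T \<theta>] A U unfolding Y_def by blast
    fix v assume v: "v \<in> ?T"
    have "{\<omega> \<in> space M. Y v \<omega> = 1} = {\<omega> \<in> space M. \<exists>w\<in>A. X {w, v} \<omega> \<le> \<theta>}" by (auto simp: Y_def)
    then show "q \<le> prob {\<omega> \<in> space M. Y v \<omega> = 1}"
      using prob_block_le[of A v \<theta>] A U v by (simp add: q_def subset_iff)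
  qed (use fin \<delta> in \<open>auto simp: Y_def t_def\<close>)
  also have "\<dots> \<le> exp (- (\<delta>\<^sup>2 * \<mu> / 4 * card A))"
  proof -
    have "t * (1 - t) \<le> 1 - exp (- t)" using \<delta> by (intro one_minus_exp_minus_ge) (simp add: t_def)
    moreover have "0 \<le> \<mu> * card A" using \<mu> by simp
    ultimately have "\<mu> * card A * (t * (1 - t)) \<le> \<mu> * card A * (1 - exp (- t))" by (intro mult_left_mono)
    also have "\<dots> \<le> card ?T * q * (1 - exp (- t))"
      using \<mu> \<delta> by (intro mult_right_mono) (auto simp: q_def t_def)
    finally have "t * ((1 - \<delta>) * \<mu> * card A) - card ?T * q * (1 - exp (- t))
        \<le> t * ((1 - \<delta>) * \<mu> * card A) - \<mu> * card A * (t * (1 - t))" by linarith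
    also have "\<dots> = - (\<delta>\<^sup>2 * \<mu> / 4 * card A)" by (simp add: t_def power2_eq_square field_simps)
    finally show ?thesis by simp
  qed
  finally show ?thesis by (simp add: sumY)
qed

text \<open>The neighbourhood takes finitely many values, so any property \<open>P\<close> of it is
  measurable once each single value is.\<close>

lemma measurable_threshold_nbrs:
  assumes A: "A \<subseteq> U" and U: "U \<subseteq> {1..n}"
  shows "{\<omega> \<in> space M. P (threshold_nbrs (\<lambda>e. X e \<omega>) U \<theta> A)} \<in> events"
proof -
  have fin: "finite U" "finite A" using A U finite_subset by (auto intro: finite_subset)
  have X: "X {w, v} \<in> borel_measurable M" if "w \<in> A" "v \<in> U - A" for w v
    using that A U by (intro rv) auto
  have mv: "{\<omega> \<in> space M. \<exists>w\<in>A. X {w, v} \<omega> \<le> \<theta>} \<in> events" if "v \<in> U - A" for v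
  proof -
    have [measurable]: "X {w, v} \<in> borel_measurable M" if "w \<in> A" for w using X \<open>v \<in> U - A\<close> that by blast
    show ?thesis using fin by measurable
  qed
  have eq: "{\<omega> \<in> space M. threshold_nbrs (\<lambda>e. X e \<omega>) U \<theta> A = S} \<in> events" if S: "S \<subseteq> U - A" for S
  proof -
    have "{\<omega> \<in> space M. threshold_nbrs (\<lambda>e. X e \<omega>) U \<theta> A = S}
        = {\<omega> \<in> space M. \<forall>v\<in>U - A. (\<exists>w\<in>A. X {w, v} \<omega> \<le> \<theta>) = (v \<in> S)}"
      using S by (auto simp: threshold_nbrs_def)
    also have "\<dots> \<in> events"
    proof (intro sets.sets_Collect_finite_All)
      fix v assume v: "v \<in> U - A"
      show "{\<omega> \<in> space M. (\<exists>w\<in>A. X {w, v} \<omega> \<le> \<theta>) = (v \<in> S)} \<in> events"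
        using mv[OF v] sets.sets_Collect_neg[OF mv[OF v]] by (cases "v \<in> S") auto
    qed (use fin in auto)
    finally show ?thesis .
  qed
  have "{\<omega> \<in> space M. P (threshold_nbrs (\<lambda>e. X e \<omega>) U \<theta> A)}
      = (\<Union>S\<in>{S \<in> Pow (U - A). P S}. {\<omega> \<in> space M. threshold_nbrs (\<lambda>e. X e \<omega>) U \<theta> A = S})"
  proof (intro equalityI subsetI)
    fix \<omega> assume "\<omega> \<in> {\<omega> \<in> space M. P (threshold_nbrs (\<lambda>e. X e \<omega>) U \<theta> A)}"
    then show "\<omega> \<in> (\<Union>S\<in>{S \<in> Pow (U - A). P S}. {\<omega> \<in> space M. threshold_nbrs (\<lambda>e. X e \<omega>) U \<theta> A = S})"
      by (intro UN_I[where a = "threshold_nbrs (\<lambda>e. X e \<omega>) U \<theta> A"]) (simp_all add: threshold_nbrs_subset)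
  next
    fix \<omega> assume "\<omega> \<in> (\<Union>S\<in>{S \<in> Pow (U - A). P S}. {\<omega> \<in> space M. threshold_nbrs (\<lambda>e. X e \<omega>) U \<theta> A = S})"
    then show "\<omega> \<in> {\<omega> \<in> space M. P (threshold_nbrs (\<lambda>e. X e \<omega>) U \<theta> A)}"
      by (elim UN_E) simp
  qed
  also have "\<dots> \<in> events"
  proof (rule sets.finite_UN)
    show "finite {S \<in> Pow (U - A). P S}" using fin by simp
  qed (rule eq, simp)
  finally show ?thesis .
qed

text \<open>Uniformity over all sets \<open>A\<close> turns the growth of the reachable set into a
  deterministic consequence of one event; no conditioning on the vertices reached so far is
  needed.\<close>

definition expanding :: "nat set \<Rightarrow> real \<Rightarrow> nat \<Rightarrow> real \<Rightarrow> 'a \<Rightarrow> bool" where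
  "expanding U \<theta> a g \<omega> \<longleftrightarrow>
     (\<forall>A\<subseteq>U. A \<noteq> {} \<longrightarrow> card A \<le> a \<longrightarrow> g * card A \<le> card (threshold_nbrs (\<lambda>e. X e \<omega>) U \<theta> A))"

lemma expanding_sets:
  assumes "U \<subseteq> {1..n}"
  shows "{\<omega> \<in> space M. expanding U \<theta> a g \<omega>} \<in> events"
proof -
  have "{\<omega> \<in> space M. expanding U \<theta> a g \<omega>} = {\<omega> \<in> space M. \<forall>A\<in>{A \<in> Pow U. A \<noteq> {} \<and> card A \<le> a}.
      g * card A \<le> card (threshold_nbrs (\<lambda>e. X e \<omega>) U \<theta> A)}"
    by (auto simp: expanding_def)
  also have "\<dots> \<in> events"
  proof (rule sets.sets_Collect_finite_All)
    show "finite {A \<in> Pow U. A \<noteq> {} \<and> card A \<le> a}" using finite_subset[OF assms] by simp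
    fix A assume "A \<in> {A \<in> Pow U. A \<noteq> {} \<and> card A \<le> a}"
    then show "{\<omega> \<in> space M. g * card A \<le> card (threshold_nbrs (\<lambda>e. X e \<omega>) U \<theta> A)} \<in> events"
      using assms by (intro measurable_threshold_nbrs) auto
  qed
  finally show ?thesis .
qed

text \<open>The failure probability for a set \<open>A\<close> beats the number \<open>n ^ card A\<close> of sets of that size.\<close>

lemma prob_not_expanding_le:
  fixes \<delta> \<mu> \<theta> :: real
  assumes U: "U \<subseteq> {1..n}" and n: "1 \<le> n" and \<delta>: "0 \<le> \<delta>" "\<delta> \<le> 1"
    and \<mu>: "\<And>j. 1 \<le> j \<Longrightarrow> j \<le> a \<Longrightarrow> \<mu> * j \<le> (real (card U) - j) * (1 - (1 - F \<theta>) ^ j)" "0 \<le> \<mu>"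
    and big: "12 * ln n \<le> \<delta>\<^sup>2 * \<mu>"
  shows "prob {\<omega> \<in> space M. \<not> expanding U \<theta> a ((1 - \<delta>) * \<mu>) \<omega>} \<le> 2 / n"
proof -
  let ?N = "\<lambda>\<omega> A. threshold_nbrs (\<lambda>e. X e \<omega>) U \<theta> A"
  have finU: "finite U" using U by (rule finite_subset) simp
  define S where "S A = {\<omega> \<in> space M. real (card (?N \<omega> A)) \<le> (1 - \<delta>) * \<mu> * card A}" for A
  define PA where "PA = {A \<in> Pow U - {{}}. card A \<le> a}"
  have finP: "finite PA" using finU by (simp add: PA_def)
  have S: "S A \<in> events" if "A \<in> PA" for A
    unfolding S_def using that U by (intro measurable_threshold_nbrs) (auto simp: PA_def)
  have "prob {\<omega> \<in> space M. \<not> expanding U \<theta> a ((1 - \<delta>) * \<mu>) \<omega>} \<le> prob (\<Union>A\<in>PA. S A)"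
  proof (rule finite_measure_mono)
    show "(\<Union>A\<in>PA. S A) \<in> events" using S finP by (intro sets.finite_UN) auto
    show "{\<omega> \<in> space M. \<not> expanding U \<theta> a ((1 - \<delta>) * \<mu>) \<omega>} \<subseteq> (\<Union>A\<in>PA. S A)"
    proof
      fix \<omega> assume "\<omega> \<in> {\<omega> \<in> space M. \<not> expanding U \<theta> a ((1 - \<delta>) * \<mu>) \<omega>}"
      then obtain A where "\<omega> \<in> space M" "A \<subseteq> U" "A \<noteq> {}" "card A \<le> a"
          "\<not> (1 - \<delta>) * \<mu> * card A \<le> card (?N \<omega> A)"
        unfolding expanding_def by blast
      then have "A \<in> PA" "\<omega> \<in> S A" by (auto simp: PA_def S_def)
      then show "\<omega> \<in> (\<Union>A\<in>PA. S A)" by blast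
    qed
  qed
  also have "\<dots> \<le> (\<Sum>A\<in>PA. prob (S A))"
    using S finP by (intro finite_measure_subadditive_finite) auto
  also have "\<dots> \<le> (\<Sum>A\<in>PA. (1 / real n ^ 3) ^ card A)"
  proof (rule sum_mono)
    fix A assume A: "A \<in> PA"
    then have AU: "A \<subseteq> U" "A \<noteq> {}" and ca: "card A \<le> a" by (auto simp: PA_def)
    have c1: "1 \<le> card A" using AU finU by (simp add: Suc_le_eq card_gt_0_iff finite_subset)
    have cU: "real (card (U - A)) = real (card U) - card A"
      using AU finU by (simp add: card_Diff_subset card_mono finite_subset of_nat_diff)
    have "prob (S A) \<le> exp (- (\<delta>\<^sup>2 * \<mu> / 4 * card A))"
      unfolding S_def using \<mu>(1)[OF c1 ca] \<mu>(2) cU by (intro prob_few_nbrs_le AU U \<delta>) auto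
    \<comment> \<open>The 12 in the hypothesis is 4 times 3: the 4 is lost in Chernoff's bound and
      the 3 yields \<open>n\<close> to the power \<open>- 3\<close> for each vertex of
      \<open>A\<close>.\<close>
    also have "\<dots> \<le> exp (- (3 * ln n * card A))"
      using mult_right_mono[OF big, of "real (card A)"] by simp
    also have "\<dots> = (1 / real n ^ 3) ^ card A"
    proof -
      have "exp (- (3 * ln n * card A)) = exp (- (3 * ln n)) ^ card A"
        by (simp add: exp_of_nat_mult[symmetric] mult.commute)
      also have "exp (- (3 * ln n)) = 1 / real n ^ 3"
        using n exp_of_nat_mult[of 3 "ln (real n)"] by (simp add: exp_minus field_simps)
      finally show ?thesis .
    qed
    finally show "prob (S A) \<le> (1 / real n ^ 3) ^ card A" .
  qed
  \<comment> \<open>Adding the sets with more than \<open>a\<close> vertices gives the sum the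
    closed form of a binomial expansion.\<close>
  also have "\<dots> \<le> (\<Sum>A\<in>Pow U - {{}}. (1 / real n ^ 3) ^ card A)"
    using finU by (intro sum_mono2) (auto simp: PA_def)
  also have "\<dots> = (\<Sum>A\<in>Pow U. (1 / real n ^ 3) ^ card A) - 1"
    using finU by (subst sum_diff) auto
  also have "(\<Sum>A\<in>Pow U. (1 / real n ^ 3) ^ card A) = (1 / real n ^ 3 + 1) ^ card U"
    using prod_add[OF finU, of "\<lambda>_. 1 / real n ^ 3" "\<lambda>_. 1"] by simp
  also have "\<dots> \<le> exp (1 / real n ^ 3) ^ card U"
    using exp_ge_add_one_self[of "1 / real n ^ 3"] by (intro power_mono) (auto simp: add.commute)
  also have "\<dots> = exp (real (card U) * (1 / real n ^ 3))" by (rule exp_of_nat_mult[symmetric])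
  also have "\<dots> \<le> exp (1 / n)"
  proof -
    have "card U \<le> n" using card_mono[OF _ U] by simp
    then have "real (card U) * (1 / real n ^ 3) \<le> real n * (1 / real n ^ 3)" by (intro mult_right_mono) auto
    also have "\<dots> \<le> real n * (1 / real n ^ 2)"
      using n by (intro mult_left_mono divide_left_mono power_increasing) auto
    also have "\<dots> = 1 / n" using n by (simp add: power2_eq_square)
    finally show ?thesis by simp
  qed
  also have "\<dots> \<le> 1 + 2 / n"
  proof -
    have "exp (1 / real n) \<le> 1 + 1 / n + (1 / n)\<^sup>2" using n by (intro exp_bound) auto
    also have "(1 / real n)\<^sup>2 \<le> 1 / n" using n by (simp add: power2_eq_square field_simps)
    finally show ?thesis by simp
  qed
  finally show ?thesis by simp
qed

end

section \<open>Growth and the last edge\<close>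

text \<open>The reachable set may be larger than the size \<open>a\<close> up to which expansion is
  known, so a subset with exactly \<open>\<lceil>c0\<rceil>\<close> vertices is expanded. The
  condition \<open>c0 + 1 \<le> a\<close> makes room for rounding up.\<close>

lemma card_reachable_within_step:
  fixes c c0 \<theta> g :: real
  assumes nonneg: "\<And>i j. i \<in> U \<Longrightarrow> j \<in> U \<Longrightarrow> i \<noteq> j \<Longrightarrow> 0 \<le> x {i, j}"
    and exp: "\<And>A. A \<subseteq> U \<Longrightarrow> A \<noteq> {} \<Longrightarrow> card A \<le> a \<Longrightarrow> g * card A \<le> card (threshold_nbrs x U \<theta> A)"
    and U: "finite U" and c0: "0 < c0" "c0 \<le> card (reachable_within x U c)" "c0 + 1 \<le> a" and g: "0 \<le> g"
  shows "g * c0 \<le> card (reachable_within x U (c + \<theta>))"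
proof -
  let ?R = "reachable_within x U"
  have "nat \<lceil>c0\<rceil> \<le> card (?R c)" using c0(2) by (simp add: ceiling_le nat_le_iff)
  then obtain A where A: "A \<subseteq> ?R c" "card A = nat \<lceil>c0\<rceil>" by (meson obtain_subset_with_card_n)
  have AU: "A \<subseteq> U" using A(1) reachable_within_subset[of x U c] by blast
  have cA: "c0 \<le> card A" using A(2) c0(1) by linarith
  have "A \<noteq> {}" using A(2) c0(1) by auto
  moreover have "card A \<le> a" using A(2) c0 by linarith
  ultimately have "g * card A \<le> card (threshold_nbrs x U \<theta> A)" using exp AU by blast
  moreover have "threshold_nbrs x U \<theta> A \<subseteq> ?R (c + \<theta>)"
  proof
    fix v assume "v \<in> threshold_nbrs x U \<theta> A"
    then obtain w where w: "v \<in> U" "v \<notin> A" "w \<in> A" "x {w, v} \<le> \<theta>" by (auto simp: threshold_nbrs_def)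
    then show "v \<in> ?R (c + \<theta>)"
      using A(1) by (intro reachable_within_step[of U x w c v \<theta>] nonneg) auto
  qed
  moreover have "finite (?R (c + \<theta>))"
    using U finite_subset[OF reachable_within_subset] by blast
  ultimately have "g * card A \<le> card (?R (c + \<theta>))" by (meson card_mono le_trans of_nat_mono order_trans)
  then show ?thesis using mult_left_mono[OF cA g] by linarith
qed

lemma card_reachable_within_iter:
  fixes \<theta> g :: real
  assumes nonneg: "\<And>i j. i \<in> U \<Longrightarrow> j \<in> U \<Longrightarrow> i \<noteq> j \<Longrightarrow> 0 \<le> x {i, j}"
    and exp: "\<And>A. A \<subseteq> U \<Longrightarrow> A \<noteq> {} \<Longrightarrow> card A \<le> a \<Longrightarrow> g * card A \<le> card (threshold_nbrs x U \<theta> A)"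
    and U: "finite U" "1 \<in> U" and g: "1 \<le> g" and a: "g ^ m + 1 \<le> a"
  shows "j \<le> Suc m \<Longrightarrow> g ^ j \<le> card (reachable_within x U (j * \<theta>))"
proof (induction j)
  case 0
  have "finite (reachable_within x U 0)"
    using U finite_subset[OF reachable_within_subset] by blast
  then have "card (reachable_within x U 0) \<noteq> 0"
    using reachable_within_start[OF U(2), of x] by auto
  then show ?case by (simp add: Suc_le_eq)
next
  case (Suc j)
  have "g ^ j \<le> g ^ m" using Suc.prems g by (intro power_increasing) auto
  then have "g * g ^ j \<le> card (reachable_within x U (j * \<theta> + \<theta>))"
    using Suc g a by (intro card_reachable_within_step[OF nonneg exp U(1)]) auto
  then show ?case by (simp add: algebra_simps)
qed

lemma path_edges_within:
  "distinct p \<Longrightarrow> set p \<subseteq> U \<Longrightarrow> e \<in> set (path_edges p) \<Longrightarrow> \<exists>i\<in>U. \<exists>j\<in>U. i \<noteq> j \<and> e = {i, j}"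
  using path_edges_pairs by blast

text \<open>Shows that reachable sets are functions of the edges inside \<open>U\<close> alone, as
  needed to separate them from the edges at vertex 2.\<close>

lemma reachable_within_cong:
  assumes "\<And>i j. i \<in> U \<Longrightarrow> j \<in> U \<Longrightarrow> i \<noteq> j \<Longrightarrow> x {i, j} = y {i, j}"
  shows "reachable_within x U c = reachable_within y U c"
proof -
  have "path_weight x p = path_weight y p" if "distinct p" "set p \<subseteq> U" for p
    unfolding path_weight_eq_sum[OF that(1)]
    using path_edges_within[OF that] assms by (intro sum.cong) auto
  then show ?thesis unfolding reachable_within_def by (metis (no_types, lifting))
qed

text \<open>Stated for a general space \<open>N\<close> because it is applied both to the
  probability space and to a product space of edge weights, where it provides the event needed for
  independence.\<close>

lemma reachable_within_measurable:
  assumes U: "finite U"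
    and Y: "\<And>i j. i \<in> U \<Longrightarrow> j \<in> U \<Longrightarrow> i \<noteq> j \<Longrightarrow> Y {i, j} \<in> borel_measurable N"
  shows "{y \<in> space N. reachable_within (\<lambda>e. Y e y) U c = S} \<in> sets N"
proof (cases "S \<subseteq> U")
  case True
  define PP where "PP v = {p. set p \<subseteq> U \<and> length p \<le> card U} \<inter> {p. p \<noteq> [] \<and> hd p = 1 \<and> last p = v \<and> distinct p}" for v
  have finP: "finite (PP v)" for v
    unfolding PP_def using finite_lists_length_le[OF U, of "card U"] by blast
  have r: "v \<in> reachable_within x U c \<longleftrightarrow> (\<exists>p\<in>PP v. path_weight x p \<le> c)" for v x
  proof -
    have "length p \<le> card U" if "distinct p" "set p \<subseteq> U" for p
      using distinct_card[OF that(1)] card_mono[OF U that(2)] by simp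
    then show ?thesis by (auto simp: reachable_within_def PP_def)
  qed
  have "(\<lambda>y. path_weight (\<lambda>e. Y e y) p) \<in> borel_measurable N" if "p \<in> PP v" for p v
  proof -
    have p: "distinct p" "set p \<subseteq> U" using that by (auto simp: PP_def)
    show ?thesis
      unfolding path_weight_eq_sum[OF p(1)]
      using path_edges_within[OF p] Y by (intro borel_measurable_sum) auto
  qed
  then have "{y \<in> space N. path_weight (\<lambda>e. Y e y) p \<le> c} \<in> sets N" if "p \<in> PP v" for p v
    using that by (intro borel_measurable_le) auto
  then have mv: "{y \<in> space N. v \<in> reachable_within (\<lambda>e. Y e y) U c} \<in> sets N" for v
    unfolding r using finP by (intro sets.sets_Collect_finite_Ex) auto
  have "{y \<in> space N. reachable_within (\<lambda>e. Y e y) U c = S}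
      = {y \<in> space N. \<forall>v\<in>U. (v \<in> reachable_within (\<lambda>e. Y e y) U c) = (v \<in> S)}"
    using True reachable_within_subset by blast
  also have "\<dots> \<in> sets N"
  proof (rule sets.sets_Collect_finite_All[OF _ U])
    fix v
    show "{y \<in> space N. (v \<in> reachable_within (\<lambda>e. Y e y) U c) = (v \<in> S)} \<in> sets N"
      using mv[of v] sets.sets_Collect_neg[OF mv[of v]] by (cases "v \<in> S") simp_all
  qed
  finally show ?thesis .
next
  case False
  then have eq: "{y \<in> space N. reachable_within (\<lambda>e. Y e y) U c = S} = {}"
    using reachable_within_subset by blast
  show ?thesis by (simp only: eq sets.empty_sets)
qed

section \<open>Independence of the last edge from the growth\<close>

context iid_weights
begin

lemma prob_interval:
  assumes e: "e \<in> complete_graph_edges n" and ab: "a \<le> b"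
  shows "prob {\<omega> \<in> space M. X e \<omega> \<in> {a<..b}} = F b - F a"
proof -
  have "{\<omega> \<in> space M. X e \<omega> \<in> {a<..b}} = {\<omega> \<in> space M. X e \<omega> \<le> b} - {\<omega> \<in> space M. X e \<omega> \<le> a}" by auto
  also have "prob \<dots> = F b - F a"
    using ab by (subst finite_measure_Diff) (auto intro!: sets_edge_Collect e simp: prob_le[OF e])
  finally show ?thesis .
qed

text \<open>The edges at vertex 2 are independent of the weights that determine the sets of vertices
  reachable from vertex 1 without passing through vertex 2.\<close>

lemma prob_reachable_no_connection_le:
  fixes h :: "nat \<Rightarrow> real" and I :: nat
  assumes h: "\<And>i. h (Suc i) \<le> h i" and n: "2 \<le> n"
    and U: "U = {1..n} - {2}" and f: "\<And>i. i < I \<Longrightarrow> f i \<subseteq> U"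
  shows "prob {\<omega> \<in> space M. (\<forall>i<I. reachable_within (\<lambda>e. X e \<omega>) U (c i) = f i) \<and>
             (\<forall>v\<in>U. \<forall>i<I. v \<in> f i \<longrightarrow> X {2, v} \<omega> \<notin> {h (Suc i)<..h i})}
     \<le> prob {\<omega> \<in> space M. \<forall>i<I. reachable_within (\<lambda>e. X e \<omega>) U (c i) = f i} *
        exp (- (\<Sum>i<I. card (f i) * (F (h i) - F (h (Suc i)))))" (is "prob ?EV \<le> prob ?PV * _")
proof -
  let ?J = "\<lambda>i. {h (Suc i)<..h i}"
  let ?\<Delta> = "\<lambda>i. F (h i) - F (h (Suc i))"
  have finU: "finite U" using U by simp
  \<comment> \<open>One block for all edges that avoid vertex 2, indexed by \<open>None\<close>, and
    one block for each single edge at vertex 2.\<close>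
  define L where "L = insert None (Some ` U)"
  define K where "K j = (case j of None \<Rightarrow> {e \<in> complete_graph_edges n. 2 \<notin> e} | Some v \<Rightarrow> {{2, v}})" for j
  have K_simps: "K None = {e \<in> complete_graph_edges n. 2 \<notin> e}" "\<And>v. K (Some v) = {{2, v}}"
    by (simp_all add: K_def)
  have KE: "K j \<subseteq> complete_graph_edges n" if "j \<in> L" for j
    using that U n by (auto simp: L_def K_simps)
  have disj: "disjoint_family_on K L"
    by (auto simp: disjoint_family_on_def L_def K_simps doubleton_eq_iff)
  define Y where "Y j \<omega> = restrict (\<lambda>e. X e \<omega>) (K j)" for j \<omega>
  have ind: "indep_vars (\<lambda>j. PiM (K j) (\<lambda>_. borel)) Y L"
    using indep_vars_restrict[OF indep KE disj] unfolding Y_def .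
  define A where "A j = (case j of
      None \<Rightarrow> {g \<in> space (PiM (K None) (\<lambda>_. borel)). \<forall>i<I. reachable_within g U (c i) = f i}
    | Some v \<Rightarrow> {g \<in> space (PiM (K (Some v)) (\<lambda>_. borel)). \<forall>i<I. v \<in> f i \<longrightarrow> g {2, v} \<notin> ?J i})" for j
  have inner: "{i, j} \<in> K None" if "i \<in> U" "j \<in> U" "i \<noteq> j" for i j
    using that U by (auto simp: K_simps)
  have A_sets: "A j \<in> sets (PiM (K j) (\<lambda>_. borel))" if j: "j \<in> L" for j
  proof (cases j)
    case None
    have "{g \<in> space (PiM (K None) (\<lambda>_. borel)). \<forall>i\<in>{..<I}. reachable_within g U (c i) = f i}
        \<in> sets (PiM (K None) (\<lambda>_. borel))"
    proof (rule sets.sets_Collect_finite_All)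
      fix i
      show "{g \<in> space (PiM (K None) (\<lambda>_. borel)). reachable_within g U (c i) = f i}
          \<in> sets (PiM (K None) (\<lambda>_. borel))"
        using reachable_within_measurable[OF finU, of "\<lambda>e g. g e" "PiM (K None) (\<lambda>_. borel)" "c i" "f i"] inner
        by (simp add: measurable_component_singleton)
    qed simp
    moreover have "A j = {g \<in> space (PiM (K j) (\<lambda>_. borel)). \<forall>i\<in>{..<I}. reachable_within g U (c i) = f i}"
      by (simp add: A_def None Ball_def)
    ultimately show ?thesis by (simp only: None)
  next
    case (Some v)
    have [measurable]: "(\<lambda>g. g {2, v}) \<in> borel_measurable (PiM (K (Some v)) (\<lambda>_. borel :: real measure))"
      by (intro measurable_component_singleton) (simp add: K_simps)
    have "A j = (\<lambda>g. g {2, v}) -` (- (\<Union>i\<in>{i. i < I \<and> v \<in> f i}. ?J i)) \<inter> space (PiM (K j) (\<lambda>_. borel))"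
      unfolding Some A_def by auto
    also have "\<dots> \<in> sets (PiM (K j) (\<lambda>_. borel))"
    proof -
      have "- (\<Union>i\<in>{i. i < I \<and> v \<in> f i}. ?J i) \<in> sets borel"
        by (intro borel_comp sets.finite_UN) auto
      then show ?thesis unfolding Some by (intro measurable_sets[where A = borel]) auto
    qed
    finally show ?thesis .
  qed
  have Y_space: "Y j \<omega> \<in> space (PiM (K j) (\<lambda>_. borel :: real measure))" for j \<omega>
    by (simp add: Y_def space_PiM)
  have Y_reach: "reachable_within (Y None \<omega>) U d = reachable_within (\<lambda>e. X e \<omega>) U d" for \<omega> d
    by (rule reachable_within_cong) (simp add: Y_def inner)
  have vN: "Y None -` A None \<inter> space M = ?PV"
    using Y_space[of None] by (auto simp: A_def Y_reach)
  have vS: "Y (Some v) -` A (Some v) \<inter> space M = {\<omega> \<in> space M. \<forall>i<I. v \<in> f i \<longrightarrow> X {2, v} \<omega> \<notin> ?J i}" for v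
    using Y_space[of "Some v"] by (auto simp: A_def Y_def K_simps)
  have "?EV = (\<Inter>j\<in>L. Y j -` A j \<inter> space M)"
  proof -
    have "(\<Inter>j\<in>L. Y j -` A j \<inter> space M)
        = (Y None -` A None \<inter> space M) \<inter> (\<Inter>v\<in>U. Y (Some v) -` A (Some v) \<inter> space M)"
      by (simp add: L_def)
    then show ?thesis unfolding vN vS by auto
  qed
  also have "prob \<dots> = (\<Prod>j\<in>L. prob (Y j -` A j \<inter> space M))"
    by (rule indep_varsD_finite[OF ind]) (use finU A_sets in \<open>auto simp: L_def\<close>)
  also have "\<dots> = prob (Y None -` A None \<inter> space M) * (\<Prod>j\<in>Some ` U. prob (Y j -` A j \<inter> space M))"
    unfolding L_def using finU by (subst prod.insert) auto
  also have "(\<Prod>j\<in>Some ` U. prob (Y j -` A j \<inter> space M)) = (\<Prod>v\<in>U. prob (Y (Some v) -` A (Some v) \<inter> space M))"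
    by (subst prod.reindex) auto
  also have "prob (Y None -` A None \<inter> space M) = prob ?PV" by (simp only: vN)
  also have "(\<Prod>v\<in>U. prob (Y (Some v) -` A (Some v) \<inter> space M))
      \<le> (\<Prod>v\<in>U. exp (- (\<Sum>i<I. if v \<in> f i then ?\<Delta> i else 0)))"
  proof (rule prod_mono, intro conjI)
    fix v assume v: "v \<in> U"
    then have e: "{2, v} \<in> complete_graph_edges n" using U n by auto
    define Iv where "Iv = {i. i < I \<and> v \<in> f i}"
    define B where "B i = {\<omega> \<in> space M. X {2, v} \<omega> \<in> ?J i}" for i
    have B: "B i \<in> events" for i unfolding B_def by (rule sets_edge_Collect[OF e]) simp
    have anti: "h j \<le> h i" if "i \<le> j" for i j
      using that h by (rule lift_Suc_antimono_le[rotated])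
    \<comment> \<open>Since \<open>h\<close> decreases, the intervals for different \<open>i\<close>
      are disjoint, so the chances that one and the same edge offers at different \<open>i\<close>
      add up.\<close>
    have "disjoint_family_on B Iv"
    proof (unfold disjoint_family_on_def, intro ballI impI)
      fix i j assume "i \<in> Iv" "j \<in> Iv" "i \<noteq> j"
      then consider "Suc i \<le> j" | "Suc j \<le> i" by linarith
      then show "B i \<inter> B j = {}" by cases (use anti in \<open>force simp: B_def\<close>)+
    qed
    then have "prob (\<Union>i\<in>Iv. B i) = (\<Sum>i\<in>Iv. prob (B i))"
      using B by (intro finite_measure_finite_Union) (auto simp: Iv_def)
    also have "\<dots> = (\<Sum>i\<in>Iv. ?\<Delta> i)" unfolding B_def using prob_interval[OF e h] by simp
    also have "\<dots> = (\<Sum>i<I. if v \<in> f i then ?\<Delta> i else 0)"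
      by (subst sum.inter_filter[symmetric]) (auto simp: Iv_def)
    finally have pU: "prob (\<Union>i\<in>Iv. B i) = (\<Sum>i<I. if v \<in> f i then ?\<Delta> i else 0)" .
    have "Y (Some v) -` A (Some v) \<inter> space M = space M - (\<Union>i\<in>Iv. B i)"
      unfolding vS by (auto simp: Iv_def B_def)
    also have "prob \<dots> = 1 - prob (\<Union>i\<in>Iv. B i)"
      using B by (intro prob_compl sets.finite_UN) (auto simp: Iv_def)
    also have "\<dots> \<le> exp (- (\<Sum>i<I. if v \<in> f i then ?\<Delta> i else 0))"
      using exp_ge_add_one_self[of "- (\<Sum>i<I. if v \<in> f i then ?\<Delta> i else 0)"] pU by simp
    finally show "prob (Y (Some v) -` A (Some v) \<inter> space M) \<le> exp (- (\<Sum>i<I. if v \<in> f i then ?\<Delta> i else 0))" .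
  qed simp
  also have "(\<Prod>v\<in>U. exp (- (\<Sum>i<I. if v \<in> f i then ?\<Delta> i else 0)))
      = exp (- (\<Sum>i<I. \<Sum>v\<in>U. if v \<in> f i then ?\<Delta> i else 0))"
    using finU by (simp add: exp_sum[symmetric] sum_negf) (rule sum.swap)
  also have "(\<Sum>i<I. \<Sum>v\<in>U. if v \<in> f i then ?\<Delta> i else 0) = (\<Sum>i<I. card (f i) * ?\<Delta> i)"
  proof (rule sum.cong[OF refl])
    fix i assume "i \<in> {..<I}"
    then have "f i \<subseteq> U" using f by simp
    then show "(\<Sum>v\<in>U. if v \<in> f i then ?\<Delta> i else 0) = card (f i) * ?\<Delta> i"
      using finU by (simp add: sum.If_cases Int_absorb1)
  qed
  finally show ?thesis by (simp add: mult_left_mono)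
qed

text \<open>Total probability over the possible values \<open>f\<close> of the reachable sets. An
  edge heavier than \<open>h i\<close> misses the interval from \<open>h (Suc i)\<close> to
  \<open>h i\<close>; passing to these intervals weakens the event but makes it computable, and the
  resulting exponent is at least the same sum for every admissible \<open>f\<close>.\<close>

lemma prob_no_connection_le:
  fixes h c q :: "nat \<Rightarrow> real"
  assumes h: "\<And>i. h (Suc i) \<le> h i" and n: "2 \<le> n" and U: "U = {1..n} - {2}"
  shows "prob {\<omega> \<in> space M. \<forall>i<I. q i \<le> card (reachable_within (\<lambda>e. X e \<omega>) U (c i)) \<and>
             (\<forall>v\<in>reachable_within (\<lambda>e. X e \<omega>) U (c i). h i < X {2, v} \<omega>)}
     \<le> exp (- (\<Sum>i<I. q i * (F (h i) - F (h (Suc i)))))" (is "prob ?A \<le> exp (- ?s)")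
proof -
  let ?R = "\<lambda>i \<omega>. reachable_within (\<lambda>e. X e \<omega>) U (c i)"
  let ?\<Delta> = "\<lambda>i. F (h i) - F (h (Suc i))"
  have finU: "finite U" using U by simp
  have XU: "X {i, j} \<in> borel_measurable M" if "i \<in> {1..n}" "j \<in> {1..n}" "i \<noteq> j" for i j
    using that by (intro rv) simp
  have \<Delta>: "0 \<le> ?\<Delta> i" for i
  proof -
    have e: "{1, 2} \<in> complete_graph_edges n" using n by simp
    show ?thesis using prob_interval[OF e h[of i]] by (metis measure_nonneg)
  qed
  \<comment> \<open>The functions are extensional on \<open>{..<I}\<close>, so two different ones
    differ at some \<open>i < I\<close> and their events are disjoint.\<close>
  define FAM where "FAM = {f \<in> {..<I} \<rightarrow>\<^sub>E Pow U. \<forall>i<I. q i \<le> card (f i)}"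
  have finF: "finite FAM" unfolding FAM_def using finU by (simp add: finite_PiE)
  have FU: "f i \<subseteq> U" if "f \<in> FAM" "i < I" for f i using that by (auto simp: FAM_def PiE_def Pi_def)
  define PV where "PV f = {\<omega> \<in> space M. \<forall>i<I. ?R i \<omega> = f i}" for f
  define EV where "EV f = {\<omega> \<in> space M. (\<forall>i<I. ?R i \<omega> = f i) \<and>
      (\<forall>v\<in>U. \<forall>i<I. v \<in> f i \<longrightarrow> X {2, v} \<omega> \<notin> {h (Suc i)<..h i})}" for f
  have "{\<omega> \<in> space M. \<forall>i\<in>{..<I}. ?R i \<omega> = f i} \<in> events" for f
    using XU U by (intro sets.sets_Collect_finite_All reachable_within_measurable finU) auto
  moreover have "PV f = {\<omega> \<in> space M. \<forall>i\<in>{..<I}. ?R i \<omega> = f i}" for f by (simp add: PV_def Ball_def)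
  ultimately have PV: "PV f \<in> events" for f by (simp only:)
  have EV: "EV f \<in> events" for f
  proof -
    have "{\<omega> \<in> space M. X {2, v} \<omega> \<notin> {h (Suc i)<..h i}} \<in> events" if "v \<in> U" for v i
      using that U n by (intro sets_edge_Collect) auto
    then have "{\<omega> \<in> space M. v \<in> f i \<longrightarrow> X {2, v} \<omega> \<notin> {h (Suc i)<..h i}} \<in> events" if "v \<in> U" for v i
      using that by (cases "v \<in> f i") simp_all
    then have "{\<omega> \<in> space M. \<forall>v\<in>U. \<forall>i\<in>{..<I}. v \<in> f i \<longrightarrow> X {2, v} \<omega> \<notin> {h (Suc i)<..h i}} \<in> events"
      by (intro sets.sets_Collect_finite_All finU finite_lessThan)
    moreover have "EV f = PV f \<inter> {\<omega> \<in> space M. \<forall>v\<in>U. \<forall>i\<in>{..<I}. v \<in> f i \<longrightarrow> X {2, v} \<omega> \<notin> {h (Suc i)<..h i}}"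
      by (auto simp: EV_def PV_def)
    ultimately show ?thesis by (simp only: PV sets.Int)
  qed
  have "prob ?A \<le> prob (\<Union>f\<in>FAM. EV f)"
  proof (rule finite_measure_mono)
    show "(\<Union>f\<in>FAM. EV f) \<in> events" using EV finF by (intro sets.finite_UN) auto
    show "?A \<subseteq> (\<Union>f\<in>FAM. EV f)"
    proof
      fix \<omega> assume \<omega>: "\<omega> \<in> ?A"
      define f where "f = restrict (\<lambda>i. ?R i \<omega>) {..<I}"
      have "f \<in> FAM" using \<omega> reachable_within_subset by (auto simp: FAM_def f_def)
      moreover have "\<omega> \<in> EV f" using \<omega> by (fastforce simp: EV_def f_def)
      ultimately show "\<omega> \<in> (\<Union>f\<in>FAM. EV f)" by blast
    qed
  qed
  also have "\<dots> \<le> (\<Sum>f\<in>FAM. prob (EV f))"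
    using EV finF by (intro finite_measure_subadditive_finite) auto
  also have "\<dots> \<le> (\<Sum>f\<in>FAM. prob (PV f) * exp (- ?s))"
  proof (rule sum_mono)
    fix f assume f: "f \<in> FAM"
    have "prob (EV f) \<le> prob (PV f) * exp (- (\<Sum>i<I. card (f i) * ?\<Delta> i))"
      unfolding EV_def PV_def by (rule prob_reachable_no_connection_le[where h = h and f = f]) (use h n U FU[OF f] in simp_all)
    also have "\<dots> \<le> prob (PV f) * exp (- ?s)"
      using f \<Delta> by (intro mult_left_mono) (auto simp: FAM_def intro!: sum_mono mult_right_mono)
    finally show "prob (EV f) \<le> prob (PV f) * exp (- ?s)" .
  qed
  also have "\<dots> = prob (\<Union>f\<in>FAM. PV f) * exp (- ?s)"
  proof -
    have "disjoint_family_on PV FAM"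
    proof (unfold disjoint_family_on_def, intro ballI impI)
      fix f g assume fg: "f \<in> FAM" "g \<in> FAM" "f \<noteq> g"
      then have "\<exists>i<I. f i \<noteq> g i" unfolding FAM_def by (metis (no_types, lifting) PiE_ext lessThan_iff mem_Collect_eq)
      then show "PV f \<inter> PV g = {}" by (auto simp: PV_def)
    qed
    then have "prob (\<Union>f\<in>FAM. PV f) = (\<Sum>f\<in>FAM. prob (PV f))"
      using PV finF by (intro finite_measure_finite_Union) auto
    then show ?thesis by (simp add: sum_distrib_right)
  qed
  also have "\<dots> \<le> 1 * exp (- ?s)" by (intro mult_right_mono) auto
  finally show ?thesis by simp
qed

end

section \<open>Uniqueness of the minimal path and measurability\<close>

context iid_weights
begin

text \<open>An edge \<open>e\<close> of one path that is missing in the other one has an atomless weight independent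
  of the weights of all other edges.\<close>

lemma AE_path_weight_neq:
  assumes p: "p \<in> self_avoiding_paths n a b" and q: "q \<in> self_avoiding_paths n a b"
    and e: "e \<in> set (path_edges p)" "e \<notin> set (path_edges q)"
  shows "AE \<omega> in M. path_weight (\<lambda>e. X e \<omega>) p \<noteq> path_weight (\<lambda>e. X e \<omega>) q"
proof -
  let ?E = "complete_graph_edges n"
  note P = self_avoiding_pathsD[OF p]
  note Q = self_avoiding_pathsD[OF q]
  have eE: "e \<in> ?E" using e P by blast
  define P' where "P' = set (path_edges p) - {e}"
  define Q' where "Q' = set (path_edges q)"
  have sub: "P' \<subseteq> ?E - {e}" "Q' \<subseteq> ?E - {e}" using P Q e by (auto simp: P'_def Q'_def)
  \<comment> \<open>Equal path weights mean \<open>X e = V\<close>, and \<open>V\<close> does not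
    involve the edge \<open>e\<close>.\<close>
  define V where "V \<omega> = (\<Sum>f\<in>Q'. X f \<omega>) - (\<Sum>f\<in>P'. X f \<omega>)" for \<omega>
  have 1: "indep_var (PiM {e} (\<lambda>_. borel)) (\<lambda>\<omega>. restrict (\<lambda>i. X i \<omega>) {e})
      (PiM (?E - {e}) (\<lambda>_. borel)) (\<lambda>\<omega>. restrict (\<lambda>i. X i \<omega>) (?E - {e}))"
    by (rule indep_var_restrict[OF indep]) (use eE in auto)
  have m1: "(\<lambda>g. g e) \<in> borel_measurable (PiM {e} (\<lambda>_. borel :: real measure))"
    by (rule measurable_component_singleton) simp
  have m2: "(\<lambda>g. (\<Sum>f\<in>Q'. g f) - (\<Sum>f\<in>P'. g f)) \<in> borel_measurable (PiM (?E - {e}) (\<lambda>_. borel :: real measure))"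
    by (intro borel_measurable_diff borel_measurable_sum measurable_component_singleton) (use sub in auto)
  have "(\<lambda>g. g e) \<circ> (\<lambda>\<omega>. restrict (\<lambda>i. X i \<omega>) {e}) = X e" by auto
  moreover have "(\<lambda>g. (\<Sum>f\<in>Q'. g f) - (\<Sum>f\<in>P'. g f)) \<circ> (\<lambda>\<omega>. restrict (\<lambda>i. X i \<omega>) (?E - {e})) = V"
    using sub by (auto simp: V_def fun_eq_iff intro!: arg_cong2[where f = "(-)"] sum.cong)
  ultimately have ind: "indep_var borel (X e) borel V"
    using indep_var_compose[OF 1 m1 m2] by simp
  then have rvs: "X e \<in> borel_measurable M" "V \<in> borel_measurable M"
    and eq: "distr M borel (X e) \<Otimes>\<^sub>M distr M borel V = distr M (borel \<Otimes>\<^sub>M borel) (\<lambda>\<omega>. (X e \<omega>, V \<omega>))"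
    by (simp_all add: indep_var_distribution_eq)
  interpret DX: real_distribution "distr M borel (X e)" using rvs(1) by (rule real_distribution_distr)
  interpret DV: real_distribution "distr M borel V" using rvs(2) by (rule real_distribution_distr)
  interpret pair_sigma_finite "distr M borel (X e)" "distr M borel V" ..
  have atom: "emeasure (distr M borel (X e)) {y} = 0" for y
  proof -
    have "cdf (distr M borel (X e)) = F" "continuous_on UNIV F"
      using iid eE by (auto simp: iid_edge_weights_def)
    then have "isCont (cdf (distr M borel (X e))) y" by (simp add: continuous_on_eq_continuous_at)
    then have "measure (distr M borel (X e)) {y} = 0" by (simp add: DX.isCont_cdf)
    then show ?thesis by (simp add: DX.emeasure_eq_measure)
  qed
  define D where "D = {z :: real \<times> real. fst z = snd z}"
  have D: "D \<in> sets (borel \<Otimes>\<^sub>M borel)"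
  proof -
    have "{z \<in> space (borel \<Otimes>\<^sub>M borel). fst z = (snd z :: real)} \<in> sets (borel \<Otimes>\<^sub>M borel)" by measurable
    then show ?thesis by (simp add: D_def space_pair_measure)
  qed
  have D': "D \<in> sets (distr M borel (X e) \<Otimes>\<^sub>M distr M borel V)"
    using D by (simp cong: sets_pair_measure_cong)
  have "emeasure M {\<omega> \<in> space M. X e \<omega> = V \<omega>} = emeasure (distr M (borel \<Otimes>\<^sub>M borel) (\<lambda>\<omega>. (X e \<omega>, V \<omega>))) D"
    using D rvs by (subst emeasure_distr) (auto simp: D_def intro!: arg_cong[where f = "emeasure M"])
  \<comment> \<open>Fubini: each slice of the diagonal is a single point, which is null for the law
    of \<open>X e\<close>.\<close>
  also have "\<dots> = (\<integral>\<^sup>+y. emeasure (distr M borel (X e)) ((\<lambda>x. (x, y)) -` D) \<partial>distr M borel V)"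
    unfolding eq[symmetric] by (rule emeasure_pair_measure_alt2[OF D'])
  also have "\<dots> = 0"
  proof -
    have "(\<lambda>x. (x, y)) -` D = {y}" for y by (auto simp: D_def)
    then show ?thesis by (simp add: atom)
  qed
  finally have "emeasure M {\<omega> \<in> space M. X e \<omega> = V \<omega>} = 0" .
  moreover have "{\<omega> \<in> space M. X e \<omega> = V \<omega>} \<in> events" using rvs by measurable
  ultimately have "AE \<omega> in M. X e \<omega> \<noteq> V \<omega>" by (subst AE_iff_measurable) auto
  then show ?thesis
  proof (rule AE_mp, intro AE_I2 impI notI)
    fix \<omega> assume "X e \<omega> \<noteq> V \<omega>" and pq: "path_weight (\<lambda>e. X e \<omega>) p = path_weight (\<lambda>e. X e \<omega>) q"
    have "path_weight (\<lambda>e. X e \<omega>) p = X e \<omega> + (\<Sum>f\<in>P'. X f \<omega>)"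
      unfolding path_weight_eq_sum[OF P(4)] P'_def using e(1) by (intro sum.remove) auto
    moreover have "path_weight (\<lambda>e. X e \<omega>) q = (\<Sum>f\<in>Q'. X f \<omega>)"
      unfolding path_weight_eq_sum[OF Q(4)] Q'_def ..
    ultimately show False using pq \<open>X e \<omega> \<noteq> V \<omega>\<close> by (simp add: V_def)
  qed
qed

lemma AE_path_weight_inj:
  "AE \<omega> in M. inj_on (path_weight (\<lambda>e. X e \<omega>)) (self_avoiding_paths n a b)"
proof -
  let ?S = "self_avoiding_paths n a b"
  have "AE \<omega> in M. p \<noteq> q \<longrightarrow> path_weight (\<lambda>e. X e \<omega>) p \<noteq> path_weight (\<lambda>e. X e \<omega>) q"
    if p: "p \<in> ?S" and q: "q \<in> ?S" for p q
  proof (cases "p = q")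
    case False
    have "set (path_edges p) \<noteq> set (path_edges q)"
      using path_determined_by_edges[of p q] self_avoiding_pathsD[OF p] self_avoiding_pathsD[OF q] False by auto
    then consider e where "e \<in> set (path_edges p)" "e \<notin> set (path_edges q)"
      | e where "e \<in> set (path_edges q)" "e \<notin> set (path_edges p)" by blast
    then show ?thesis
    proof cases
      case 1
      then show ?thesis using AE_path_weight_neq[OF p q] by auto
    next
      case 2
      then have "AE \<omega> in M. path_weight (\<lambda>e. X e \<omega>) q \<noteq> path_weight (\<lambda>e. X e \<omega>) p"
        using AE_path_weight_neq[OF q p] by auto
      then show ?thesis by (rule AE_mp) (auto intro!: AE_I2)
    qed
  qed simp
  then have "AE \<omega> in M. \<forall>p\<in>?S. \<forall>q\<in>?S. p \<noteq> q \<longrightarrow> path_weight (\<lambda>e. X e \<omega>) p \<noteq> path_weight (\<lambda>e. X e \<omega>) q"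
    by (intro AE_finite_allI) auto
  then show ?thesis by (rule AE_mp) (auto intro!: AE_I2 simp: inj_on_def)
qed

lemma min_path_weight_measurable:
  "(\<lambda>\<omega>. min_path_weight n (\<lambda>e. X e \<omega>)) \<in> borel_measurable M"
  unfolding min_path_weight_def
  by (rule borel_measurable_Min) (simp_all only: finite_self_avoiding_paths measurable_path_weight)

text \<open>Measurability has to hold everywhere, also where the minimum is not unique and
  \<open>THE\<close> is unspecified. So the hopcount is written as some function \<open>r\<close> of
  the set \<open>A\<close> of all minimisers, which takes finitely many values.\<close>

lemma hopcount_measurable:
  "(\<lambda>\<omega>. real (hopcount n (\<lambda>e. X e \<omega>))) \<in> borel_measurable M"
proof -
  let ?S = "self_avoiding_paths n 1 2"
  let ?W = "\<lambda>\<omega>. min_path_weight n (\<lambda>e. X e \<omega>)"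
  define A where "A \<omega> = {p \<in> ?S. path_weight (\<lambda>e. X e \<omega>) p = ?W \<omega>}" for \<omega>
  define r where "r B = real (length (path_edges (THE p. p \<in> B)))" for B :: "nat list set"
  have "A \<in> measurable M (count_space (Pow ?S))"
  proof (subst measurable_count_space_eq2)
    show "A \<in> space M \<rightarrow> Pow ?S \<and> (\<forall>B\<in>Pow ?S. A -` {B} \<inter> space M \<in> events)"
    proof (intro conjI ballI)
      fix B assume B: "B \<in> Pow ?S"
      have m: "{\<omega> \<in> space M. path_weight (\<lambda>e. X e \<omega>) p = ?W \<omega>} \<in> events" if "p \<in> ?S" for p
        by (rule borel_measurable_eq[OF measurable_path_weight[OF that] min_path_weight_measurable])
      have "A \<omega> = B \<longleftrightarrow> (\<forall>p\<in>?S. (path_weight (\<lambda>e. X e \<omega>) p = ?W \<omega>) = (p \<in> B))" for \<omega>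
        using B unfolding A_def by blast
      then have "A -` {B} \<inter> space M = {\<omega> \<in> space M. \<forall>p\<in>?S. (path_weight (\<lambda>e. X e \<omega>) p = ?W \<omega>) = (p \<in> B)}"
        by (simp add: vimage_def Int_def conj_commute)
      also have "\<dots> \<in> events"
      proof (rule sets.sets_Collect_finite_All)
        fix p assume p: "p \<in> ?S"
        show "{\<omega> \<in> space M. (path_weight (\<lambda>e. X e \<omega>) p = ?W \<omega>) = (p \<in> B)} \<in> events"
          using m[OF p] sets.sets_Collect_neg[OF m[OF p]] by (cases "p \<in> B") simp_all
      qed simp
      finally show "A -` {B} \<inter> space M \<in> events" .
    qed (auto simp: A_def)
  qed simp
  then have "r \<circ> A \<in> borel_measurable M"
    by (rule measurable_comp) simp
  also have "r \<circ> A = (\<lambda>\<omega>. real (hopcount n (\<lambda>e. X e \<omega>)))"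
    by (simp add: fun_eq_iff r_def A_def hopcount_def min_weight_path_def)
  finally show ?thesis .
qed

lemma hopcount_eq:
  assumes inj: "inj_on (path_weight (\<lambda>e. X e \<omega>)) (self_avoiding_paths n 1 2)" and n: "2 \<le> n"
  obtains p where "p \<in> self_avoiding_paths n 1 2"
    "path_weight (\<lambda>e. X e \<omega>) p = min_path_weight n (\<lambda>e. X e \<omega>)"
    "hopcount n (\<lambda>e. X e \<omega>) = length p - 1"
proof -
  let ?S = "self_avoiding_paths n 1 2"
  let ?w = "path_weight (\<lambda>e. X e \<omega>)"
  have "Min (?w ` ?S) \<in> ?w ` ?S"
    using self_avoiding_paths_nonempty[OF n] by (intro Min_in) auto
  then obtain p where p: "p \<in> ?S" "?w p = min_path_weight n (\<lambda>e. X e \<omega>)"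
    unfolding min_path_weight_def by auto
  have "min_weight_path n (\<lambda>e. X e \<omega>) = p"
    unfolding min_weight_path_def
    by (rule the_equality) (use p inj in \<open>auto simp: inj_on_def\<close>)
  then have "hopcount n (\<lambda>e. X e \<omega>) = length p - 1" by (simp add: hopcount_def)
  then show ?thesis using p that by blast
qed

end

section \<open>The upper bound on the minimal weight for fixed \<open>n\<close>\<close>

context iid_weights
begin

text \<open>A path is composed of \<open>k - 2\<close> steps at threshold \<open>\<theta>\<close>,
  one at \<open>\<Theta> i\<close> and a last edge at \<open>h i\<close>, with total at most
  \<open>k * \<theta>\<close>. If the minimum is larger, then expansion fails at some threshold or
  the last edge is missing for every \<open>i < I\<close>.\<close>

lemma prob_min_path_weight_gt_le:
  fixes \<theta> g :: real and \<Theta> h \<gamma> :: "nat \<Rightarrow> real"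
  assumes n: "2 \<le> n" and k: "2 \<le> k" and g: "1 \<le> g" "g ^ (k - 2) + 1 \<le> real a"
    and \<gamma>: "\<And>i. i < I \<Longrightarrow> 0 \<le> \<gamma> i" and h: "\<And>i. h (Suc i) \<le> h i"
    and \<Theta>h: "\<And>i. i < I \<Longrightarrow> \<Theta> i + h i = 2 * \<theta>" and U: "U = {1..n} - {2}"
  shows "prob {\<omega> \<in> space M. k * \<theta> < min_path_weight n (\<lambda>e. X e \<omega>)}
     \<le> prob {\<omega> \<in> space M. \<not> expanding U \<theta> a g \<omega>}
       + (\<Sum>i<I. prob {\<omega> \<in> space M. \<not> expanding U (\<Theta> i) a (\<gamma> i) \<omega>})
       + exp (- (\<Sum>i<I. \<gamma> i * g ^ (k - 2) * (F (h i) - F (h (Suc i)))))"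
    (is "prob ?A \<le> prob ?B + (\<Sum>i<I. prob (?B' i)) + exp ?s")
proof -
  let ?c = "\<lambda>i. real (k - 2) * \<theta> + \<Theta> i"
  let ?R = "\<lambda>\<omega>. reachable_within (\<lambda>e. X e \<omega>) U"
  let ?C = "{\<omega> \<in> space M. \<forall>i<I. \<gamma> i * g ^ (k - 2) \<le> card (?R \<omega> (?c i)) \<and> (\<forall>v\<in>?R \<omega> (?c i). h i < X {2, v} \<omega>)}"
  have U': "U \<subseteq> {1..n}" "finite U" "1 \<in> U" using U n by auto
  have B: "?B \<in> events" "\<And>i. ?B' i \<in> events"
    using expanding_sets[OF U'(1)] by (auto intro!: sets.sets_Collect_neg)
  have UB: "(\<Union>i\<in>{..<I}. ?B' i) \<in> events" using B by (intro sets.finite_UN) simp_all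
  have C: "?C \<in> events"
  proof -
    have XU: "X {i, j} \<in> borel_measurable M" if "i \<in> {1..n}" "j \<in> {1..n}" "i \<noteq> j" for i j
      using that by (intro rv) simp
    have R: "{\<omega> \<in> space M. ?R \<omega> c = S} \<in> events" for c S
      by (rule reachable_within_measurable[OF U'(2)]) (use XU U'(1) in blast)
    define P where "P i S \<omega> \<longleftrightarrow> \<gamma> i * g ^ (k - 2) \<le> card S \<and> (\<forall>v\<in>S. h i < X {2, v} \<omega>)" for i S \<omega>
    have PS: "{\<omega> \<in> space M. P i S \<omega>} \<in> events" if S: "S \<subseteq> U" for i S
    proof (cases "\<gamma> i * g ^ (k - 2) \<le> card S")
      case True
      have "{\<omega> \<in> space M. \<forall>v\<in>S. h i < X {2, v} \<omega>} \<in> events"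
      proof (rule sets.sets_Collect_finite_All)
        fix v assume "v \<in> S"
        then have v: "v \<in> {1..n}" "v \<noteq> 2" using S U by auto
        show "{\<omega> \<in> space M. h i < X {2, v} \<omega>} \<in> events"
          by (rule sets_edge_Collect) (use v n in simp_all)
      qed (use S U'(2) finite_subset in blast)
      then show ?thesis using True by (simp add: P_def)
    qed (simp add: P_def)
    have "{\<omega> \<in> space M. P i (?R \<omega> (?c i)) \<omega>}
        = (\<Union>S\<in>Pow U. {\<omega> \<in> space M. ?R \<omega> (?c i) = S} \<inter> {\<omega> \<in> space M. P i S \<omega>})" for i
      using reachable_within_subset by blast
    moreover have "(\<Union>S\<in>Pow U. {\<omega> \<in> space M. ?R \<omega> (?c i) = S} \<inter> {\<omega> \<in> space M. P i S \<omega>}) \<in> events" for i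
      by (rule sets.finite_UN) (simp add: U'(2), rule sets.Int[OF R PS], simp)
    ultimately have "{\<omega> \<in> space M. P i (?R \<omega> (?c i)) \<omega>} \<in> events" for i by (simp only:)
    then have "{\<omega> \<in> space M. \<forall>i\<in>{..<I}. P i (?R \<omega> (?c i)) \<omega>} \<in> events"
      by (intro sets.sets_Collect_finite_All) simp_all
    moreover have "?C = {\<omega> \<in> space M. \<forall>i\<in>{..<I}. P i (?R \<omega> (?c i)) \<omega>}" by (simp add: P_def Ball_def)
    ultimately show ?thesis by (simp only:)
  qed
  have "prob ?A \<le> prob (?B \<union> (\<Union>i\<in>{..<I}. ?B' i) \<union> ?C)"
  proof (rule finite_measure_mono_AE)
    show "?B \<union> (\<Union>i\<in>{..<I}. ?B' i) \<union> ?C \<in> events" by (intro sets.Un B UB C)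
    show "AE \<omega> in M. \<omega> \<in> ?A \<longrightarrow> \<omega> \<in> ?B \<union> (\<Union>i\<in>{..<I}. ?B' i) \<union> ?C"
      using AE_pos
    proof (rule AE_mp, intro AE_I2 impI)
      fix \<omega> assume \<omega>: "\<omega> \<in> space M" "\<forall>e\<in>complete_graph_edges n. 0 < X e \<omega>" "\<omega> \<in> ?A"
      show "\<omega> \<in> ?B \<union> (\<Union>i\<in>{..<I}. ?B' i) \<union> ?C"
      proof (rule ccontr)
        assume "\<omega> \<notin> ?B \<union> (\<Union>i\<in>{..<I}. ?B' i) \<union> ?C"
        then have ex: "expanding U \<theta> a g \<omega>" "\<And>i. i < I \<Longrightarrow> expanding U (\<Theta> i) a (\<gamma> i) \<omega>" and nC: "\<omega> \<notin> ?C"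
          using \<omega>(1) by blast+
        have nonneg: "0 \<le> X {i, j} \<omega>" if "i \<in> U" "j \<in> U" "i \<noteq> j" for i j
        proof -
          have "{i, j} \<in> complete_graph_edges n" using that U' by (simp add: subset_iff)
          then show ?thesis using \<omega>(2) by (meson less_imp_le)
        qed
        have it: "g ^ (k - 2) \<le> card (?R \<omega> (real (k - 2) * \<theta>))"
          by (rule card_reachable_within_iter[where x = "\<lambda>e. X e \<omega>" and a = a and m = "k - 2"])
            (use nonneg ex(1) g U' in \<open>auto simp: expanding_def\<close>)
        have st: "\<gamma> i * g ^ (k - 2) \<le> card (?R \<omega> (?c i))" if i: "i < I" for i
          by (rule card_reachable_within_step[where x = "\<lambda>e. X e \<omega>" and a = a])
            (use nonneg ex(2)[OF i] g U' it \<gamma>[OF i] in \<open>auto simp: expanding_def\<close>)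
        obtain i where i: "i < I" "\<not> (\<forall>v\<in>?R \<omega> (?c i). h i < X {2, v} \<omega>)"
          using nC st \<omega>(1) by blast
        then obtain v where v: "v \<in> ?R \<omega> (?c i)" "X {2, v} \<omega> \<le> h i" by force
        have "min_path_weight n (\<lambda>e. X e \<omega>) \<le> ?c i + h i"
          using v unfolding U by (rule min_path_weight_le_via[OF _ _ n])
        also have "\<dots> = k * \<theta>" using \<Theta>h[OF i(1)] k by (simp add: of_nat_diff algebra_simps)
        finally show False using \<omega>(3) by simp
      qed
    qed
  qed
  also have "\<dots> \<le> prob (?B \<union> (\<Union>i\<in>{..<I}. ?B' i)) + prob ?C"
    by (rule measure_Un_le[OF sets.Un[OF B(1) UB] C])
  also have "prob (?B \<union> (\<Union>i\<in>{..<I}. ?B' i)) \<le> prob ?B + prob (\<Union>i\<in>{..<I}. ?B' i)"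
    by (rule measure_Un_le[OF B(1) UB])
  also have "prob (\<Union>i\<in>{..<I}. ?B' i) \<le> (\<Sum>i<I. prob (?B' i))"
    by (rule finite_measure_subadditive_finite) (use B in blast)+
  also have "prob ?C \<le> exp ?s" by (rule prob_no_connection_le[where h = h]) (use h n U in simp_all)
  finally show ?thesis by simp
qed

end

text \<open>The number \<open>w i\<close> is the factor gained in edge probability by raising the
  threshold from \<open>\<theta>\<close> to \<open>\<Theta> i\<close>. Up to constants,
  \<open>w i * n / d\<close> vertices are then reached, so \<open>gap\<close> says that each
  \<open>i\<close> contributes at least a constant to the expected number of last edges.\<close>

lemma (in iid_weights) prob_min_path_weight_gt_explicit:
  fixes k I :: nat and d \<theta> :: real and w \<Theta> h :: "nat \<Rightarrow> real"
  assumes n: "2 \<le> n" and k: "2 \<le> k" and d: "0 < d" "d ^ k = n"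
    and p0: "d * (1 - 1 / k) \<le> n * F \<theta>" "n * F \<theta> \<le> 2 * d"
    and big: "12 * real k \<le> d" "48 * (real k)\<^sup>2 * ln n \<le> d"
    and w: "\<And>i. i < I \<Longrightarrow> 1 \<le> w i" "\<And>i. i < I \<Longrightarrow> 24 * w i \<le> d"
    and pi: "\<And>i. i < I \<Longrightarrow> d * w i / 2 \<le> n * F (\<Theta> i)" "\<And>i. i < I \<Longrightarrow> n * F (\<Theta> i) \<le> 2 * (d * w i)"
    and h: "\<And>i. h (Suc i) \<le> h i" and \<Theta>h: "\<And>i. i < I \<Longrightarrow> \<Theta> i + h i = 2 * \<theta>"
    and gap: "\<And>i. i < I \<Longrightarrow> 1 / 2 \<le> w i * (n / d) * (F (h i) - F (h (Suc i)))"
  shows "prob {\<omega> \<in> space M. k * \<theta> < min_path_weight n (\<lambda>e. X e \<omega>)}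
           \<le> 2 * (real I + 1) / n + exp (- (real I * exp (- 6) / 16))"
proof -
  define U where "U = {1..n} - {2 :: nat}"
  have U: "U \<subseteq> {1..n}" "card U = n - 1" using n by (auto simp: U_def)
  have n0: "0 < real n" "1 \<le> n" using n by auto
  have k2: "2 \<le> real k" using k by simp
  have d24: "24 \<le> d" using big(1) k2 by linarith
  have F01: "0 \<le> F x" "F x \<le> 1" for x
  proof -
    have e: "{1, 2} \<in> complete_graph_edges n" using n by simp
    show "0 \<le> F x" "F x \<le> 1" using prob_le[OF e, of x] by (metis measure_nonneg, metis prob_le_1)
  qed
  \<comment> \<open>The factors \<open>1 - 1 / k\<close> pay for three losses per generation: the
    error in \<open>n * F \<theta>\<close>, overlapping neighbourhoods (both in
    \<open>\<mu>\<close>), and the Chernoff deviation (in \<open>g\<close>).\<close>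
  define \<mu> where "\<mu> = d * (1 - 1 / k)\<^sup>2"
  define g where "g = (1 - 1 / k) * \<mu>"
  \<comment> \<open>This step occurs once, so each of the same three losses may cost a factor
    2.\<close>
  define \<gamma> where "\<gamma> i = (1 - 1 / 2) * (d * w i / 4)" for i
  have \<gamma>0: "0 \<le> \<gamma> i" if "i < I" for i
  proof -
    have "0 \<le> w i" using w(1)[OF that] by linarith
    then show ?thesis using d by (simp add: \<gamma>_def)
  qed
  have half: "1 / 2 \<le> 1 - 1 / real k" using k2 by (simp add: field_simps)
  have g_eq: "g = d * (1 - 1 / k) ^ 3" by (simp add: g_def \<mu>_def power2_eq_square power3_eq_cube)
  have \<mu>4: "d / 4 \<le> \<mu>"
  proof -
    have "(1 / 2)\<^sup>2 \<le> (1 - 1 / real k)\<^sup>2" using half by (intro power_mono) auto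
    then have "d * (1 / 2)\<^sup>2 \<le> \<mu>" unfolding \<mu>_def using d by (intro mult_left_mono) auto
    then show ?thesis by (simp add: power2_eq_square)
  qed
  have g1: "1 \<le> g"
  proof -
    have "(1 / 2) * (d / 4) \<le> g" unfolding g_def using half \<mu>4 d by (intro mult_mono) auto
    then show ?thesis using d24 by simp
  qed
  have gd: "g \<le> d"
  proof -
    have "(1 - 1 / real k) ^ 3 \<le> 1" using half k2 by (intro power_le_one) auto
    then show ?thesis unfolding g_eq using d mult_left_mono[of _ 1 d] by simp
  qed
  have dk2: "d ^ (k - 2) = n / d\<^sup>2"
  proof -
    have "d ^ (k - 2) * d\<^sup>2 = d ^ (k - 2 + 2)" by (simp only: power_add)
    also have "k - 2 + 2 = k" using k by simp
    finally have "d ^ (k - 2) * d\<^sup>2 = d ^ k" .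
    then show ?thesis using d by (simp add: field_simps)
  qed
  \<comment> \<open>The largest size of a set that has to be expanded. It is of order
    \<open>n / d\<^sup>2\<close>, which makes the overlap term \<open>p * a\<close> of order
    \<open>1 / d\<close>.\<close>
  define a where "a = nat \<lceil>g ^ (k - 2) + 1\<rceil>"
  have a1: "g ^ (k - 2) + 1 \<le> real a" unfolding a_def by linarith
  have a3: "real a \<le> 3 * (n / d\<^sup>2)"
  proof -
    have "g ^ (k - 2) \<le> d ^ (k - 2)" using gd g1 by (intro power_mono) auto
    moreover have "1 \<le> d ^ (k - 2)" using d24 by (intro one_le_power) auto
    moreover have "0 \<le> g ^ (k - 2)" using g1 by simp
    ultimately show ?thesis unfolding a_def dk2[symmetric] by linarith
  qed
  have pa: "p * a + 2 * a / n \<le> 6 * y / d + 6 / d\<^sup>2" if "n * p \<le> 2 * (d * y)" "0 \<le> p" "0 \<le> y" for p y :: real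
  proof -
    have "p \<le> 2 * (d * y) / n" using that n0 by (simp add: field_simps)
    then have "p * a \<le> (2 * (d * y) / n) * (3 * (n / d\<^sup>2))"
      using a3 that d by (intro mult_mono) auto
    also have "\<dots> = 6 * y / d" using n0 d by (simp add: power2_eq_square field_simps)
    finally have 1: "p * a \<le> 6 * y / d" .
    have "2 * a / n \<le> 2 * (3 * (n / d\<^sup>2)) / n" using a3 n0 by (intro divide_right_mono) auto
    also have "\<dots> = 6 / d\<^sup>2" using n0 by simp
    finally show ?thesis using 1 by simp
  qed
  have d2: "6 / d\<^sup>2 \<le> 1 / d" using d24 by (simp add: power2_eq_square field_simps)
  have E0: "prob {\<omega> \<in> space M. \<not> expanding U \<theta> a g \<omega>} \<le> 2 / n"
    unfolding g_def
  proof (rule prob_not_expanding_le[OF U(1)])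
    have "F \<theta> * a + 2 * a / n \<le> 6 * 1 / d + 6 / d\<^sup>2" using p0 F01 by (intro pa) auto
    also have "\<dots> \<le> 12 / d" using d2 d by (simp add: field_simps)
    also have "\<dots> \<le> 1 / k" using big(1) d k2 by (simp add: field_simps)
    finally have small: "F \<theta> * a + 2 * a / n \<le> 1 / k" .
    fix j assume j: "1 \<le> j" "j \<le> a"
    have "\<mu> * j = d * (1 - 1 / k) * (1 - 1 / k) * j" by (simp add: \<mu>_def power2_eq_square)
    also have "\<dots> \<le> n * F \<theta> * (1 - 1 / k) * j"
      using p0 half by (intro mult_right_mono) auto
    also have "\<dots> \<le> (real (n - 1) - j) * (1 - (1 - F \<theta>) ^ j)"
      using F01 n0 j small k2 by (intro expansion_rate_le[where a = a]) auto
    finally show "\<mu> * j \<le> (real (card U) - j) * (1 - (1 - F \<theta>) ^ j)" by (simp add: U)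
  next
    show "12 * ln n \<le> (1 / real k)\<^sup>2 * \<mu>"
    proof -
      have "12 * ln n \<le> (1 / real k)\<^sup>2 * (d / 4)"
        using big(2) k2 by (simp add: power2_eq_square field_simps)
      also have "\<dots> \<le> (1 / real k)\<^sup>2 * \<mu>" using \<mu>4 by (intro mult_left_mono) auto
      finally show ?thesis .
    qed
  qed (use n0 k2 d \<mu>4 in \<open>auto simp: field_simps\<close>)
  have Ei: "prob {\<omega> \<in> space M. \<not> expanding U (\<Theta> i) a (\<gamma> i) \<omega>} \<le> 2 / n" if i: "i < I" for i
    unfolding \<gamma>_def
  proof (rule prob_not_expanding_le[OF U(1)])
    have "F (\<Theta> i) * a + 2 * a / n \<le> 6 * w i / d + 6 / d\<^sup>2" using pi(2)[OF i] w(1)[OF i] F01 by (intro pa) auto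
    also have "\<dots> \<le> 12 * w i / d" proof -
      have "1 / d \<le> w i / d" using w(1)[OF i] d by (intro divide_right_mono) auto
      moreover have "0 < 1 / d" using d by simp
      ultimately have "6 * (w i / d) + 6 / d\<^sup>2 \<le> 12 * (w i / d)" using d2 by linarith
      then show ?thesis by simp
    qed
    also have "\<dots> \<le> 1 / 2" using w(2)[OF i] d by (simp add: field_simps)
    finally have small: "F (\<Theta> i) * a + 2 * a / n \<le> 1 / 2" .
    fix j assume j: "1 \<le> j" "j \<le> a"
    have "d * w i / 4 * j = d * w i / 2 * (1 - 1 / 2) * j" by simp
    also have "\<dots> \<le> n * F (\<Theta> i) * (1 - 1 / 2) * j"
      using pi(1)[OF i] by (intro mult_right_mono) auto
    also have "\<dots> \<le> (real (n - 1) - j) * (1 - (1 - F (\<Theta> i)) ^ j)"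
      using F01 n0 j small by (intro expansion_rate_le[where a = a]) auto
    finally show "d * w i / 4 * j \<le> (real (card U) - j) * (1 - (1 - F (\<Theta> i)) ^ j)" by (simp add: U)
  next
    have "12 * ln n \<le> d / 16"
    proof -
      have "2\<^sup>2 \<le> (real k)\<^sup>2" using k2 by (intro power_mono) auto
      then have "48 * 4 * ln n \<le> 48 * (real k)\<^sup>2 * ln n" using n0 by (intro mult_right_mono) auto
      then show ?thesis using big(2) by linarith
    qed
    also have "\<dots> \<le> (1 / 2)\<^sup>2 * (d * w i / 4)" using w(1)[OF i] d by (simp add: power2_eq_square)
    finally show "12 * ln n \<le> (1 / 2)\<^sup>2 * (d * w i / 4)" .
  qed (use n0 d w(1)[OF i] in auto)
  \<comment> \<open>The constant collects \<open>1 / 8\<close> from \<open>\<gamma>\<close>,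
    \<open>1 / 2\<close> from \<open>gap\<close>, and \<open>exp (- 6)\<close> from the losses in
    \<open>g ^ (k - 2)\<close>.\<close>
  have gain: "exp (- 6) / 16 \<le> \<gamma> i * g ^ (k - 2) * (F (h i) - F (h (Suc i)))" if i: "i < I" for i
  proof -
    have \<Delta>: "0 \<le> F (h i) - F (h (Suc i))"
    proof (rule ccontr)
      assume "\<not> 0 \<le> F (h i) - F (h (Suc i))"
      then have "w i * (n / d) * (F (h i) - F (h (Suc i))) \<le> 0"
        using w(1)[OF i] d n0 by (intro mult_nonneg_nonpos) auto
      then show False using gap[OF i] by linarith
    qed
    have "exp (- 6) \<le> (1 - 1 / real k) ^ (3 * (k - 2))"
    proof -
      have "exp (- 6) = exp (- 2 :: real) ^ 3" by (simp add: exp_of_nat_mult[symmetric])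
      also have "\<dots> \<le> ((1 - 1 / real k) ^ k) ^ 3" using one_minus_inverse_power_ge[OF k] by (intro power_mono) auto
      also have "\<dots> = (1 - 1 / real k) ^ (3 * k)" by (simp add: power_mult[symmetric] mult.commute)
      also have "\<dots> \<le> (1 - 1 / real k) ^ (3 * (k - 2))" using half k2 by (intro power_decreasing) auto
      finally show ?thesis .
    qed
    then have "n / d\<^sup>2 * exp (- 6) \<le> n / d\<^sup>2 * (1 - 1 / real k) ^ (3 * (k - 2))" by (intro mult_left_mono) auto
    also have "\<dots> = g ^ (k - 2)" by (simp add: g_eq power_mult_distrib dk2 power_mult)
    finally have g2: "n / d\<^sup>2 * exp (- 6) \<le> g ^ (k - 2)" .
    have "exp (- 6) / 16 \<le> exp (- 6) / 8 * (w i * (n / d) * (F (h i) - F (h (Suc i))))"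
      using mult_left_mono[OF gap[OF i], of "exp (- 6) / 8"] by simp
    also have "\<dots> = \<gamma> i * (n / d\<^sup>2 * exp (- 6)) * (F (h i) - F (h (Suc i)))"
      using d by (simp add: \<gamma>_def power2_eq_square field_simps)
    also have "\<dots> \<le> \<gamma> i * g ^ (k - 2) * (F (h i) - F (h (Suc i)))"
      using g2 \<Delta> w(1)[OF i] d by (intro mult_right_mono mult_left_mono) (auto simp: \<gamma>_def)
    finally show ?thesis .
  qed
  have "prob {\<omega> \<in> space M. k * \<theta> < min_path_weight n (\<lambda>e. X e \<omega>)}
     \<le> prob {\<omega> \<in> space M. \<not> expanding U \<theta> a g \<omega>}
       + (\<Sum>i<I. prob {\<omega> \<in> space M. \<not> expanding U (\<Theta> i) a (\<gamma> i) \<omega>})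
       + exp (- (\<Sum>i<I. \<gamma> i * g ^ (k - 2) * (F (h i) - F (h (Suc i)))))"
    by (rule prob_min_path_weight_gt_le) (use n k g1 a1 \<gamma>0 h \<Theta>h in \<open>auto simp: U_def\<close>)
  also have "(\<Sum>i<I. prob {\<omega> \<in> space M. \<not> expanding U (\<Theta> i) a (\<gamma> i) \<omega>}) \<le> (\<Sum>i<I. 2 / n)"
    using Ei by (intro sum_mono) auto
  also have "exp (- (\<Sum>i<I. \<gamma> i * g ^ (k - 2) * (F (h i) - F (h (Suc i))))) \<le> exp (- (\<Sum>i<I. exp (- 6) / 16))"
    using gain by (simp only: exp_le_cancel_iff neg_le_iff_le) (intro sum_mono, simp)
  finally show ?thesis using E0 n0 by (simp add: field_simps)
qed

section \<open>Asymptotics of the upper bound\<close>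

text \<open>Here \<open>z n\<close> is the \<open>1 / n\<close> quantile of \<open>G\<close>, so the
  weight scale is \<open>z n powr s n\<close>. The equation for \<open>F n\<close> starts at
  \<open>n = 2\<close> because smaller complete graphs have no edge and say nothing about
  \<open>F n\<close>.\<close>

locale fpp_power_weights =
  fixes M :: "nat \<Rightarrow> 'a measure" and X :: "nat \<Rightarrow> nat set \<Rightarrow> 'a \<Rightarrow> real"
    and F :: "nat \<Rightarrow> real \<Rightarrow> real" and G :: "real \<Rightarrow> real" and lam C x1 B :: real and s z :: "nat \<Rightarrow> real"
  assumes iid_weights: "\<And>n. iid_edge_weights (M n) n (X n) (F n)"
    and F_eq: "\<And>n y. 2 \<le> n \<Longrightarrow> 0 < y \<Longrightarrow> F n y = G (y powr (1 / s n))"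
    and s_pos: "\<And>n. 0 < s n" and s_0: "s \<longlonglongrightarrow> 0"
    and s_ln: "filterlim (\<lambda>n. s n * ln n) at_top sequentially"
    and s2_ln: "(\<lambda>n. (s n)\<^sup>2 * ln n) \<longlonglongrightarrow> 0"
    and lam: "0 < lam" and x1: "0 < x1" and C: "0 \<le> C"
    and quad: "\<And>x. 0 \<le> x \<Longrightarrow> x \<le> x1 \<Longrightarrow> \<bar>G x - lam * x\<bar> \<le> C * x\<^sup>2"
    and B: "0 \<le> B" "\<And>x. 0 < x \<Longrightarrow> G x \<le> B * x"
    and z: "eventually (\<lambda>n. 0 < z n \<and> z n \<le> x1 \<and> G (z n) = 1 / n \<and> z n \<le> 2 / (lam * n)) sequentially"
begin

lemma weights: "iid_weights (M n) n (X n) (F n)"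
  using iid_weights[of n]
  by (intro iid_weights.intro iid_weights_axioms.intro) (auto simp: iid_edge_weights_def)

text \<open>\<open>d n ^ k n = n\<close>, so that \<open>k n\<close> generations of growth by the factor \<open>d n\<close> just exhaust the
  graph; an edge is below the threshold \<open>\<theta> n\<close> with probability about \<open>d n / n\<close>.\<close>

definition k :: "nat \<Rightarrow> nat" where "k n = nat \<lceil>s n * ln (real n)\<rceil>"
definition \<beta> :: "nat \<Rightarrow> real" where "\<beta> n = ln (real n) / k n"
definition d :: "nat \<Rightarrow> real" where "d n = exp (\<beta> n)"
definition u :: "nat \<Rightarrow> real" where "u n = z n powr s n"
definition \<theta> :: "nat \<Rightarrow> real" where "\<theta> n = u n * exp (\<beta> n * s n)"

lemma ln_top: "filterlim (\<lambda>n. ln (real n)) at_top sequentially"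
  by (rule filterlim_compose[OF ln_at_top filterlim_real_sequentially])

lemma k_ge: "s n * ln (real n) \<le> k n"
  unfolding k_def by linarith

lemma k_le: "1 \<le> n \<Longrightarrow> k n \<le> s n * ln (real n) + 1"
  using s_pos[of n] unfolding k_def by (simp add: mult_nonneg_nonneg)

lemma k_top: "filterlim (\<lambda>n. real (k n)) at_top sequentially"
  by (rule filterlim_at_top_mono[OF s_ln]) (simp add: k_ge)

lemma k_ge_ev: "eventually (\<lambda>n. K \<le> real (k n)) sequentially"
  using k_top by (simp add: filterlim_at_top)

lemma ln_ge_ev: "eventually (\<lambda>n. K \<le> ln (real n)) sequentially"
  using ln_top by (simp add: filterlim_at_top)

text \<open>Here \<open>s\<^sup>2 * ln n\<close> tending to 0 enters. It yields
  \<open>k \<le> \<beta>\<close>, so \<open>d = exp \<beta>\<close> dominates every fixed power of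
  \<open>k\<close> and of \<open>ln n = k * \<beta>\<close>.\<close>

lemma k_squared_le: "eventually (\<lambda>n. (real (k n))\<^sup>2 \<le> ln n) sequentially"
proof -
  have "(\<lambda>n. (s n)\<^sup>2 * ln n + 2 * s n + 1 / ln n) \<longlonglongrightarrow> 0 + 2 * 0 + 0"
    by (intro tendsto_add tendsto_mult tendsto_const s2_ln s_0 real_tendsto_divide_at_top[OF tendsto_const ln_top])
  then have "eventually (\<lambda>n. (s n)\<^sup>2 * ln n + 2 * s n + 1 / ln n < 1) sequentially"
    by (rule order_tendstoD) simp
  then show ?thesis
    using ln_ge_ev[of 1] eventually_ge_at_top[of 1]
  proof eventually_elim
    case (elim n)
    have "(real (k n))\<^sup>2 \<le> (s n * ln n + 1)\<^sup>2" using k_le[OF elim(3)] by (intro power_mono) auto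
    also have "\<dots> = ((s n)\<^sup>2 * ln n + 2 * s n + 1 / ln n) * ln n"
      using elim(2) by (simp add: power2_eq_square field_simps)
    also have "\<dots> \<le> 1 * ln n" using elim by (intro mult_right_mono) auto
    finally show ?case by simp
  qed
qed

lemma k_le_\<beta>: "eventually (\<lambda>n. real (k n) \<le> \<beta> n) sequentially"
  using k_squared_le k_ge_ev[of 1]
proof eventually_elim
  case (elim n)
  then show ?case by (simp add: \<beta>_def power2_eq_square field_simps)
qed

lemma \<beta>_top: "filterlim \<beta> at_top sequentially"
  by (rule filterlim_at_top_mono[OF k_top k_le_\<beta>])

text \<open>The fourth power is what expansion requires:
  \<open>k\<^sup>2 * ln n = k ^ 3 * \<beta> \<le> \<beta> ^ 4\<close>.\<close>

lemma poly_\<beta>_le_d: "eventually (\<lambda>n. c * \<beta> n ^ 4 \<le> d n) sequentially"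
proof -
  have "((\<lambda>x. x ^ 4 / exp x) \<longlongrightarrow> (0 :: real)) at_top" by (rule tendsto_power_div_exp_0)
  then have "((\<lambda>x. c * (x ^ 4 / exp x)) \<longlongrightarrow> c * 0) at_top" by (intro tendsto_mult tendsto_const)
  then have "eventually (\<lambda>x. c * (x ^ 4 / exp x) < 1) at_top" by (rule order_tendstoD) simp
  then have "eventually (\<lambda>n. c * (\<beta> n ^ 4 / exp (\<beta> n)) < 1) sequentially"
    using \<beta>_top by (rule eventually_compose_filterlim)
  then show ?thesis by (rule eventually_mono) (simp add: d_def field_simps)
qed

lemma d_ge_ev: "eventually (\<lambda>n. K \<le> d n) sequentially"
proof -
  have "eventually (\<lambda>n. K \<le> \<beta> n) sequentially" using \<beta>_top by (simp add: filterlim_at_top)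
  then show ?thesis
    by (rule eventually_mono) (use exp_ge_add_one_self in \<open>smt (verit) d_def\<close>)
qed

lemma k_mult_le_d:
  fixes c :: real
  assumes c: "0 \<le> c"
  shows "eventually (\<lambda>n. c * k n \<le> d n) sequentially"
  using poly_\<beta>_le_d[of c] k_le_\<beta> k_ge_ev[of 1]
proof eventually_elim
  case (elim n)
  have "\<beta> n ^ 1 \<le> \<beta> n ^ 4" using elim by (intro power_increasing) auto
  then have "c * k n \<le> c * \<beta> n ^ 4" using elim c by (intro mult_left_mono) auto
  then show ?case using elim by simp
qed

lemma d_power_k: "1 \<le> n \<Longrightarrow> 1 \<le> k n \<Longrightarrow> d n ^ k n = n"
  by (simp add: d_def \<beta>_def exp_of_nat_mult[symmetric])

lemma d_squared_le: "1 \<le> n \<Longrightarrow> 2 \<le> k n \<Longrightarrow> (d n)\<^sup>2 \<le> n"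
proof -
  assume n: "1 \<le> n" and k: "2 \<le> k n"
  have "0 \<le> \<beta> n" using n by (simp add: \<beta>_def)
  then have "(d n)\<^sup>2 \<le> d n ^ k n" using k by (intro power_increasing) (auto simp: d_def)
  then show ?thesis using d_power_k[of n] n k by simp
qed

text \<open>The effect of the ceiling in \<open>k\<close>, and the source of the constant in the
  upper bound: it gives \<open>\<theta> n \<le> exp 1 * u n\<close>.\<close>

lemma \<beta>_s_le_1: "1 \<le> k n \<Longrightarrow> \<beta> n * s n \<le> 1"
  using k_ge[of n] by (simp add: \<beta>_def field_simps)

text \<open>Near 0 the function \<open>G\<close> is linear up to a quadratic error, and arguments of
  order \<open>d / n\<close> make the relative error of order \<open>d / n \<le> 1 / d\<close>. This
  is below \<open>1 / k\<close>, the precision that \<open>k\<close> generations can afford.\<close>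

lemma scaled_cdf_error:
  assumes Y: "0 < Y"
  shows "eventually (\<lambda>n. \<forall>y. 0 < y \<and> y \<le> Y \<longrightarrow> \<bar>n * G (z n * (d n * y)) - d n * y\<bar> \<le> d n * y / k n) sequentially"
proof -
  \<comment> \<open>The constant arises from \<open>C * (z n)\<^sup>2\<close> and
    \<open>z n \<le> 2 / (lam * n)\<close>.\<close>
  define K0 where "K0 = 4 * C / lam\<^sup>2"
  have K0: "0 \<le> K0" using C by (simp add: K0_def)
  have K0Y: "0 \<le> K0 * (Y + 1)" using K0 Y by simp
  show ?thesis
    using z eventually_ge_at_top[of 1] k_ge_ev[of 2] d_ge_ev[of "max 1 (2 * Y / (lam * x1))"] k_mult_le_d[OF K0Y]
  proof eventually_elim
    case (elim n)
    have n: "0 < real n" and d: "0 < d n" "1 \<le> d n" "2 * Y / (lam * x1) \<le> d n" and k: "2 \<le> k n" "0 < real (k n)"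
      using elim by auto
    have zn: "0 < z n" "z n \<le> x1" "G (z n) = 1 / n" "z n \<le> 2 / (lam * n)" using elim by auto
    have d2: "(d n)\<^sup>2 \<le> n" using d_squared_le[of n] k elim by simp
    then have dn: "d n / n \<le> 1 / d n" using n d by (simp add: power2_eq_square field_simps)
    show ?case
    proof (intro allI impI)
      fix y assume y: "0 < y \<and> y \<le> Y"
      define t where "t = d n * y"
      have t: "0 < t" "t \<le> d n * Y" using y d by (auto simp: t_def)
      have zt: "z n * t \<le> x1"
      proof -
        have "z n * t \<le> (2 / (lam * n)) * (d n * Y)" using zn t lam n by (intro mult_mono) auto
        also have "\<dots> = 2 * Y / lam * (d n / n)" by simp
        also have "\<dots> \<le> 2 * Y / lam * (1 / d n)" using dn Y lam by (intro mult_left_mono) auto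
        also have "\<dots> \<le> x1" using d lam x1 by (simp add: field_simps)
        finally show ?thesis .
      qed
      have q1: "\<bar>G (z n * t) - lam * (z n * t)\<bar> \<le> C * (z n * t)\<^sup>2" using zn t zt by (intro quad) auto
      have q2: "\<bar>1 / n - lam * z n\<bar> \<le> C * (z n)\<^sup>2" using quad[of "z n"] zn by simp
      \<comment> \<open>Subtracting \<open>t\<close> times the expansion at \<open>z n\<close>,
        where \<open>G\<close> is exactly \<open>1 / n\<close>, eliminates \<open>lam\<close> from
        the main term.\<close>
      have "n * G (z n * t) - t = n * ((G (z n * t) - lam * (z n * t)) - t * (1 / n - lam * z n))"
        using n by (simp add: algebra_simps)
      also have "\<bar>\<dots>\<bar> \<le> n * (C * (z n * t)\<^sup>2 + t * (C * (z n)\<^sup>2))"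
      proof -
        have "\<bar>t * (1 / n - lam * z n)\<bar> \<le> t * (C * (z n)\<^sup>2)" using q2 t by (simp add: abs_mult)
        then have "\<bar>(G (z n * t) - lam * (z n * t)) - t * (1 / n - lam * z n)\<bar> \<le> C * (z n * t)\<^sup>2 + t * (C * (z n)\<^sup>2)"
          using q1 by linarith
        then show ?thesis using n by (simp add: abs_mult mult_left_mono)
      qed
      also have "\<dots> = n * C * t * (t + 1) * (z n)\<^sup>2" by (simp add: power2_eq_square algebra_simps)
      also have "\<dots> \<le> n * C * t * (t + 1) * (2 / (lam * n))\<^sup>2"
        using zn t C n by (intro mult_left_mono power_mono) auto
      also have "\<dots> = t * (K0 * ((t + 1) / n))" using n lam by (simp add: K0_def power2_eq_square field_simps)
      also have "\<dots> \<le> t * (1 / k n)"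
      proof -
        have "t + 1 \<le> d n * (Y + 1)" using t d by (simp add: algebra_simps)
        then have "(t + 1) / n \<le> (d n * (Y + 1)) / n" using n by (intro divide_right_mono) auto
        also have "\<dots> = (Y + 1) * (d n / n)" by simp
        also have "\<dots> \<le> (Y + 1) * (1 / d n)" using dn Y by (intro mult_left_mono) auto
        finally have "K0 * ((t + 1) / n) \<le> K0 * ((Y + 1) * (1 / d n))" using K0 by (rule mult_left_mono)
        also have "\<dots> \<le> 1 / k n" using elim(5) d k by (simp add: field_simps)
        finally show ?thesis using t by (intro mult_left_mono) auto
      qed
      finally show "\<bar>n * G (z n * (d n * y)) - d n * y\<bar> \<le> d n * y / k n" by (simp add: t_def)
    qed
  qed
qed

lemma F_\<theta>:
  assumes n: "2 \<le> n" and z: "0 < z n" and c: "0 < c"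
  shows "F n (\<theta> n * c) = G (z n * (d n * c powr (1 / s n)))"
proof -
  have s: "0 < s n" by (rule s_pos)
  have "(\<theta> n * c) powr (1 / s n) = z n * (d n * c powr (1 / s n))"
    using z c s by (simp add: \<theta>_def u_def powr_mult powr_powr powr_def[of "exp _"] d_def)
  moreover have "0 < \<theta> n * c" using z c by (simp add: \<theta>_def u_def)
  ultimately show ?thesis using F_eq[OF n] by simp
qed

text \<open>A relative change \<open>x * s n\<close> of a threshold multiplies the edge probability
  by about \<open>exp x\<close>. This is why thresholds are perturbed on the scale
  \<open>s n\<close>.\<close>

lemma powr_s_limit:
  "(\<lambda>n. (1 + x * s n) powr (1 / s n)) \<longlonglongrightarrow> exp x"
proof -
  have "filterlim s (at_right 0) sequentially"
    by (rule tendsto_imp_filterlim_at_right[OF s_0]) (simp add: s_pos)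
  then show ?thesis by (rule filterlim_compose[OF tendsto_exp_limit_at_right])
qed

lemma F_scaled_error:
  assumes Y: "0 < Y"
  shows "eventually (\<lambda>n. \<forall>c>0. c powr (1 / s n) \<le> Y \<longrightarrow>
    \<bar>n * F n (\<theta> n * c) - d n * c powr (1 / s n)\<bar> \<le> d n * c powr (1 / s n) / k n) sequentially"
  using scaled_cdf_error[OF Y] eventually_ge_at_top[of 2] z
proof eventually_elim
  case (elim n)
  show ?case
  proof (intro allI impI)
    fix c :: real assume c: "0 < c" "c powr (1 / s n) \<le> Y"
    have "F n (\<theta> n * c) = G (z n * (d n * c powr (1 / s n)))" using elim c by (intro F_\<theta>) auto
    moreover have "0 < c powr (1 / s n)" using c by simp
    ultimately show "\<bar>n * F n (\<theta> n * c) - d n * c powr (1 / s n)\<bar> \<le> d n * c powr (1 / s n) / k n"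
      using elim(1) c(2) by simp
  qed
qed

text \<open>The factor \<open>w n i\<close> gained by raising the last but one threshold cancels the factor \<open>v n i\<close>
  lost by lowering the last one, hence each of the \<open>I\<close> ways to split \<open>2 * \<theta>\<close> contributes a constant.\<close>

lemma prob_gt_k_\<theta>_le:
  "eventually (\<lambda>n. measure (M n) {\<omega> \<in> space (M n). k n * \<theta> n < min_path_weight n (\<lambda>e. X n e \<omega>)}
     \<le> 2 * (real I + 1) / n + exp (- (real I * exp (- 6) / 16))) sequentially"
proof -
  define w where "w n i = (1 + real i * s n) powr (1 / s n)" for n and i :: nat
  define v where "v n i = (1 - real i * s n) powr (1 / s n)" for n and i :: nat
  \<comment> \<open>Exceeds all limits of \<open>w n i\<close> with \<open>i < I\<close>, and is at
    least 1, so the error bound also covers the unperturbed threshold and the factors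
    \<open>v n i \<le> 1\<close>.\<close>
  define Y where "Y = exp (real I) + 1"
  have Y: "0 < Y" "1 \<le> Y" by (auto simp: Y_def add_pos_pos)
  have w_lim: "(\<lambda>n. w n i) \<longlonglongrightarrow> exp i" for i unfolding w_def by (rule powr_s_limit)
  have v_lim: "(\<lambda>n. v n i) \<longlonglongrightarrow> exp (- real i)" for i
    using powr_s_limit[of "- real i"] by (simp add: v_def)
  have k_lim: "(\<lambda>n. 1 / real (k n)) \<longlonglongrightarrow> 0"
    by (rule real_tendsto_divide_at_top[OF tendsto_const k_top])
  have w_le: "eventually (\<lambda>n. \<forall>i\<in>{..<I}. w n i \<le> Y) sequentially"
  proof (rule eventually_ball_finite)
    show "\<forall>i\<in>{..<I}. eventually (\<lambda>n. w n i \<le> Y) sequentially"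
    proof
      fix i assume "i \<in> {..<I}"
      then have "exp (real i) \<le> exp (real I)" by simp
      also have "\<dots> < Y" by (simp add: Y_def)
      finally have "eventually (\<lambda>n. w n i < Y) sequentially" by (rule order_tendstoD(2)[OF w_lim])
      then show "eventually (\<lambda>n. w n i \<le> Y) sequentially" by (rule eventually_mono) simp
    qed
  qed simp
  have gap: "eventually (\<lambda>n. \<forall>i\<in>{..<I}. 1 / 2 < w n i * (v n i - v n (Suc i) - (v n i + v n (Suc i)) * (1 / k n))) sequentially"
  proof (rule eventually_ball_finite)
    show "\<forall>i\<in>{..<I}. eventually (\<lambda>n. 1 / 2 < w n i * (v n i - v n (Suc i) - (v n i + v n (Suc i)) * (1 / k n))) sequentially"
    proof
      fix i assume "i \<in> {..<I}"
      \<comment> \<open>The limits of \<open>w n i\<close> and \<open>v n i\<close> are inverse to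
        each other, so the limit of the product does not depend on \<open>i\<close>.\<close>
      have "(\<lambda>n. w n i * (v n i - v n (Suc i) - (v n i + v n (Suc i)) * (1 / k n)))
          \<longlonglongrightarrow> exp i * (exp (- real i) - exp (- real (Suc i)) - (exp (- real i) + exp (- real (Suc i))) * 0)"
        by (intro tendsto_intros w_lim v_lim k_lim)
      also have "exp (real i) * (exp (- real i) - exp (- real (Suc i)) - (exp (- real i) + exp (- real (Suc i))) * 0) = 1 - exp (- 1)"
        by (simp add: right_diff_distrib exp_add[symmetric])
      finally have lim: "(\<lambda>n. w n i * (v n i - v n (Suc i) - (v n i + v n (Suc i)) * (1 / k n))) \<longlonglongrightarrow> 1 - exp (- 1)" .
      have "1 / 2 < 1 - exp (- 1 :: real)"
      proof -
        have "(1 + 1 / 2)\<^sup>2 \<le> (exp (1 / 2 :: real))\<^sup>2"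
          using exp_ge_add_one_self[of "1 / 2"] by (intro power_mono) auto
        also have "\<dots> = exp 1" by (simp add: exp_double[symmetric])
        finally have "2 < exp (1 :: real)" by (simp add: power2_eq_square)
        then show ?thesis by (simp add: exp_minus field_simps)
      qed
      then show "eventually (\<lambda>n. 1 / 2 < w n i * (v n i - v n (Suc i) - (v n i + v n (Suc i)) * (1 / k n))) sequentially"
        by (rule order_tendstoD(1)[OF lim])
    qed
  qed simp
  \<comment> \<open>Keeps all lowered thresholds \<open>\<theta> n * (1 - i * s n)\<close> with
    \<open>i \<le> I\<close> positive.\<close>
  have "(\<lambda>n. real I * s n) \<longlonglongrightarrow> real I * 0" by (intro tendsto_intros s_0)
  then have Is: "eventually (\<lambda>n. real I * s n < 1) sequentially" by (rule order_tendstoD) simp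
  have k12: "eventually (\<lambda>n. 12 * real (k n) \<le> d n) sequentially" by (rule k_mult_le_d) simp
  show ?thesis
    using w_le gap Is F_scaled_error[OF Y(1)] z eventually_ge_at_top[of 2] k_ge_ev[of 2] k12
      poly_\<beta>_le_d[of 48] k_le_\<beta> d_ge_ev[of "24 * Y"]
  proof eventually_elim
    case (elim n)
    interpret iid_weights "M n" n "X n" "F n" by (rule weights)
    have zn: "0 < z n" using elim by simp
    have \<theta>: "0 < \<theta> n" using zn by (simp add: \<theta>_def u_def)
    have d: "0 < d n" by (simp add: d_def)
    have n: "2 \<le> n" "0 < real n" and k: "2 \<le> k n" "2 \<le> real (k n)" using elim by auto
    have s: "0 < s n" by (rule s_pos)
    have err: "\<bar>n * F n (\<theta> n * c) - d n * y\<bar> \<le> d n * y / k n" if "0 < c" "y = c powr (1 / s n)" "y \<le> Y" for c y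
      using elim(4) that by blast
    have half: "d n * y / k n \<le> d n * y / 2" if "0 \<le> y" for y
      using k d that by (intro divide_left_mono) auto
    have is1: "real i * s n < 1" if "i \<le> I" for i
    proof -
      have "real i * s n \<le> real I * s n" using that s by (intro mult_right_mono) auto
      then show ?thesis using elim by simp
    qed
    have w1: "1 \<le> w n i" for i using s unfolding w_def by (intro ge_one_powr_ge_zero) auto
    have p0: "\<bar>n * F n (\<theta> n) - d n\<bar> \<le> d n / k n" using err[of 1 1] Y by simp
    have pi: "\<bar>n * F n (\<theta> n * (1 + i * s n)) - d n * w n i\<bar> \<le> d n * w n i / 2" if i: "i < I" for i
    proof -
      have "\<bar>n * F n (\<theta> n * (1 + i * s n)) - d n * w n i\<bar> \<le> d n * w n i / k n"
        using elim(1) i s by (intro err) (auto simp: w_def intro!: add_pos_nonneg)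
      then show ?thesis using half[of "w n i"] w1[of i] by linarith
    qed
    have ph: "\<bar>n * F n (\<theta> n * (1 - i * s n)) - d n * v n i\<bar> \<le> d n * v n i / k n" if i: "i \<le> I" for i
    proof (rule err)
      have "v n i \<le> 1" unfolding v_def using is1[OF i] s by (intro powr_le1) auto
      then show "v n i \<le> Y" using Y by simp
    qed (use is1[OF i] in \<open>auto simp: v_def\<close>)
    show ?case
    proof (rule prob_min_path_weight_gt_explicit[where d = "d n" and w = "w n"
          and \<Theta> = "\<lambda>i. \<theta> n * (1 + i * s n)" and h = "\<lambda>i. \<theta> n * (1 - i * s n)"])
      show "2 \<le> n" "2 \<le> k n" "0 < d n" by fact+
      show "d n ^ k n = n" using n k by (intro d_power_k) auto
      show "d n * (1 - 1 / k n) \<le> n * F n (\<theta> n)" using p0 by (simp add: algebra_simps)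
      show "n * F n (\<theta> n) \<le> 2 * d n" proof -
        have "d n / k n \<le> d n / 2" using k d by (intro divide_left_mono) auto
        then show ?thesis using p0 d by linarith
      qed
      show "12 * real (k n) \<le> d n" using elim by simp
      show "48 * (real (k n))\<^sup>2 * ln (real n) \<le> d n"
      proof -
        have "48 * (real (k n))\<^sup>2 * ln (real n) = 48 * (real (k n) ^ 3 * \<beta> n)"
          using k by (simp add: \<beta>_def power2_eq_square power3_eq_cube)
        also have "\<dots> \<le> 48 * (\<beta> n ^ 3 * \<beta> n)"
          using elim k by (intro mult_left_mono mult_right_mono power_mono) auto
        also have "\<dots> = 48 * \<beta> n ^ 4" by (simp add: power3_eq_cube power4_eq_xxxx)
        finally show ?thesis using elim by simp
      qed
      fix i
      show "1 \<le> w n i" by (rule w1)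
      show "\<theta> n * (1 - real (Suc i) * s n) \<le> \<theta> n * (1 - real i * s n)"
        using \<theta> s by (intro mult_left_mono) auto
      assume i: "i < I"
      show "24 * w n i \<le> d n" proof -
        have "w n i \<le> Y" using elim(1) i by simp
        then show ?thesis using elim(11) by linarith
      qed
      show "d n * w n i / 2 \<le> n * F n (\<theta> n * (1 + i * s n))" using pi[OF i] by linarith
      show "n * F n (\<theta> n * (1 + i * s n)) \<le> 2 * (d n * w n i)" using pi[OF i] w1[of i] d by linarith
      show "\<theta> n * (1 + i * s n) + \<theta> n * (1 - i * s n) = 2 * \<theta> n" by (simp add: algebra_simps)
      have "w n i * (v n i - v n (Suc i) - (v n i + v n (Suc i)) * (1 / k n))
          = w n i / d n * ((d n * v n i - d n * v n i / k n) - (d n * v n (Suc i) + d n * v n (Suc i) / k n))"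
        using d k by (simp add: field_simps)
      also have "\<dots> \<le> w n i / d n * (n * F n (\<theta> n * (1 - i * s n)) - n * F n (\<theta> n * (1 - Suc i * s n)))"
        using ph[of i] ph[of "Suc i"] i w1[of i] d by (intro mult_left_mono) auto
      also have "\<dots> = w n i * (n / d n) * (F n (\<theta> n * (1 - i * s n)) - F n (\<theta> n * (1 - Suc i * s n)))"
        by (simp add: right_diff_distrib)
      finally have "w n i * (v n i - v n (Suc i) - (v n i + v n (Suc i)) * (1 / k n))
          \<le> w n i * (n / d n) * (F n (\<theta> n * (1 - i * s n)) - F n (\<theta> n * (1 - Suc i * s n)))" .
      moreover have "1 / 2 < w n i * (v n i - v n (Suc i) - (v n i + v n (Suc i)) * (1 / k n))"
        using elim(2) i by blast
      ultimately show "1 / 2 \<le> w n i * (n / d n) * (F n (\<theta> n * (1 - i * s n)) - F n (\<theta> n * (1 - Suc i * s n)))"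
        by linarith
    qed
  qed
qed

lemma prob_gt_upper_bound_tendsto:
  "(\<lambda>n. measure (M n) {\<omega> \<in> space (M n). exp 1 * k n * u n < min_path_weight n (\<lambda>e. X n e \<omega>)}) \<longlonglongrightarrow> 0"
proof (rule tendsto_sandwich[OF always_eventually _ tendsto_const, rotated 2])
  let ?P = "\<lambda>n. measure (M n) {\<omega> \<in> space (M n). k n * \<theta> n < min_path_weight n (\<lambda>e. X n e \<omega>)}"
  show "eventually (\<lambda>n. measure (M n) {\<omega> \<in> space (M n). exp 1 * k n * u n < min_path_weight n (\<lambda>e. X n e \<omega>)} \<le> ?P n) sequentially"
    using z k_ge_ev[of 1]
  proof eventually_elim
    case (elim n)
    interpret iid_weights "M n" n "X n" "F n" by (rule weights)
    have "exp (\<beta> n * s n) \<le> exp 1" using \<beta>_s_le_1[of n] elim by simp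
    then have "k n * \<theta> n \<le> exp 1 * k n * u n"
      unfolding \<theta>_def using elim by (simp add: u_def mult_left_mono mult_ac)
    then have "{\<omega> \<in> space (M n). exp 1 * k n * u n < min_path_weight n (\<lambda>e. X n e \<omega>)}
        \<subseteq> {\<omega> \<in> space (M n). k n * \<theta> n < min_path_weight n (\<lambda>e. X n e \<omega>)}" by auto
    moreover have "{\<omega> \<in> space (M n). k n * \<theta> n < min_path_weight n (\<lambda>e. X n e \<omega>)} \<in> events"
      using min_path_weight_measurable by measurable
    ultimately show ?case by (rule finite_measure_mono)
  qed
  show "?P \<longlonglongrightarrow> 0"
  proof (rule tendstoI)
    fix e :: real assume e: "0 < e"
    define c where "c = exp (- 6 :: real) / 16"
    have c: "0 < c" by (simp add: c_def)
    \<comment> \<open>\<open>I\<close> is fixed before \<open>n\<close> tends to infinity: the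
      exponential becomes small through \<open>I\<close>, the other term through
      \<open>n\<close>.\<close>
    obtain I :: nat where "- ln (e / 2) / c < real I" using reals_Archimedean2 by blast
    then have "- (real I * c) < ln (e / 2)" using c by (simp add: field_simps)
    then have I: "exp (- (real I * exp (- 6) / 16)) < e / 2"
      using e by (metis c_def divide_pos_pos exp_less_mono exp_ln times_divide_eq_right zero_less_numeral)
    have "(\<lambda>n. 2 * (real I + 1) / real n) \<longlonglongrightarrow> 0"
      by (intro real_tendsto_divide_at_top[OF tendsto_const] filterlim_real_sequentially)
    then have "eventually (\<lambda>n. 2 * (real I + 1) / real n < e / 2) sequentially"
      by (rule order_tendstoD) (use e in simp)
    with prob_gt_k_\<theta>_le[of I] show "eventually (\<lambda>n. dist (?P n) 0 < e) sequentially"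
    proof eventually_elim
      case (elim n)
      then have "?P n < e" using I by linarith
      then show ?case by simp
    qed
  qed
qed simp

end

section \<open>Asymptotics of the lower bound and of the hopcount\<close>

context fpp_power_weights
begin

text \<open>With high probability no edge satisfies \<open>X\<^sup>1\<^sup>/\<^sup>s < 2\<^sup>-\<^sup>J\<close>.  Since \<open>R\<close> is of order \<open>ln n\<close>, the factor \<open>R\<^sup>k\<close> lost in the
  first moment bound only replaces \<open>t\<close> by \<open>t * \<rho>\<close> with \<open>\<rho> \<longlonglongrightarrow> 1\<close>.\<close>

definition J :: "nat \<Rightarrow> nat" where "J n = nat \<lceil>4 * log 2 (real n)\<rceil>"
definition R :: "nat \<Rightarrow> real" where "R n = 2 * (2 / lam) * (1 + 2 * B * real (J n))"
definition \<rho> :: "nat \<Rightarrow> real" where "\<rho> n = R n powr s n"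
definition \<epsilon> :: "nat \<Rightarrow> real" where "\<epsilon> n = sqrt (s n * ln (ln (real n)))"

text \<open>The fourth power leaves \<open>B / n\<^sup>2\<close> after the union over at most
  \<open>n\<^sup>2\<close> edges.\<close>

lemma half_power_J: "1 \<le> n \<Longrightarrow> (1 / 2) ^ J n \<le> 1 / real n ^ 4"
proof -
  assume n: "1 \<le> n"
  have "real n ^ 4 = (2 powr log 2 (real n)) ^ 4" using n by simp
  also have "\<dots> = 2 powr (4 * log 2 (real n))" by (simp add: powr_powr[symmetric] powr_power mult.commute)
  also have "\<dots> \<le> 2 powr real (J n)" unfolding J_def by (intro powr_mono) linarith+
  also have "\<dots> = 2 ^ J n" by (simp add: powr_realpow)
  finally have "1 / 2 ^ J n \<le> 1 / real n ^ 4" using n by (intro divide_left_mono) auto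
  then show ?thesis by (simp add: power_one_over)
qed

lemma R_pos: "0 < R n"
  using lam B(1) by (simp add: R_def add_pos_nonneg)

text \<open>The quantifiers over \<open>t\<close>, \<open>K\<close> and \<open>m\<close> stand
  inside \<open>eventually\<close> because all three depend on \<open>n\<close> when the bound is
  applied.\<close>

lemma prob_light_path_le_asymp:
  "eventually (\<lambda>n. \<forall>t K m. 0 < t \<longrightarrow> (\<forall>j\<in>K. 1 \<le> j \<longrightarrow> real j * ln (t * \<rho> n / real j) \<le> m) \<longrightarrow>
     measure (M n) {\<omega> \<in> space (M n). \<exists>p\<in>self_avoiding_paths n 1 2. length p - 1 \<in> K \<and>
            path_weight (\<lambda>e. X n e \<omega>) p \<le> t * u n} \<le> B / (real n)\<^sup>2 + exp (m / s n - ln n)) sequentially"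
  using z eventually_ge_at_top[of 2]
proof eventually_elim
  case (elim n)
  interpret iid_weights "M n" n "X n" "F n" by (rule weights)
  interpret weights_power_bound "M n" n "X n" "F n" "1 / s n" B
  proof
    show "F n y \<le> B * y powr (1 / s n)" if "0 < y" for y
      using F_eq[of n y] B(2)[of "y powr (1 / s n)"] that elim by simp
  qed (use s_pos[of n] B in auto)
  show ?case
  proof (intro allI impI)
    fix t m :: real and K :: "nat set"
    assume t: "0 < t" and m: "\<forall>j\<in>K. 1 \<le> j \<longrightarrow> real j * ln (t * \<rho> n / real j) \<le> m"
    let ?P = "measure (M n) {\<omega> \<in> space (M n). \<exists>p\<in>self_avoiding_paths n 1 2. length p - 1 \<in> K \<and>
      path_weight (\<lambda>e. X n e \<omega>) p \<le> t * u n}"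
    have n: "0 < real n" using elim by simp
    have "?P \<le> (real n)\<^sup>2 * B * (1 / 2) ^ J n + exp (1 / s n * m) / n"
    proof (rule prob_light_path_le[where C = "2 / lam"])
      show "0 < u n" using elim by (simp add: u_def)
      show "u n powr (1 / s n) \<le> 2 / lam / n" using elim s_pos[of n] by (simp add: u_def powr_powr)
      fix j assume "j \<in> K" "1 \<le> j"
      then show "real j * ln (t * (2 * (2 / lam) * (1 + 2 * B * real (J n))) powr (1 / (1 / s n)) / real j) \<le> m"
        using m by (simp add: \<rho>_def R_def)
    qed (use elim t lam in auto)
    also have "(real n)\<^sup>2 * B * (1 / 2) ^ J n \<le> (real n)\<^sup>2 * B * (1 / real n ^ 4)"
      using half_power_J[of n] B elim by (intro mult_left_mono) auto
    also have "\<dots> = B / (real n)\<^sup>2" using n by (simp add: power2_eq_square power4_eq_xxxx)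
    also have "exp (1 / s n * m) / n = exp (m / s n - ln n)" using n by (simp add: exp_diff)
    finally show "?P \<le> B / (real n)\<^sup>2 + exp (m / s n - ln n)" by simp
  qed
qed

text \<open>Since \<open>ln x \<le> 2 * sqrt x\<close> for \<open>x \<ge> 1\<close>, the product is
  at most \<open>2 * sqrt (s\<^sup>2 * ln n)\<close>.\<close>

lemma s_ln_ln_tendsto: "(\<lambda>n. s n * ln (ln (real n))) \<longlonglongrightarrow> 0"
proof (rule tendsto_sandwich[OF _ _ tendsto_const])
  show "eventually (\<lambda>n. 0 \<le> s n * ln (ln (real n))) sequentially"
    using ln_ge_ev[of 1] by (rule eventually_mono) (use s_pos in \<open>simp add: less_imp_le\<close>)
  show "eventually (\<lambda>n. s n * ln (ln (real n)) \<le> 2 * sqrt ((s n)\<^sup>2 * ln (real n))) sequentially"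
    using ln_ge_ev[of 1]
  proof eventually_elim
    case (elim n)
    have "ln (ln (real n)) = 2 * ln (sqrt (ln (real n)))" using elim by (simp add: ln_sqrt)
    also have "\<dots> \<le> 2 * sqrt (ln (real n))"
      using ln_le_minus_one[of "sqrt (ln (real n))"] elim by simp
    finally have "s n * ln (ln (real n)) \<le> s n * (2 * sqrt (ln (real n)))"
      using s_pos[of n] by (intro mult_left_mono) auto
    also have "\<dots> = 2 * sqrt ((s n)\<^sup>2 * ln (real n))" using s_pos[of n] by (simp add: real_sqrt_mult)
    finally show ?case .
  qed
  have "(\<lambda>n. 2 * sqrt ((s n)\<^sup>2 * ln (real n))) \<longlonglongrightarrow> 2 * sqrt 0"
    by (intro tendsto_intros s2_ln)
  then show "(\<lambda>n. 2 * sqrt ((s n)\<^sup>2 * ln (real n))) \<longlonglongrightarrow> 0" by simp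
qed

lemma \<epsilon>_tendsto: "\<epsilon> \<longlonglongrightarrow> 0"
  using tendsto_real_sqrt[OF s_ln_ln_tendsto] by (simp add: \<epsilon>_def[abs_def])

lemma R_le:
  obtains c where "0 < c" "eventually (\<lambda>n. R n \<le> c * ln (real n)) sequentially"
proof -
  define c where "c = 4 / lam * (1 + 2 * B * (4 / ln 2 + 1))"
  have "eventually (\<lambda>n. R n \<le> c * ln (real n)) sequentially"
    using ln_ge_ev[of 1]
  proof eventually_elim
    case (elim n)
    have "0 \<le> log 2 (real n)" using elim by (simp add: log_def)
    then have "real (J n) \<le> 4 * log 2 (real n) + 1" unfolding J_def by linarith
    also have "\<dots> \<le> (4 / ln 2 + 1) * ln (real n)" using elim by (simp add: log_def algebra_simps)
    finally have "2 * B * real (J n) \<le> 2 * B * ((4 / ln 2 + 1) * ln (real n))"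
      using B by (intro mult_left_mono) auto
    then have "1 + 2 * B * real (J n) \<le> (1 + 2 * B * (4 / ln 2 + 1)) * ln (real n)"
      using elim by (simp add: algebra_simps)
    then have "2 * (2 / lam) * (1 + 2 * B * real (J n)) \<le> 2 * (2 / lam) * ((1 + 2 * B * (4 / ln 2 + 1)) * ln (real n))"
      using lam by (intro mult_left_mono) auto
    moreover have "2 * (2 / lam) = 4 / lam" by simp
    ultimately show ?case unfolding R_def c_def by (simp only: mult.assoc)
  qed
  moreover have "0 < 1 + 2 * B * (4 / ln 2 + 1)" using B by (intro add_pos_nonneg mult_nonneg_nonneg) auto
  then have "0 < c" using lam by (simp add: c_def)
  ultimately show ?thesis using that by blast
qed

text \<open>The truncation costs a relative error of order \<open>\<epsilon>\<^sup>2\<close> in the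
  weight, which is negligible against \<open>\<epsilon>\<close>. This makes
  \<open>\<epsilon>\<close> large enough as the error in the lower bound.\<close>

lemma ln_\<rho>_le: "eventually (\<lambda>n. s n * ln (R n) \<le> 2 * (\<epsilon> n)\<^sup>2) sequentially"
proof -
  obtain c where c: "0 < c" "eventually (\<lambda>n. R n \<le> c * ln (real n)) sequentially" by (rule R_le)
  show ?thesis
    using c(2) ln_ge_ev[of "max 1 c"]
  proof eventually_elim
    case (elim n)
    have "ln (R n) \<le> ln (c * ln (real n))" using elim R_pos c by simp
    also have "\<dots> = ln c + ln (ln (real n))" using elim c by (simp add: ln_mult)
    also have "ln c \<le> ln (ln (real n))" using elim c by simp
    finally have "s n * ln (R n) \<le> s n * (2 * ln (ln (real n)))" using s_pos[of n] by (intro mult_left_mono) auto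
    moreover have "0 \<le> s n * ln (ln (real n))" using elim s_pos[of n] by (simp add: less_imp_le)
    ultimately show ?case by (simp add: \<epsilon>_def)
  qed
qed

lemma \<rho>_eq: "\<rho> n = exp (s n * ln (R n))"
  using R_pos[of n] by (simp add: \<rho>_def powr_def)

lemma \<rho>_tendsto: "\<rho> \<longlonglongrightarrow> 1"
proof -
  have "(\<lambda>n. s n * ln (R n)) \<longlonglongrightarrow> 0"
  proof (rule tendsto_sandwich[OF always_eventually ln_\<rho>_le])
    show "\<forall>n. s n * ln (4 / lam) \<le> s n * ln (R n)"
    proof
      fix n
      have "4 / lam * 1 \<le> 4 / lam * (1 + 2 * B * real (J n))" using lam B by (intro mult_left_mono) auto
      then have "ln (4 / lam) \<le> ln (R n)" using lam R_pos[of n] by (simp add: R_def)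
      then show "s n * ln (4 / lam) \<le> s n * ln (R n)" using s_pos[of n] by (intro mult_left_mono) auto
    qed
    show "(\<lambda>n. s n * ln (4 / lam)) \<longlonglongrightarrow> 0" using tendsto_mult[OF s_0 tendsto_const] by simp
    have "(\<lambda>n. 2 * (\<epsilon> n)\<^sup>2) \<longlonglongrightarrow> 2 * 0\<^sup>2" by (intro tendsto_intros \<epsilon>_tendsto)
    then show "(\<lambda>n. 2 * (\<epsilon> n)\<^sup>2) \<longlonglongrightarrow> 0" by simp
  qed
  then have "(\<lambda>n. exp (s n * ln (R n))) \<longlonglongrightarrow> exp 0" by (rule tendsto_exp)
  then show ?thesis by (simp add: \<rho>_eq[abs_def])
qed

lemma B_over_n2_tendsto: "(\<lambda>n. B / (real n)\<^sup>2) \<longlonglongrightarrow> 0"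
  by (intro real_tendsto_divide_at_top[OF tendsto_const] filterlim_pow_at_top filterlim_real_sequentially) simp

lemma prob_lt_lower_bound_tendsto:
  "(\<lambda>n. measure (M n) {\<omega> \<in> space (M n).
      min_path_weight n (\<lambda>e. X n e \<omega>) < (1 - \<epsilon> n) * exp 1 * of_int \<lfloor>s n * ln n\<rfloor> * u n}) \<longlonglongrightarrow> 0"
proof (rule tendsto_sandwich[OF always_eventually _ tendsto_const])
  have \<epsilon>4: "eventually (\<lambda>n. \<epsilon> n < 1 / 4) sequentially" by (rule order_tendstoD(2)[OF \<epsilon>_tendsto]) simp
  have sL: "eventually (\<lambda>n. 1 \<le> s n * ln (real n)) sequentially" using s_ln by (simp add: filterlim_at_top)
  show "eventually (\<lambda>n. measure (M n) {\<omega> \<in> space (M n).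
      min_path_weight n (\<lambda>e. X n e \<omega>) < (1 - \<epsilon> n) * exp 1 * of_int \<lfloor>s n * ln n\<rfloor> * u n}
      \<le> B / (real n)\<^sup>2 + exp (- (sqrt (ln (real n)) / 4))) sequentially"
    using prob_light_path_le_asymp \<epsilon>4 sL ln_ge_ev[of 1] ln_ge_ev[of "exp 1"] ln_\<rho>_le eventually_ge_at_top[of 2] z
  proof eventually_elim
    case (elim n)
    interpret iid_weights "M n" n "X n" "F n" by (rule weights)
    define L where "L = ln (real n)"
    define t where "t = (1 - \<epsilon> n) * exp 1 * of_int \<lfloor>s n * L\<rfloor>"
    have L1: "1 \<le> L" "1 \<le> s n * L" "1 \<le> ln L"
    proof -
      show "1 \<le> L" "1 \<le> s n * L" using elim by (auto simp: L_def)
      have "ln (exp 1) \<le> ln L" using elim unfolding L_def by (subst ln_le_cancel_iff) auto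
      then show "1 \<le> ln L" by simp
    qed
    have s: "0 < s n" by (rule s_pos)
    have "1 \<le> \<lfloor>s n * L\<rfloor>" using L1 by (simp add: le_floor_iff)
    then have fl: "1 \<le> real_of_int \<lfloor>s n * L\<rfloor>" "of_int \<lfloor>s n * L\<rfloor> \<le> s n * L" by linarith+
    have \<epsilon>0: "0 \<le> \<epsilon> n" "(\<epsilon> n)\<^sup>2 = s n * ln L" using L1 s by (auto simp: \<epsilon>_def L_def)
    have t: "0 < t" using elim fl by (simp add: t_def)
    have \<rho>0: "0 < \<rho> n" by (simp add: \<rho>_eq)
    \<comment> \<open>The maximum over real \<open>j\<close> is attained at
      \<open>j = t * \<rho> n / exp 1\<close>; the bound is \<open>ln y \<le> y - 1\<close> for
      \<open>y = t * \<rho> n / (exp 1 * j)\<close>.\<close>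
    have mono: "real j * ln (t * \<rho> n / real j) \<le> t * \<rho> n / exp 1" if "1 \<le> j" for j :: nat
    proof -
      have j: "0 < real j" using that by simp
      have "ln (t * \<rho> n / (exp 1 * real j)) \<le> t * \<rho> n / (exp 1 * real j) - 1"
        using t \<rho>0 j by (intro ln_le_minus_one) simp
      moreover have "ln (t * \<rho> n / (exp 1 * real j)) = ln (t * \<rho> n / real j) - 1"
        using t \<rho>0 j by (simp add: ln_div ln_mult)
      ultimately have "ln (t * \<rho> n / real j) \<le> t * \<rho> n / (exp 1 * real j)" by simp
      then have "real j * ln (t * \<rho> n / real j) \<le> real j * (t * \<rho> n / (exp 1 * real j))"
        by (intro mult_left_mono) auto
      then show ?thesis using j by (simp add: field_simps)
    qed
    let ?A = "{\<omega> \<in> space (M n). min_path_weight n (\<lambda>e. X n e \<omega>) < t * u n}"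
    let ?B = "{\<omega> \<in> space (M n). \<exists>p\<in>self_avoiding_paths n 1 2. length p - 1 \<in> UNIV \<and>
      path_weight (\<lambda>e. X n e \<omega>) p \<le> t * u n}"
    have "measure (M n) ?A \<le> measure (M n) ?B"
    proof (rule finite_measure_mono)
      show "?A \<subseteq> ?B"
      proof safe
        fix \<omega> assume w: "min_path_weight n (\<lambda>e. X n e \<omega>) < t * u n"
        have "Min (path_weight (\<lambda>e. X n e \<omega>) ` self_avoiding_paths n 1 2) \<in> path_weight (\<lambda>e. X n e \<omega>) ` self_avoiding_paths n 1 2"
          using self_avoiding_paths_nonempty[of n] elim by (intro Min_in) auto
        then show "\<exists>p\<in>self_avoiding_paths n 1 2. length p - 1 \<in> UNIV \<and> path_weight (\<lambda>e. X n e \<omega>) p \<le> t * u n"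
          using w unfolding min_path_weight_def by force
      qed
      show "?B \<in> events"
      proof (rule sets.sets_Collect_finite_Ex)
        fix p assume p: "p \<in> self_avoiding_paths n 1 2"
        note [measurable] = measurable_path_weight[OF p]
        show "{\<omega> \<in> space (M n). length p - 1 \<in> UNIV \<and> path_weight (\<lambda>e. X n e \<omega>) p \<le> t * u n} \<in> events"
          by measurable
      qed simp
    qed
    also have "\<dots> \<le> B / (real n)\<^sup>2 + exp (t * \<rho> n / exp 1 / s n - ln n)"
      using elim(1) t mono by blast
    also have "t * \<rho> n / exp 1 / s n - ln n \<le> - (sqrt L / 4)"
    proof -
      have "t * \<rho> n / exp 1 / s n = (1 - \<epsilon> n) * \<rho> n * (of_int \<lfloor>s n * L\<rfloor> / s n)" by (simp add: t_def)
      also have "\<dots> \<le> (1 - \<epsilon> n) * \<rho> n * L"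
        using fl s elim \<rho>0 by (intro mult_left_mono) (auto simp: field_simps)
      also have "(1 - \<epsilon> n) * \<rho> n \<le> 1 - \<epsilon> n / 4"
      proof -
        have "(1 - \<epsilon> n) * \<rho> n \<le> exp (- \<epsilon> n) * exp (2 * (\<epsilon> n)\<^sup>2)"
          using exp_ge_add_one_self[of "- \<epsilon> n"] elim \<rho>0 by (intro mult_mono) (auto simp: \<rho>_eq)
        also have "\<dots> = exp (2 * (\<epsilon> n)\<^sup>2 - \<epsilon> n)" by (simp add: exp_add[symmetric])
        \<comment> \<open>As \<open>\<epsilon> n < 1 / 4\<close>, the cost
          \<open>2 * (\<epsilon> n)\<^sup>2\<close> uses up at most half of the gain
          \<open>\<epsilon> n\<close>.\<close>
        also have "\<dots> \<le> exp (- (\<epsilon> n / 2))"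
        proof -
          have "\<epsilon> n * \<epsilon> n \<le> \<epsilon> n * (1 / 4)" using elim \<epsilon>0 by (intro mult_left_mono) auto
          then show ?thesis by (simp add: power2_eq_square)
        qed
        also have "\<dots> \<le> 1 - \<epsilon> n / 4"
        proof -
          have "\<epsilon> n / 2 * (1 / 2) \<le> \<epsilon> n / 2 * (1 - \<epsilon> n / 2)" using elim \<epsilon>0 by (intro mult_left_mono) auto
          then show ?thesis using one_minus_exp_minus_ge[of "\<epsilon> n / 2"] \<epsilon>0 by simp
        qed
        finally show ?thesis .
      qed
      then have "(1 - \<epsilon> n) * \<rho> n * L \<le> (1 - \<epsilon> n / 4) * L" using L1 by (intro mult_right_mono) auto
      finally have "t * \<rho> n / exp 1 / s n - ln n \<le> - (L * \<epsilon> n / 4)" by (simp add: L_def algebra_simps)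
      \<comment> \<open>\<open>(L * \<epsilon>)\<^sup>2 = L * (s * L) * ln L\<close>, where the last
        two factors are at least 1. So the exponent tends to minus infinity.\<close>
      moreover have "sqrt L \<le> L * \<epsilon> n"
      proof -
        have "L * 1 * 1 \<le> L * (s n * L) * ln L" using L1 by (intro mult_mono) auto
        also have "\<dots> = (L * \<epsilon> n)\<^sup>2" using \<epsilon>0 by (simp add: power_mult_distrib power2_eq_square[of L])
        finally have "L \<le> (L * \<epsilon> n)\<^sup>2" by simp
        then show ?thesis using L1 \<epsilon>0 by (intro real_le_lsqrt) auto
      qed
      ultimately show ?thesis by linarith
    qed
    finally show ?case by (simp add: t_def L_def)
  qed
  have "filterlim (\<lambda>n. sqrt (ln (real n)) * (1 / 4)) at_top sequentially"
    by (rule filterlim_at_top_mult_tendsto_pos[OF tendsto_const])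
      (auto intro: filterlim_compose[OF sqrt_at_top ln_top])
  then have "(\<lambda>n. exp (- (sqrt (ln (real n)) / 4))) \<longlonglongrightarrow> 0"
    by (intro filterlim_compose[OF exp_at_bot]) (simp add: filterlim_uminus_at_bot)
  then show "(\<lambda>n. B / (real n)\<^sup>2 + exp (- (sqrt (ln (real n)) / 4))) \<longlonglongrightarrow> 0"
    using tendsto_add[OF B_over_n2_tendsto] by force
qed simp

lemma k_ratio_tendsto: "(\<lambda>n. k n / (s n * ln n)) \<longlonglongrightarrow> 1"
proof (rule tendsto_sandwich)
  have sL: "eventually (\<lambda>n. 1 \<le> s n * ln (real n)) sequentially" using s_ln by (simp add: filterlim_at_top)
  show "eventually (\<lambda>n. 1 \<le> k n / (s n * ln n)) sequentially"
    using sL by (rule eventually_mono) (use k_ge in \<open>simp add: pos_le_divide_eq\<close>)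
  show "eventually (\<lambda>n. k n / (s n * ln n) \<le> 1 + 1 / (s n * ln n)) sequentially"
    using sL eventually_ge_at_top[of 1]
  proof eventually_elim
    case (elim n)
    have "k n / (s n * ln n) \<le> (s n * ln n + 1) / (s n * ln n)"
      using elim k_le[of n] by (intro divide_right_mono) auto
    also have "\<dots> = 1 + 1 / (s n * ln n)" using elim by (subst add_divide_distrib) auto
    finally show ?case .
  qed
  have "(\<lambda>n. 1 + 1 / (s n * ln (real n))) \<longlonglongrightarrow> 1 + 0"
    by (intro tendsto_add tendsto_const real_tendsto_divide_at_top[OF tendsto_const s_ln])
  then show "(\<lambda>n. 1 + 1 / (s n * ln (real n))) \<longlonglongrightarrow> 1" by simp
qed simp

text \<open>For total weight \<open>exp 1 * k * u\<close> the optimal length is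
  \<open>k * \<rho>\<close>. A path with \<open>j = x * k * \<rho>\<close> edges has exponent
  proportional to \<open>x * (1 - ln x)\<close>, which stays a fixed amount below its maximum when
  \<open>x\<close> is away from 1; this beats the error in \<open>r\<close>, the ratio of
  \<open>k * \<rho>\<close> to \<open>s * ln n\<close>.\<close>

lemma prob_light_path_of_atypical_length_tendsto:
  assumes \<delta>: "0 < \<delta>"
  shows "(\<lambda>n. measure (M n) {\<omega> \<in> space (M n). \<exists>p\<in>self_avoiding_paths n 1 2.
      length p - 1 \<in> {j. \<delta> < \<bar>real j / (s n * ln n) - 1\<bar>} \<and>
      path_weight (\<lambda>e. X n e \<omega>) p \<le> exp 1 * k n * u n}) \<longlonglongrightarrow> 0"
proof -
  obtain c where c: "0 < c" "\<And>x. 0 < x \<Longrightarrow> \<delta> / 3 \<le> \<bar>x - 1\<bar> \<Longrightarrow> x * (1 - ln x) \<le> 1 - c"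
    using mult_one_minus_ln_gap[of "\<delta> / 3"] \<delta> by auto
  define r where "r n = k n * \<rho> n / (s n * ln n)" for n
  have r: "r \<longlonglongrightarrow> 1"
    using tendsto_mult[OF k_ratio_tendsto \<rho>_tendsto] by (simp add: r_def[abs_def])
  have sL: "eventually (\<lambda>n. 1 \<le> s n * ln (real n)) sequentially" using s_ln by (simp add: filterlim_at_top)
  have r_near: "eventually (\<lambda>n. dist (r n) 1 < min 1 (\<delta> / 3)) sequentially"
    by (rule tendstoD[OF r]) (use \<delta> in simp)
  have "(\<lambda>n. r n * (1 - c) - 1) \<longlonglongrightarrow> 1 * (1 - c) - 1" by (intro tendsto_intros r)
  then have rc: "eventually (\<lambda>n. r n * (1 - c) - 1 < - (c / 2)) sequentially"
    by (rule order_tendstoD) (use c in simp)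
  show ?thesis
  proof (rule tendsto_sandwich[OF always_eventually _ tendsto_const])
    show "eventually (\<lambda>n. measure (M n) {\<omega> \<in> space (M n). \<exists>p\<in>self_avoiding_paths n 1 2.
        length p - 1 \<in> {j. \<delta> < \<bar>real j / (s n * ln n) - 1\<bar>} \<and>
        path_weight (\<lambda>e. X n e \<omega>) p \<le> exp 1 * k n * u n}
        \<le> B / (real n)\<^sup>2 + exp (- (c / 2 * ln (real n)))) sequentially"
      using prob_light_path_le_asymp sL r_near rc k_ge_ev[of 1] ln_ge_ev[of 1]
    proof eventually_elim
      case (elim n)
      let ?K = "{j. \<delta> < \<bar>real j / (s n * ln n) - 1\<bar>}"
      have k: "0 < real (k n)" and \<rho>0: "0 < \<rho> n" using elim by (auto simp: \<rho>_eq)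
      have sL: "0 < s n * ln n" using elim by simp
      have s: "0 < s n" by (rule s_pos)
      have r2: "0 < r n" "r n < 2" "\<bar>r n - 1\<bar> < \<delta> / 3" using elim(3) by (auto simp: dist_real_def)
      have m: "real j * ln (exp 1 * k n * \<rho> n / real j) \<le> k n * \<rho> n * (1 - c)" if j: "j \<in> ?K" "1 \<le> j" for j
      proof -
        define x where "x = real j / (k n * \<rho> n)"
        have x: "0 < x" using j k \<rho>0 by (simp add: x_def)
        have jx: "real j / (s n * ln n) = x * r n" using k \<rho>0 by (simp add: x_def r_def)
        \<comment> \<open>Replacing \<open>s * ln n\<close> by \<open>k * \<rho>\<close> as the unit
          of length: with \<open>r n < 2\<close> the errors in \<open>\<bar>x * r n - 1\<bar> \<le>
          \<bar>x - 1\<bar> * r n + \<bar>r n - 1\<bar>\<close> would be at most two thirds and one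
          third of \<open>\<delta>\<close>.\<close>
        have "\<delta> / 3 \<le> \<bar>x - 1\<bar>"
        proof (rule ccontr)
          assume "\<not> \<delta> / 3 \<le> \<bar>x - 1\<bar>"
          then have "\<bar>x - 1\<bar> * r n \<le> \<delta> / 3 * 2" using r2 \<delta> by (intro mult_mono) auto
          moreover have "\<bar>x * r n - 1\<bar> \<le> \<bar>(x - 1) * r n\<bar> + \<bar>r n - 1\<bar>"
            using abs_triangle_ineq[of "(x - 1) * r n" "r n - 1"] by (simp add: algebra_simps)
          ultimately show False using j(1) r2 jx by (simp add: abs_mult)
        qed
        then have "x * (1 - ln x) \<le> 1 - c" using c(2) x by blast
        moreover have "ln (exp 1 * k n * \<rho> n / real j) = 1 - ln x"
          using j k \<rho>0 by (simp add: x_def ln_div ln_mult)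
        moreover have "real j = k n * \<rho> n * x" using k \<rho>0 by (simp add: x_def)
        ultimately show ?thesis using k \<rho>0 by (simp add: mult.assoc mult_left_mono)
      qed
      have "measure (M n) {\<omega> \<in> space (M n). \<exists>p\<in>self_avoiding_paths n 1 2. length p - 1 \<in> ?K \<and>
        path_weight (\<lambda>e. X n e \<omega>) p \<le> (exp 1 * k n) * u n} \<le> B / (real n)\<^sup>2 + exp (k n * \<rho> n * (1 - c) / s n - ln n)"
        using elim(1)[rule_format, of "exp 1 * k n" ?K "k n * \<rho> n * (1 - c)"] m k by simp
      also have "k n * \<rho> n * (1 - c) / s n - ln n = (r n * (1 - c) - 1) * ln n"
        using s elim by (simp add: r_def field_simps)
      also have "\<dots> \<le> - (c / 2) * ln n" using elim by (intro mult_right_mono) auto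
      finally show ?case by (simp add: mult.assoc)
    qed
    have "filterlim (\<lambda>n. c / 2 * ln (real n)) at_top sequentially"
      using c by (intro filterlim_tendsto_pos_mult_at_top[OF tendsto_const] ln_top) simp
    then have "(\<lambda>n. exp (- (c / 2 * ln (real n)))) \<longlonglongrightarrow> 0"
      by (intro filterlim_compose[OF exp_at_bot]) (simp add: filterlim_uminus_at_bot)
    then show "(\<lambda>n. B / (real n)\<^sup>2 + exp (- (c / 2 * ln (real n)))) \<longlonglongrightarrow> 0"
      using tendsto_add[OF B_over_n2_tendsto] by force
  qed simp
qed

end

section \<open>Convergence\<close>

context fpp_power_weights
begin

lemma events_min_path_weight:
  "{\<omega> \<in> space (M n). c < min_path_weight n (\<lambda>e. X n e \<omega>)} \<in> sets (M n)"
  "{\<omega> \<in> space (M n). min_path_weight n (\<lambda>e. X n e \<omega>) < c} \<in> sets (M n)"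
proof -
  interpret iid_weights "M n" n "X n" "F n" by (rule weights)
  note [measurable] = min_path_weight_measurable
  show "{\<omega> \<in> space (M n). c < min_path_weight n (\<lambda>e. X n e \<omega>)} \<in> sets (M n)" by measurable
  show "{\<omega> \<in> space (M n). min_path_weight n (\<lambda>e. X n e \<omega>) < c} \<in> sets (M n)" by measurable
qed

definition weight_lower_bound :: "nat \<Rightarrow> real" where "weight_lower_bound n = (1 - \<epsilon> n) * exp 1 * of_int \<lfloor>s n * ln (real n)\<rfloor> * u n"
definition weight_upper_bound :: "nat \<Rightarrow> real" where "weight_upper_bound n = exp 1 * of_int \<lceil>s n * ln (real n)\<rceil> * u n"

lemma k_eq_ceiling: "1 \<le> n \<Longrightarrow> real (k n) = of_int \<lceil>s n * ln (real n)\<rceil>"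
  using s_pos[of n] by (simp add: k_def mult_nonneg_nonneg less_imp_le order_less_le_trans[of "-1" 0])

lemma prob_outside_tendsto:
  "(\<lambda>n. measure (M n) {\<omega> \<in> space (M n). min_path_weight n (\<lambda>e. X n e \<omega>) < weight_lower_bound n}
      + measure (M n) {\<omega> \<in> space (M n). weight_upper_bound n < min_path_weight n (\<lambda>e. X n e \<omega>)}) \<longlonglongrightarrow> 0"
proof -
  have "(\<lambda>n. measure (M n) {\<omega> \<in> space (M n). weight_upper_bound n < min_path_weight n (\<lambda>e. X n e \<omega>)}) \<longlonglongrightarrow> 0"
    by (rule Lim_transform_eventually[OF prob_gt_upper_bound_tendsto])
      (rule eventually_mono[OF eventually_ge_at_top[of 1]], simp add: weight_upper_bound_def k_eq_ceiling)
  from tendsto_add[OF prob_lt_lower_bound_tendsto this] show ?thesis by (simp add: weight_lower_bound_def)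
qed

text \<open>The sequence \<open>v\<close> stands for the weight scale, which is identified with
  \<open>u n\<close> only for large \<open>n\<close>.\<close>

lemma whp_weight_bounds:
  assumes v: "eventually (\<lambda>n. v n = u n) sequentially"
  shows "with_high_probability M (\<lambda>n \<omega>.
     (1 - \<epsilon> n) * exp 1 * of_int \<lfloor>s n * ln (real n)\<rfloor> * v n \<le> min_path_weight n (\<lambda>e. X n e \<omega>) \<and>
     min_path_weight n (\<lambda>e. X n e \<omega>) \<le> exp 1 * of_int \<lceil>s n * ln (real n)\<rceil> * v n)"
  unfolding with_high_probability_def
proof (rule tendsto_sandwich)
  let ?W = "\<lambda>n \<omega>. min_path_weight n (\<lambda>e. X n e \<omega>)"
  let ?Q = "\<lambda>n \<omega>. (1 - \<epsilon> n) * exp 1 * of_int \<lfloor>s n * ln (real n)\<rfloor> * v n \<le> ?W n \<omega> \<and>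
      ?W n \<omega> \<le> exp 1 * of_int \<lceil>s n * ln (real n)\<rceil> * v n"
  let ?p = "\<lambda>n. measure (M n) {\<omega> \<in> space (M n). ?W n \<omega> < weight_lower_bound n} + measure (M n) {\<omega> \<in> space (M n). weight_upper_bound n < ?W n \<omega>}"
  show "eventually (\<lambda>n. 1 - ?p n \<le> measure (M n) {\<omega> \<in> space (M n). ?Q n \<omega>}) sequentially"
    using v
  proof eventually_elim
    case (elim n)
    interpret iid_weights "M n" n "X n" "F n" by (rule weights)
    let ?A = "{\<omega> \<in> space (M n). ?W n \<omega> < weight_lower_bound n}" and ?B = "{\<omega> \<in> space (M n). weight_upper_bound n < ?W n \<omega>}"
    have AB: "?A \<in> events" "?B \<in> events" by (rule events_min_path_weight)+
    have "{\<omega> \<in> space (M n). ?Q n \<omega>} = space (M n) - (?A \<union> ?B)"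
      using elim by (auto simp: weight_lower_bound_def weight_upper_bound_def)
    then show ?case
      using prob_compl[OF sets.Un[OF AB]] measure_Un_le[OF AB] by simp
  qed
  show "eventually (\<lambda>n. measure (M n) {\<omega> \<in> space (M n). ?Q n \<omega>} \<le> 1) sequentially"
  proof (rule always_eventually, rule allI)
    fix n
    interpret iid_weights "M n" n "X n" "F n" by (rule weights)
    show "measure (M n) {\<omega> \<in> space (M n). ?Q n \<omega>} \<le> 1" by (rule prob_le_1)
  qed
  show "(\<lambda>n. 1 - ?p n) \<longlonglongrightarrow> 1" using tendsto_diff[OF tendsto_const prob_outside_tendsto, of 1] by simp
qed simp

lemma floor_ratio_tendsto: "(\<lambda>n. of_int \<lfloor>s n * ln (real n)\<rfloor> / (s n * ln (real n))) \<longlonglongrightarrow> 1"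
proof (rule tendsto_sandwich)
  have sL: "eventually (\<lambda>n. 1 \<le> s n * ln (real n)) sequentially" using s_ln by (simp add: filterlim_at_top)
  show "eventually (\<lambda>n. 1 - 1 / (s n * ln (real n)) \<le> of_int \<lfloor>s n * ln (real n)\<rfloor> / (s n * ln (real n))) sequentially"
    using sL
  proof eventually_elim
    case (elim n)
    have "1 - 1 / (s n * ln (real n)) = (s n * ln (real n) - 1) / (s n * ln (real n))"
      using elim by (subst diff_divide_distrib) auto
    also have "\<dots> \<le> of_int \<lfloor>s n * ln (real n)\<rfloor> / (s n * ln (real n))"
      using elim by (intro divide_right_mono) linarith+
    finally show ?case .
  qed
  show "eventually (\<lambda>n. of_int \<lfloor>s n * ln (real n)\<rfloor> / (s n * ln (real n)) \<le> 1) sequentially"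
    using sL by (rule eventually_mono) (simp add: divide_le_eq)
  have "(\<lambda>n. 1 - 1 / (s n * ln (real n))) \<longlonglongrightarrow> 1 - 0"
    by (intro tendsto_diff tendsto_const real_tendsto_divide_at_top[OF tendsto_const s_ln])
  then show "(\<lambda>n. 1 - 1 / (s n * ln (real n))) \<longlonglongrightarrow> 1" by simp
qed simp

lemma weight_converges:
  assumes v: "eventually (\<lambda>n. v n = u n) sequentially"
  shows "converges_in_probability M
    (\<lambda>n \<omega>. min_path_weight n (\<lambda>e. X n e \<omega>) / (v n * s n * ln (real n))) (exp 1)"
  unfolding converges_in_probability_def
proof (intro conjI allI impI)
  let ?W = "\<lambda>n \<omega>. min_path_weight n (\<lambda>e. X n e \<omega>)"
  show meas: "(\<lambda>\<omega>. ?W n \<omega> / (v n * s n * ln (real n))) \<in> borel_measurable (M n)" for n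
  proof -
    interpret iid_weights "M n" n "X n" "F n" by (rule weights)
    note [measurable] = min_path_weight_measurable
    show ?thesis by measurable
  qed
  fix \<delta> :: real assume \<delta>: "0 < \<delta>"
  have "(\<lambda>n. (1 - \<epsilon> n) * exp 1 * (of_int \<lfloor>s n * ln (real n)\<rfloor> / (s n * ln (real n)))) \<longlonglongrightarrow> (1 - 0) * exp 1 * 1"
    by (intro tendsto_intros \<epsilon>_tendsto floor_ratio_tendsto)
  then have lo: "eventually (\<lambda>n. exp 1 - \<delta> < (1 - \<epsilon> n) * exp 1 * (of_int \<lfloor>s n * ln (real n)\<rfloor> / (s n * ln (real n)))) sequentially"
    by (rule order_tendstoD) (use \<delta> in simp)
  have "(\<lambda>n. exp 1 * (k n / (s n * ln (real n)))) \<longlonglongrightarrow> exp 1 * 1"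
    by (intro tendsto_intros k_ratio_tendsto)
  then have up: "eventually (\<lambda>n. exp 1 * (k n / (s n * ln (real n))) < exp 1 + \<delta>) sequentially"
    by (rule order_tendstoD) (use \<delta> in simp)
  have sL: "eventually (\<lambda>n. 1 \<le> s n * ln (real n)) sequentially" using s_ln by (simp add: filterlim_at_top)
  show "(\<lambda>n. measure (M n) {\<omega> \<in> space (M n). \<bar>?W n \<omega> / (v n * s n * ln (real n)) - exp 1\<bar> > \<delta>}) \<longlonglongrightarrow> 0"
  proof (rule tendsto_sandwich[OF always_eventually _ tendsto_const prob_outside_tendsto])
    show "eventually (\<lambda>n. measure (M n) {\<omega> \<in> space (M n). \<bar>?W n \<omega> / (v n * s n * ln (real n)) - exp 1\<bar> > \<delta>}
      \<le> measure (M n) {\<omega> \<in> space (M n). ?W n \<omega> < weight_lower_bound n} + measure (M n) {\<omega> \<in> space (M n). weight_upper_bound n < ?W n \<omega>}) sequentially"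
      using v lo up sL z eventually_ge_at_top[of 1]
    proof eventually_elim
      case (elim n)
      interpret iid_weights "M n" n "X n" "F n" by (rule weights)
      let ?A = "{\<omega> \<in> space (M n). ?W n \<omega> < weight_lower_bound n}" and ?B = "{\<omega> \<in> space (M n). weight_upper_bound n < ?W n \<omega>}"
      have AB: "?A \<in> events" "?B \<in> events" by (rule events_min_path_weight)+
      have u: "0 < u n" using elim by (simp add: u_def)
      define q where "q = u n * (s n * ln (real n))"
      have q: "0 < q" using u elim by (simp add: q_def)
      have cancel: "a * (b / l) * (c * l) = a * b * c" if "1 \<le> l" for a b c l :: real
        using that by simp
      have lo_q: "(exp 1 - \<delta>) * q < weight_lower_bound n"
      proof -
        have "(exp 1 - \<delta>) * q < (1 - \<epsilon> n) * exp 1 * (of_int \<lfloor>s n * ln (real n)\<rfloor> / (s n * ln (real n))) * q"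
          using elim q by (intro mult_strict_right_mono) auto
        also have "\<dots> = weight_lower_bound n" unfolding weight_lower_bound_def q_def using elim by (simp only: cancel)
        finally show ?thesis .
      qed
      have up_q: "weight_upper_bound n < (exp 1 + \<delta>) * q"
      proof -
        have "weight_upper_bound n = exp 1 * (k n / (s n * ln (real n))) * q"
          unfolding weight_upper_bound_def q_def k_eq_ceiling[OF elim(6), symmetric] using elim(4) by (simp only: cancel)
        also have "\<dots> < (exp 1 + \<delta>) * q" using elim q by (intro mult_strict_right_mono) auto
        finally show ?thesis .
      qed
      have "{\<omega> \<in> space (M n). \<bar>?W n \<omega> / (v n * s n * ln (real n)) - exp 1\<bar> > \<delta>} \<subseteq> ?A \<union> ?B"
      proof
        fix \<omega> assume \<omega>: "\<omega> \<in> {\<omega> \<in> space (M n). \<bar>?W n \<omega> / (v n * s n * ln (real n)) - exp 1\<bar> > \<delta>}"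
        have "v n * s n * ln (real n) = q" using elim by (simp add: q_def)
        then consider "?W n \<omega> / q < exp 1 - \<delta>" | "exp 1 + \<delta> < ?W n \<omega> / q" using \<omega> by fastforce
        then show "\<omega> \<in> ?A \<union> ?B"
        proof cases
          case 1
          then have "?W n \<omega> < (exp 1 - \<delta>) * q" using q by (simp add: pos_divide_less_eq)
          then show ?thesis using lo_q \<omega> by simp
        next
          case 2
          then have "(exp 1 + \<delta>) * q < ?W n \<omega>" using q by (simp add: pos_less_divide_eq)
          then show ?thesis using up_q \<omega> by simp
        qed
      qed
      then have "measure (M n) {\<omega> \<in> space (M n). \<bar>?W n \<omega> / (v n * s n * ln (real n)) - exp 1\<bar> > \<delta>} \<le> measure (M n) (?A \<union> ?B)"
        using AB by (intro finite_measure_mono sets.Un)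
      also have "\<dots> \<le> measure (M n) ?A + measure (M n) ?B" by (rule measure_Un_le[OF AB])
      finally show ?case .
    qed
  qed simp
qed

text \<open>If the minimal weight respects its upper bound, the minimal path is itself a light path,
  so an atypical hopcount forces a light path of atypical length. Almost sure uniqueness lets the
  hopcount be read off that path.\<close>

lemma hopcount_converges:
  "converges_in_probability M
    (\<lambda>n \<omega>. real (hopcount n (\<lambda>e. X n e \<omega>)) / (s n * ln (real n))) 1"
  unfolding converges_in_probability_def
proof (intro conjI allI impI)
  let ?W = "\<lambda>n \<omega>. min_path_weight n (\<lambda>e. X n e \<omega>)"
  let ?H = "\<lambda>n \<omega>. real (hopcount n (\<lambda>e. X n e \<omega>))"
  show "(\<lambda>\<omega>. ?H n \<omega> / (s n * ln (real n))) \<in> borel_measurable (M n)" for n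
  proof -
    interpret iid_weights "M n" n "X n" "F n" by (rule weights)
    note [measurable] = hopcount_measurable
    show ?thesis by measurable
  qed
  fix \<delta> :: real assume \<delta>: "0 < \<delta>"
  let ?A = "\<lambda>n. {\<omega> \<in> space (M n). exp 1 * k n * u n < ?W n \<omega>}"
  let ?B = "\<lambda>n. {\<omega> \<in> space (M n). \<exists>p\<in>self_avoiding_paths n 1 2.
      length p - 1 \<in> {j. \<delta> < \<bar>real j / (s n * ln n) - 1\<bar>} \<and>
      path_weight (\<lambda>e. X n e \<omega>) p \<le> exp 1 * k n * u n}"
  show "(\<lambda>n. measure (M n) {\<omega> \<in> space (M n). \<bar>?H n \<omega> / (s n * ln (real n)) - 1\<bar> > \<delta>}) \<longlonglongrightarrow> 0"
  proof (rule tendsto_sandwich[OF always_eventually _ tendsto_const])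
    show "(\<lambda>n. measure (M n) (?A n) + measure (M n) (?B n)) \<longlonglongrightarrow> 0"
      using tendsto_add[OF prob_gt_upper_bound_tendsto prob_light_path_of_atypical_length_tendsto[OF \<delta>]] by simp
    show "eventually (\<lambda>n. measure (M n) {\<omega> \<in> space (M n). \<bar>?H n \<omega> / (s n * ln (real n)) - 1\<bar> > \<delta>}
        \<le> measure (M n) (?A n) + measure (M n) (?B n)) sequentially"
      using eventually_ge_at_top[of 2]
    proof eventually_elim
      case (elim n)
      interpret iid_weights "M n" n "X n" "F n" by (rule weights)
      have A: "?A n \<in> events" by (rule events_min_path_weight)
      have B: "?B n \<in> events"
      proof (rule sets.sets_Collect_finite_Ex)
        fix p assume p: "p \<in> self_avoiding_paths n 1 2"
        note [measurable] = measurable_path_weight[OF p]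
        show "{\<omega> \<in> space (M n). length p - 1 \<in> {j. \<delta> < \<bar>real j / (s n * ln n) - 1\<bar>} \<and>
            path_weight (\<lambda>e. X n e \<omega>) p \<le> exp 1 * k n * u n} \<in> events" by measurable
      qed simp
      have "measure (M n) {\<omega> \<in> space (M n). \<bar>?H n \<omega> / (s n * ln (real n)) - 1\<bar> > \<delta>} \<le> measure (M n) (?A n \<union> ?B n)"
      proof (rule finite_measure_mono_AE)
        show "?A n \<union> ?B n \<in> events" using A B by (rule sets.Un)
        show "AE \<omega> in M n. \<omega> \<in> {\<omega> \<in> space (M n). \<bar>?H n \<omega> / (s n * ln (real n)) - 1\<bar> > \<delta>} \<longrightarrow> \<omega> \<in> ?A n \<union> ?B n"
          using AE_path_weight_inj[of 1 2]
        proof (rule AE_mp, intro AE_I2 impI)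
          fix \<omega> assume \<omega>: "inj_on (path_weight (\<lambda>e. X n e \<omega>)) (self_avoiding_paths n 1 2)"
              "\<omega> \<in> {\<omega> \<in> space (M n). \<bar>?H n \<omega> / (s n * ln (real n)) - 1\<bar> > \<delta>}"
          obtain p where p: "p \<in> self_avoiding_paths n 1 2" "path_weight (\<lambda>e. X n e \<omega>) p = ?W n \<omega>"
              "hopcount n (\<lambda>e. X n e \<omega>) = length p - 1"
            by (rule hopcount_eq[OF \<omega>(1) elim])
          show "\<omega> \<in> ?A n \<union> ?B n"
          proof (cases "exp 1 * k n * u n < ?W n \<omega>")
            case False
            then have "length p - 1 \<in> {j. \<delta> < \<bar>real j / (s n * ln n) - 1\<bar>} \<and>
                path_weight (\<lambda>e. X n e \<omega>) p \<le> exp 1 * k n * u n"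
              using p \<omega>(2) by auto
            then show ?thesis using p(1) \<omega>(2) by blast
          qed (use \<omega>(2) in simp)
        qed
      qed
      also have "\<dots> \<le> measure (M n) (?A n) + measure (M n) (?B n)" by (rule measure_Un_le[OF A B])
      finally show ?case .
    qed
  qed simp
qed

end

section \<open>Powers of one positive random variable\<close>

lemma cdf_powr_eq:
  fixes Z :: "'b \<Rightarrow> real"
  assumes "prob_space N" and Z: "Z \<in> borel_measurable N" and pos: "AE \<omega> in N. 0 < Z \<omega>"
    and s: "0 < s" and y: "0 < y"
  shows "cdf (distr N borel (\<lambda>\<omega>. Z \<omega> powr s)) y = cdf (distr N borel Z) (y powr (1 / s))"
proof -
  interpret prob_space N by fact
  note [measurable] = Z
  have "cdf (distr N borel (\<lambda>\<omega>. Z \<omega> powr s)) y = prob ((\<lambda>\<omega>. Z \<omega> powr s) -` {..y} \<inter> space N)"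
    unfolding cdf_def by (rule measure_distr) measurable
  also have "\<dots> = prob (Z -` {..y powr (1 / s)} \<inter> space N)"
  proof (rule finite_measure_eq_AE)
    show "AE \<omega> in N. (\<omega> \<in> (\<lambda>\<omega>. Z \<omega> powr s) -` {..y} \<inter> space N) = (\<omega> \<in> Z -` {..y powr (1 / s)} \<inter> space N)"
      using pos
    proof (rule AE_mp, intro AE_I2 impI)
      fix \<omega> assume "0 < Z \<omega>"
      then have "Z \<omega> powr s \<le> y \<longleftrightarrow> Z \<omega> \<le> y powr (1 / s)"
        using s y powr_mono2[of s "Z \<omega>" "y powr (1 / s)"] powr_mono2[of "1 / s" "Z \<omega> powr s" y]
        by (auto simp: powr_powr)
      then show "(\<omega> \<in> (\<lambda>\<omega>. Z \<omega> powr s) -` {..y} \<inter> space N) = (\<omega> \<in> Z -` {..y powr (1 / s)} \<inter> space N)"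
        by simp
    qed
  qed measurable
  also have "\<dots> = cdf (distr N borel Z) (y powr (1 / s))"
    unfolding cdf_def by (rule measure_distr[symmetric]) (use Z in auto)
  finally show ?thesis .
qed

lemma cdf_zero_of_AE_pos:
  fixes Z :: "'b \<Rightarrow> real"
  assumes "prob_space N" and Z: "Z \<in> borel_measurable N" and pos: "AE \<omega> in N. 0 < Z \<omega>"
  shows "cdf (distr N borel Z) 0 = 0"
proof -
  interpret prob_space N by fact
  note [measurable] = Z
  have "cdf (distr N borel Z) 0 = prob (Z -` {..0} \<inter> space N)"
    unfolding cdf_def by (rule measure_distr) (use Z in auto)
  also have "\<dots> = prob {}"
  proof (rule finite_measure_eq_AE)
    show "AE \<omega> in N. (\<omega> \<in> Z -` {..0} \<inter> space N) = (\<omega> \<in> {})"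
      using pos by (rule AE_mp) (auto intro!: AE_I2)
  qed (use Z in \<open>auto intro: measurable_sets\<close>)
  finally show ?thesis by simp
qed

theorem theorem1p1:
  fixes N :: "'b measure" and Z :: "'b \<Rightarrow> real" and G :: "real \<Rightarrow> real"
    and xhat lam :: real and s :: "nat \<Rightarrow> real"
    and M :: "nat \<Rightarrow> 'a measure" and X :: "nat \<Rightarrow> nat set \<Rightarrow> 'a \<Rightarrow> real"
    and F :: "nat \<Rightarrow> real \<Rightarrow> real" and u \<epsilon> :: "nat \<Rightarrow> real" and W :: "nat \<Rightarrow> 'a \<Rightarrow> real"
    and H :: "nat \<Rightarrow> 'a \<Rightarrow> nat"
  assumes "prob_space N"
    and "Z \<in> borel_measurable N"
    and "AE \<omega> in N. 0 < Z \<omega>"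
    and "G = cdf (distr N borel Z)"
    and "continuous_on UNIV G"
    and "0 < xhat"
    and "C2_on_interval 0 xhat G"
    and "strict_mono_on {0..xhat} G"
    and "(deriv G \<longlongrightarrow> lam) (at_right 0)"
    and "0 < lam"
    and "\<And>n. 0 < s n"
    and "s \<longlonglongrightarrow> 0"
    and "filterlim (\<lambda>n. s n * ln (real n)) at_top sequentially"
    and "(\<lambda>n. (s n)\<^sup>2 * ln (real n)) \<longlonglongrightarrow> 0"
    and "\<And>n. iid_edge_weights (M n) n (X n) (F n)"
    and "\<And>n e. e \<in> complete_graph_edges n \<Longrightarrow>
           distr (M n) borel (X n e) = distr N borel (\<lambda>\<omega>. Z \<omega> powr s n)"
  defines "u \<equiv> \<lambda>n. weight_scale n (F n)"
    and "W \<equiv> \<lambda>n \<omega>. min_path_weight n (\<lambda>e. X n e \<omega>)"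
    and "H \<equiv> \<lambda>n \<omega>. hopcount n (\<lambda>e. X n e \<omega>)"
    and "\<epsilon> \<equiv> \<lambda>n. sqrt (s n * ln (ln (real n)))"
  shows "with_high_probability M (\<lambda>n \<omega>.
           (1 - \<epsilon> n) * exp 1 * of_int \<lfloor>s n * ln (real n)\<rfloor> * u n \<le> W n \<omega> \<and>
           W n \<omega> \<le> exp 1 * of_int \<lceil>s n * ln (real n)\<rceil> * u n) \<and>
         \<epsilon> \<longlonglongrightarrow> 0 \<and>
         converges_in_probability M (\<lambda>n \<omega>. W n \<omega> / (u n * s n * ln (real n))) (exp 1) \<and>
         converges_in_probability M (\<lambda>n \<omega>. real (H n \<omega>) / (s n * ln (real n))) 1"
proof -
  interpret N: prob_space N by fact
  interpret DZ: real_distribution "distr N borel Z" using assms(2) by (rule N.real_distribution_distr)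
  have G0: "G 0 = 0" using cdf_zero_of_AE_pos[OF assms(1-3)] assms(4) by simp
  have Gmono: "x \<le> y \<Longrightarrow> G x \<le> G y" for x y using DZ.cdf_nondecreasing assms(4) by simp
  have G1: "G x \<le> 1" for x using DZ.cdf_bounded_prob assms(4) by simp
  obtain C where C: "0 \<le> C" "\<And>x. x \<in> {0..xhat} \<Longrightarrow> \<bar>G x - G 0 - lam * x\<bar> \<le> C * x\<^sup>2"
    using C2_on_interval_quadratic_error[OF assms(6,7,9)] by blast
  \<comment> \<open>Up to \<open>x1\<close> the quadratic error is at most half the linear term. The
    summand 1 covers the case \<open>C = 0\<close>.\<close>
  define x1 where "x1 = min xhat (lam / (2 * C + 1))"
  have x1: "0 < x1" "x1 \<le> xhat" "C * x1 \<le> lam / 2"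
  proof -
    show "0 < x1" "x1 \<le> xhat" using assms(6,10) C(1) by (auto simp: x1_def)
    have "C * x1 \<le> C * (lam / (2 * C + 1))" using C(1) by (intro mult_left_mono) (auto simp: x1_def)
    also have "\<dots> \<le> lam / 2" using C(1) assms(10) by (simp add: field_simps)
    finally show "C * x1 \<le> lam / 2" .
  qed
  have quad: "\<bar>G x - lam * x\<bar> \<le> C * x\<^sup>2" if "0 \<le> x" "x \<le> x1" for x
    using C(2)[of x] that x1 G0 by simp
  have Cx2: "C * x\<^sup>2 \<le> lam / 2 * x" if "0 \<le> x" "x \<le> x1" for x
  proof -
    have "C * x \<le> C * x1" using that C(1) by (intro mult_left_mono) auto
    then have "(C * x) * x \<le> (lam / 2) * x" using that x1 by (intro mult_right_mono) auto
    then show ?thesis by (simp add: power2_eq_square mult.assoc)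
  qed
  have G_ge: "lam / 2 * x \<le> G x" and G_le: "G x \<le> 2 * lam * x" if "0 \<le> x" "x \<le> x1" for x
  proof -
    have "0 \<le> lam * x" using that assms(10) by simp
    then show "lam / 2 * x \<le> G x" "G x \<le> 2 * lam * x" using quad[OF that] Cx2[OF that] by linarith+
  qed
  \<comment> \<open>The first value serves below \<open>x1\<close>; beyond \<open>x1\<close> it is
    enough that \<open>G\<close> is at most 1.\<close>
  define B where "B = max (2 * lam) (1 / x1)"
  have B: "0 \<le> B" "G x \<le> B * x" if "0 < x" for x
  proof -
    show "0 \<le> B" using assms(10) by (simp add: B_def)
    show "G x \<le> B * x"
    proof (cases "x \<le> x1")
      case True
      have "2 * lam * x \<le> B * x" using that by (intro mult_right_mono) (auto simp: B_def)
      moreover have "G x \<le> 2 * lam * x" using that True by (intro G_le) auto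
      ultimately show ?thesis by linarith
    next
      case False
      have "1 \<le> 1 / x1 * x" using False x1 by (simp add: field_simps)
      also have "\<dots> \<le> B * x" using that by (intro mult_right_mono) (auto simp: B_def)
      finally show ?thesis using G1[of x] by linarith
    qed
  qed
  have F: "F n y = G (y powr (1 / s n))" if n: "2 \<le> n" and y: "0 < y" for n y
  proof -
    have e: "{1, 2} \<in> complete_graph_edges n" using n by simp
    have "F n = cdf (distr (M n) borel (X n {1, 2}))"
      using assms(15)[of n] e by (simp add: iid_edge_weights_def)
    also have "\<dots> = cdf (distr N borel (\<lambda>\<omega>. Z \<omega> powr s n))" using assms(16)[OF e] by simp
    finally show ?thesis using cdf_powr_eq[OF assms(1-3) assms(11) y] assms(4) by simp
  qed
  have scale: "eventually (\<lambda>n. \<exists>y. 0 < y \<and> y \<le> x1 \<and> G y = 1 / n \<and> y \<le> 2 / (lam * n) \<and> u n = y powr s n) sequentially"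
  proof -
    have Gx1: "0 < G x1" using G_ge[of x1] x1 mult_pos_pos[OF assms(10) x1(1)] by simp
    have "(\<lambda>n. 1 / real n) \<longlonglongrightarrow> 0" by (rule lim_1_over_n)
    then have "eventually (\<lambda>n. 1 / real n < G x1) sequentially" using Gx1 by (rule order_tendstoD)
    then show ?thesis
      using eventually_ge_at_top[of 2]
    proof eventually_elim
      case (elim n)
      have n: "0 < real n" using elim by simp
      have "\<exists>y\<ge>0. y \<le> x1 \<and> G y = 1 / n"
        by (rule IVT') (use elim G0 x1 assms(5) continuous_on_subset in \<open>auto intro: less_imp_le\<close>)
      then obtain y where y: "0 \<le> y" "y \<le> x1" "G y = 1 / n" by blast
      have y0: "0 < y" using y G0 n by (cases "y = 0") auto
      have "lam / 2 * y \<le> 1 / n" using G_ge[of y] y by simp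
      then have y2: "y \<le> 2 / (lam * n)" using n assms(10) by (simp add: field_simps)
      have s: "0 < s n" by (rule assms(11))
      have "weight_scale n (F n) = y powr s n"
        unfolding weight_scale_def
      proof (rule the_equality)
        show "0 < y powr s n \<and> real n * F n (y powr s n) = 1"
          using F[of n "y powr s n"] elim y y0 s n by (simp add: powr_powr)
        fix c assume c: "0 < c \<and> real n * F n c = 1"
        define x where "x = c powr (1 / s n)"
        have x: "0 < x" "G x = 1 / n" using c F[of n c] elim n by (auto simp: x_def field_simps)
        \<comment> \<open>A solution beyond \<open>x1\<close> is excluded by monotonicity and
          \<open>1 / n < G x1\<close>; below \<open>x1\<close>, strict monotonicity gives
          uniqueness.\<close>
        have "x \<le> x1"
        proof (rule ccontr)
          assume "\<not> x \<le> x1"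
          then have "G x1 \<le> G x" by (intro Gmono) simp
          then show False using x elim by simp
        qed
        then have "x = y"
          using strict_mono_on_eqD[OF assms(8), of x y] x y x1 by simp
        then show "c = y powr s n" using c s by (auto simp: x_def powr_powr)
      qed
      then show ?case using y y0 y2 by (auto simp: u_def)
    qed
  qed
  \<comment> \<open>Recovering the quantile from \<open>u n\<close> defines it for every
    \<open>n\<close> at once, without choosing witnesses.\<close>
  define z where "z n = u n powr (1 / s n)" for n
  have z: "eventually (\<lambda>n. (0 < z n \<and> z n \<le> x1 \<and> G (z n) = 1 / n \<and> z n \<le> 2 / (lam * n)) \<and> u n = z n powr s n) sequentially"
    using scale
  proof eventually_elim
    case (elim n)
    then obtain y where y: "0 < y" "y \<le> x1" "G y = 1 / n" "y \<le> 2 / (lam * n)" "u n = y powr s n" by blast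
    have "z n = y" using y(1,5) assms(11)[of n] by (simp add: z_def powr_powr)
    then show ?case using y by simp
  qed
  interpret P: fpp_power_weights M X F G lam C x1 B s z
  proof
    show "eventually (\<lambda>n. 0 < z n \<and> z n \<le> x1 \<and> G (z n) = 1 / n \<and> z n \<le> 2 / (lam * n)) sequentially"
      using z by (rule eventually_mono) simp
    show "0 \<le> B" by (rule B(1)[of 1]) simp
  qed (use assms F quad B x1 C in auto)
  have u: "eventually (\<lambda>n. u n = P.u n) sequentially"
    using z by (rule eventually_mono) (simp add: P.u_def)
  have \<epsilon>: "\<epsilon> = P.\<epsilon>" by (simp add: \<epsilon>_def P.\<epsilon>_def fun_eq_iff)
  show ?thesis
    unfolding W_def H_def \<epsilon>
    using P.whp_weight_bounds[OF u] P.\<epsilon>_tendsto P.weight_converges[OF u] P.hopcount_converges by blast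
qed

end
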